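(* Let $N\ge2$, $\Omega:=\mathbb{R}^N_+=\{x\in\mathbb{R}^N: x_N>0\}$, $x':=(x_2,\dots,x_N)$, let $L\subset\partial\Omega$ be the straight line $\{x=(x_1,0,\dots,0)\}$, and let $a\in L$. Let $$1<p<p_0:=1+\frac{2}{N-1}.$$ Let $\omega\in C(0,\infty)$ be a positive nondecreasing function, put $\mu(s):=\omega(s)/s$ and $h_\omega(s):=\exp(-\omega(s)/s)$, and assume that $\mu$ is monotonically decreasing on $(0,\infty)$, that $\lim_{s\to0}\mu(s)=\infty$, and that $$\limsup_{j\to\infty}\mu\left(2^{-j+1}\right)\mu\left(2^{-j}\right)^{-1}<1,\qquad \omega(s)\to0\ \text{ as } s\to0.$$ Assume also that the Dini condition $\int_0^c s^{-1}\omega(s)\,ds<\infty$ is not satisfied, namely $$\int_0^1 s^{-1}\omega(s)\,ds=\infty .$$ Let $\{K_j\}$ be an arbitrary monotonically increasing sequence of positive numbers with $K_j\to\infty$ as $j\to\infty$, and let $\{u_j\}$ be the sequence of solutions of the problems $$-\Delta u+h_\omega(|x'|)u^p=0\ \text{ in }\Omega,\qquad u|_{x_N=0}=K_j\,\delta_a(x).$$ Then $u_\infty(x):=\lim_{j\to\infty}u_j(x)$ is a solution of $-\Delta u+h_\omega(|x'|)u^p=0$ in $\Omega$ which satisfies $$u_\infty|_{\partial\Omega\setminus L}=0,\qquad u_\infty|_{\partial\Omega\cap L}=\infty .$$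
   Context: $\delta_a$ is the Dirac measure on $\partial\Omega=\{x_N=0\}$ at the point $a$. Let $P_0(x,z)=c_Nx_N|x-z|^{-N}$, $c_N=\pi^{-N/2}\Gamma(N/2)$, be the Poisson kernel for $-\Delta$ in $\mathbb{R}^N_+$. The condition $\int_{\{|x|<R,\,x_N>0\}}h_\omega(|x'|)P_0(x,a)^px_N\,dx<\infty$ for all $0<R<\infty$ guarantees that for each $K>0$ the problem with boundary datum $K\delta_a$ has a unique solution dominated by the supersolution $KP_0(x,a)$; this is the solution meant, with $K=K_j$. By the comparison principle the sequence $u_j$ is monotonically nondecreasing in $j$, and it is bounded above by the maximal solution of the equation in $\Omega$, so the limit $u_\infty$ exists. *)

theory Defs
  imports "HOL-Probability.Probability"
begin

text \<open>
  Points of the Euclidean N-space are vectors of type \<^typ>\<open>real ^ 'n\<close> with N = CARD('n). The index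
  \<open>n\<close> stands for the last coordinate (the one that is positive in the half-space), the index
  \<open>f\<close> for the first one (the direction of the line L). The coordinate order plays no other role, so
  they are just two distinct indices.
\<close>

definition half_space :: "'n::finite \<Rightarrow> (real ^ 'n) set" where
  "half_space n = {x. x $ n > 0}"

definition axis_line :: "'n::finite \<Rightarrow> (real ^ 'n) set" where
  "axis_line f = {x. \<forall>i. i \<noteq> f \<longrightarrow> x $ i = 0}"

text \<open>The length \<open>|x'|\<close> of the vector \<open>x'\<close> of all coordinates except the one with index \<open>f\<close>.\<close>

definition transverse_norm :: "'n::finite \<Rightarrow> real ^ 'n \<Rightarrow> real" where
  "transverse_norm f x = sqrt (\<Sum>i\<in>UNIV - {f}. (x $ i)\<^sup>2)"

definition mu :: "(real \<Rightarrow> real) \<Rightarrow> real \<Rightarrow> real" where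
  "mu \<omega> s = \<omega> s / s"

definition h_weight :: "(real \<Rightarrow> real) \<Rightarrow> real \<Rightarrow> real" where
  "h_weight \<omega> s = exp (- \<omega> s / s)"

definition poisson_kernel :: "'n::finite \<Rightarrow> real ^ 'n \<Rightarrow> real ^ 'n \<Rightarrow> real" where
  "poisson_kernel n x z =
     pi powr (- real CARD('n) / 2) * Gamma (real CARD('n) / 2) * x $ n / norm (x - z) ^ CARD('n)"

definition partial :: "'n::finite \<Rightarrow> (real ^ 'n \<Rightarrow> real) \<Rightarrow> real ^ 'n \<Rightarrow> real" where
  "partial i \<zeta> x = frechet_derivative \<zeta> (at x) (axis i 1)"

definition laplacian :: "(real ^ 'n::finite \<Rightarrow> real) \<Rightarrow> real ^ 'n \<Rightarrow> real" where
  "laplacian \<zeta> x = (\<Sum>i\<in>UNIV. partial i (partial i \<zeta>) x)"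

definition C2 :: "(real ^ 'n::finite \<Rightarrow> real) \<Rightarrow> bool" where
  "C2 \<zeta> \<longleftrightarrow> \<zeta> differentiable_on UNIV \<and> (\<forall>i. partial i \<zeta> differentiable_on UNIV) \<and>
     (\<forall>i j. continuous_on UNIV (partial i (partial j \<zeta>)))"

definition supp :: "(real ^ 'n::finite \<Rightarrow> real) \<Rightarrow> (real ^ 'n) set" where
  "supp \<zeta> = closure {x. \<zeta> x \<noteq> 0}"

text \<open>
  Nonnegative solutions of \<open>- \<Delta> u + g u\<^sup>p = 0\<close> in the half-space, in the sense of distributions;
  \<open>u\<close> is the continuous representative. Values of \<open>u\<close> outside the half-space are irrelevant.
\<close>

definition interior_solution ::
  "'n::finite \<Rightarrow> (real ^ 'n \<Rightarrow> real) \<Rightarrow> real \<Rightarrow> (real ^ 'n \<Rightarrow> real) \<Rightarrow> bool" where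
  "interior_solution n g p u \<longleftrightarrow>
     continuous_on (half_space n) u \<and> (\<forall>x\<in>half_space n. 0 \<le> u x) \<and>
     (\<forall>\<zeta>. C2 \<zeta> \<and> compact (supp \<zeta>) \<and> supp \<zeta> \<subseteq> half_space n \<longrightarrow>
        (LINT x:half_space n|lborel. - u x * laplacian \<zeta> x + g x * u x powr p * \<zeta> x) = 0)"

text \<open>
  Weak solutions of \<open>- \<Delta> u + g u\<^sup>p = 0\<close> in the half-space with a measure \<open>\<nu>\<close> as boundary value. The
  test functions are \<open>C\<^sup>2\<close> with compact support and vanish on the boundary. Green's formula then
  leaves as boundary term minus the \<open>\<nu>\<close>-integral of the outer normal derivative of \<open>\<zeta>\<close>; the outer
  normal is minus the \<open>n\<close>-th unit vector, which gives the positive sign below.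
\<close>

definition measure_boundary_solution ::
  "'n::finite \<Rightarrow> (real ^ 'n \<Rightarrow> real) \<Rightarrow> real \<Rightarrow> (real ^ 'n) measure \<Rightarrow> (real ^ 'n \<Rightarrow> real) \<Rightarrow> bool" where
  "measure_boundary_solution n g p \<nu> u \<longleftrightarrow>
     continuous_on (half_space n) u \<and> (\<forall>x\<in>half_space n. 0 \<le> u x) \<and>
     (\<forall>R>0. set_integrable lborel (half_space n \<inter> ball 0 R) u) \<and>
     (\<forall>R>0. set_integrable lborel (half_space n \<inter> ball 0 R) (\<lambda>x. g x * u x powr p * x $ n)) \<and>
     (\<forall>\<zeta>. C2 \<zeta> \<and> compact (supp \<zeta>) \<and> (\<forall>x\<in>frontier (half_space n). \<zeta> x = 0) \<longrightarrow>
        (LINT x:half_space n|lborel. - u x * laplacian \<zeta> x + g x * u x powr p * \<zeta> x) =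
        (LINT y:frontier (half_space n)|\<nu>. partial n \<zeta> y))"

text \<open>
  The solution with boundary value \<open>K \<delta>\<^sub>a\<close>: the weak solution dominated by the supersolution
  \<open>K P\<^sub>0(\<cdot>, a)\<close>.
\<close>

definition dirac_boundary_solution ::
  "'n::finite \<Rightarrow> (real ^ 'n \<Rightarrow> real) \<Rightarrow> real \<Rightarrow> real \<Rightarrow> real ^ 'n \<Rightarrow> (real ^ 'n \<Rightarrow> real) \<Rightarrow> bool" where
  "dirac_boundary_solution n g p K a u \<longleftrightarrow>
     measure_boundary_solution n g p (scale_measure (ennreal K) (return borel a)) u \<and>
     (\<forall>x\<in>half_space n. u x \<le> K * poisson_kernel n x a)"

definition boundary_value_zero_on :: "'n::finite \<Rightarrow> (real ^ 'n) set \<Rightarrow> (real ^ 'n \<Rightarrow> real) \<Rightarrow> bool" where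
  "boundary_value_zero_on n S u \<longleftrightarrow> (\<forall>y\<in>S. (u \<longlongrightarrow> 0) (at y within half_space n))"

text \<open>
  The integral of \<open>u\<close> over the part of the hyperplane \<open>{x. x $ n = \<epsilon>}\<close> in \<open>ball b r\<close>, with respect to
  (N-1)-dimensional Lebesgue measure.
\<close>

definition slice_mass :: "'n::finite \<Rightarrow> (real ^ 'n \<Rightarrow> real) \<Rightarrow> real ^ 'n \<Rightarrow> real \<Rightarrow> real \<Rightarrow> ennreal" where
  "slice_mass n u b r \<epsilon> =
     (\<integral>\<^sup>+ y. (let x = (\<chi> i. if i = n then \<epsilon> else y i) in ennreal (u x) * indicator (ball b r) x)
        \<partial>(Pi\<^sub>M (UNIV - {n}) (\<lambda>_. lborel)))"

text \<open>
  Boundary value \<open>\<infinity>\<close> on the line with direction \<open>f\<close>. If N > 2, every point of the line is a limit of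
  boundary points off the line, so a function with boundary value 0 off the line cannot have the
  unrestricted limit \<open>\<infinity>\<close> at a point of the line. The limit is therefore taken in the wedges
  \<open>x\<^sub>N \<ge> \<kappa> |x'|\<close> around the line; they contain all nontangential cones at its points, and for N = 2
  and \<open>\<kappa> \<le> 1\<close> they are the whole half-plane. The second condition says that the boundary trace of
  \<open>u\<close> has infinite mass in every neighbourhood of every point of the line; it excludes,
  for instance, the trace being a finite measure with a density on the line.
\<close>

definition boundary_value_infinite_on ::
  "'n::finite \<Rightarrow> 'n \<Rightarrow> (real ^ 'n) set \<Rightarrow> (real ^ 'n \<Rightarrow> real) \<Rightarrow> bool" where
  "boundary_value_infinite_on n f S u \<longleftrightarrow> (\<forall>b\<in>S.
     (\<forall>\<kappa>>0. filterlim u at_top (at b within {x\<in>half_space n. x $ n \<ge> \<kappa> * transverse_norm f x})) \<and>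
     (\<forall>r>0. (slice_mass n u b r \<longlongrightarrow> \<infinity>) (at_right 0)))"

end

theory Submission
  imports Defs "HOL-Real_Asymp.Real_Asymp"
begin

text \<open>
  All potential theory is derived from one family of test functions, the bumps
  \<open>(l\<^sup>2 - |x - c|\<^sup>2)\<^sub>+\<^sup>3\<close>: the \<open>l\<close>-derivative of the mean of a function with kernel
  \<open>(l\<^sup>2 - |x - c|\<^sup>2)\<^sub>+\<^sup>2 / l\<^sup>N\<^sup>+\<^sup>4\<close> is a positive multiple of its integral against the Laplacian of the
  bump. This gives a maximum principle for continuous weak subsolutions. Testing the equation with
  a bump minus its mirror image shows that a solution with boundary value \<open>K \<delta>\<^sub>a\<close> lies between
  \<open>c K x\<^sub>N |x - a|\<^sup>-\<^sup>N - A x\<^sub>N |x - a|\<^sup>-\<^sup>\<beta>\<close> and \<open>c K x\<^sub>N |x - a|\<^sup>-\<^sup>N\<close>, where \<open>\<beta> = (N - 1) p - 1\<close>, and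
  \<open>\<beta> < N\<close> is the condition \<open>p < p\<^sub>0\<close>. Comparison near \<open>a\<close> is therefore decided by the masses, so that
  the solutions increase; Keller-Osserman and boundary barriers control the limit off the line.

  For the propagation, the absorption coefficient is at most \<open>exp (- \<mu>(r))\<close> at distance \<open>r\<close> from
  the line, so below the level \<open>exp (\<mu>(r) / (p - 1))\<close> the equation behaves linearly and a Harnack chain
  along the line loses a constant factor per step of length \<open>r\<close>. Since \<open>\<mu>\<close> grows geometrically on the
  dyadic radii, a solution that attains this level at the radius \<open>r/2\<close> attains the
  corresponding level at the radius \<open>r\<close> even after moving by a distance comparable to
  \<open>r \<mu>(r) = \<omega>(r)\<close>. The failure of the Dini condition makes the total distance infinite.
\<close>

section \<open>Bump functions and their means\<close>

text \<open>The cube in the bump is the lowest power of the truncated quadratic that is twice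
  continuously differentiable, so that a bump minus its mirror image is an admissible test function.
  The pole is the delicate point of the comparison: two solutions meet at \<open>a\<close> only
  through the leading terms of their expansions there. Upper and lower bound must therefore carry
  the same constant, and it is obtained from the weak formulation itself, by integrating the
  derivative of the means over all radii. In the propagation the index of the solution is left free.
  For a point of the line and a scale, first a much finer scale is chosen, such that \<omega> summed
  over the scales in between covers the distance to \<open>a\<close>, and then a mass so large that
  the level of the finest scale is attained above \<open>a\<close>. Since every point and every
  small scale can be reached in this way, and since the level outgrows every power of the inverse
  radius, one estimate yields both the limit in the wedges and the infinite mass of the
  slices.\<close>

lemma integral_translate:
  fixes f :: "'a::euclidean_space \<Rightarrow> real"
  assumes "f \<in> borel_measurable borel"
  shows "(LINT x|lborel. f (c + x)) = (LINT x|lborel. f x)"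
proof -
  have "(LINT x|lborel. f x) = (LINT x|distr lborel borel ((+) c). f x)"
    by (simp add: lborel_distr_plus)
  also have "\<dots> = (LINT x|lborel. f (c + x))"
    using assms by (subst integral_distr) auto
  finally show ?thesis by simp
qed

lemma integrable_translate:
  fixes f :: "'a::euclidean_space \<Rightarrow> real"
  assumes "integrable lborel f"
  shows "integrable lborel (\<lambda>x. f (c + x))"
proof -
  have "integrable (distr lborel borel ((+) c)) f"
    using assms by (simp add: lborel_distr_plus)
  then show ?thesis
    by (subst (asm) integrable_distr_eq) (use assms in auto)
qed

lemma integrable_bounded_support:
  fixes f :: "'a::euclidean_space \<Rightarrow> real"
  assumes "f \<in> borel_measurable borel" "\<And>x. \<bar>f x\<bar> \<le> B" "bounded S" "\<And>x. x \<notin> S \<Longrightarrow> f x = 0"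
  shows "integrable lborel f"
proof -
  obtain c r where S: "S \<subseteq> cball c r"
    using assms(3) bounded_subset_cball by blast
  have B0: "0 \<le> B" using assms(2)[of undefined] by linarith
  have i: "integrable lborel (\<lambda>x. B * indicator (cball c r) x)"
    using emeasure_lborel_cball_finite[of c r] by (intro integrable_mult_right integrable_real_indicator) auto
  have S': "f x = 0" if "x \<notin> cball c r" for x using S assms(4) that by blast
  show ?thesis
    by (rule Bochner_Integration.integrable_bound[OF i])
       (use assms(1,2) S' B0 in \<open>auto simp: indicator_def intro!: AE_I2\<close>)
qed

text \<open>Difference quotients in the direction \<open>e\<close> integrate to \<open>0\<close> by
  translation invariance. The mean value theorem bounds them by \<open>B\<close>, step factors at
  most \<open>1\<close> keep their supports in one ball, and dominated convergence gives the
  derivative.\<close>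

lemma integral_axis_derivative_zero:
  fixes \<phi> \<phi>' :: "'a::euclidean_space \<Rightarrow> real"
  assumes der: "\<And>x. ((\<lambda>t. \<phi> (x + t *\<^sub>R e)) has_real_derivative \<phi>' x) (at 0)"
    and bd: "\<And>x. \<bar>\<phi>' x\<bar> \<le> B" and S: "bounded S" "\<And>x. x \<notin> S \<Longrightarrow> \<phi> x = 0"
    and int: "integrable lborel \<phi>"
  shows "(LINT x|lborel. \<phi>' x) = 0"
proof -
  define q where "q m x = (\<phi> (x + (1 / real (Suc m)) *\<^sub>R e) - \<phi> x) * real (Suc m)" for m x
  obtain R where R: "S \<subseteq> cball 0 R" using S(1) by (metis bounded_iff mem_cball_0 subsetI)
  have B0: "0 \<le> B" using bd[of 0] by linarith
  have der': "((\<lambda>t. \<phi> (x + t *\<^sub>R e)) has_real_derivative \<phi>' (x + s *\<^sub>R e)) (at s)" for x s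
  proof -
    have "((\<lambda>t. \<phi> ((x + s *\<^sub>R e) + (t - s) *\<^sub>R e)) has_real_derivative \<phi>' (x + s *\<^sub>R e) * 1) (at s)"
      by (rule DERIV_chain2[where g="\<lambda>t. t - s"]) (use der[of "x + s *\<^sub>R e"] in \<open>auto intro!: derivative_eq_intros\<close>)
    moreover have "x + s *\<^sub>R e + (t - s) *\<^sub>R e = x + t *\<^sub>R e" for t
      by (simp add: scaleR_diff_left)
    ultimately show ?thesis by simp
  qed
  have [measurable]: "\<phi> \<in> borel_measurable borel"
    using borel_measurable_integrable[OF int] by simp
  have qm[measurable]: "q m \<in> borel_measurable borel" for m
    unfolding q_def by measurable
  have lim: "(\<lambda>m. q m x) \<longlonglongrightarrow> \<phi>' x" for x
  proof -
    have "((\<lambda>h. (\<phi> (x + h *\<^sub>R e) - \<phi> x) / h) \<longlongrightarrow> \<phi>' x) (at 0)"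
      using der[of x] by (simp add: has_field_derivative_iff)
    moreover have "filterlim (\<lambda>m. 1 / real (Suc m)) (at 0) sequentially"
      unfolding filterlim_at using LIMSEQ_inverse_real_of_nat by (auto simp: inverse_eq_divide)
    ultimately have "(\<lambda>m. (\<phi> (x + (1 / real (Suc m)) *\<^sub>R e) - \<phi> x) / (1 / real (Suc m))) \<longlonglongrightarrow> \<phi>' x"
      by (rule filterlim_compose)
    then show ?thesis by (simp add: q_def)
  qed
  have bound: "\<bar>q m x\<bar> \<le> B * indicator (cball 0 (R + norm e)) x" for m x
  proof -
    let ?h = "1 / real (Suc m)"
    have h: "0 < ?h" "?h \<le> 1" by auto
    obtain z where z: "\<phi> (x + ?h *\<^sub>R e) - \<phi> (x + 0 *\<^sub>R e) = (?h - 0) * \<phi>' (x + z *\<^sub>R e)"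
      using MVT2[OF h(1), of "\<lambda>t. \<phi> (x + t *\<^sub>R e)" "\<lambda>s. \<phi>' (x + s *\<^sub>R e)"] der' by blast
    then have qe: "q m x = \<phi>' (x + z *\<^sub>R e)" by (simp add: q_def)
    show ?thesis
    proof (cases "x \<in> cball 0 (R + norm e)")
      case True
      then show ?thesis using qe bd by simp
    next
      case False
      then have nx: "norm x > R + norm e" by simp
      have he: "norm (?h *\<^sub>R e) \<le> norm e" using mult_right_mono[OF h(2) norm_ge_zero[of e]] by simp
      have "norm (x + ?h *\<^sub>R e) > R" using nx he norm_triangle_ineq4[of "x + ?h *\<^sub>R e" "?h *\<^sub>R e"] by simp
      moreover have "norm x > R" using nx norm_ge_zero[of e] by linarith
      ultimately have "x \<notin> S" "x + ?h *\<^sub>R e \<notin> S" using R by auto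
      then show ?thesis using S(2) False by (simp add: q_def)
    qed
  qed
  have i: "integrable lborel (\<lambda>x::'a. B * indicator (cball 0 (R + norm e)) x)"
    using emeasure_lborel_cball_finite[of "0::'a" "R + norm e"] by (intro integrable_mult_right integrable_real_indicator) auto
  have [measurable]: "\<phi>' \<in> borel_measurable borel"
    using lim by (rule borel_measurable_LIMSEQ_real) measurable
  have "(\<lambda>m. LINT x|lborel. q m x) \<longlonglongrightarrow> (LINT x|lborel. \<phi>' x)"
    by (rule integral_dominated_convergence[OF _ _ i]) (simp_all add: lim bound)
  moreover have "(LINT x|lborel. q m x) = 0" for m
  proof -
    have "integrable lborel (\<lambda>x. \<phi> (x + (1 / real (Suc m)) *\<^sub>R e))"
      using integrable_translate[OF int, of "(1 / real (Suc m)) *\<^sub>R e"] by (simp add: add.commute)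
    moreover have "(LINT x|lborel. \<phi> (x + (1 / real (Suc m)) *\<^sub>R e)) = (LINT x|lborel. \<phi> x)"
      using integral_translate[of \<phi> "(1 / real (Suc m)) *\<^sub>R e"] by (simp add: add.commute)
    ultimately show ?thesis using int unfolding q_def
      by (simp add: Bochner_Integration.integral_diff del: of_nat_Suc)
  qed
  ultimately show ?thesis by (simp add: LIMSEQ_const_iff)
qed

text \<open>The mean value inequality turns the bound \<open>w\<close> for the derivative into one
  for the difference quotients; dominated convergence then applies along sequences.\<close>

lemma has_real_derivative_integral:
  fixes f f' :: "real \<Rightarrow> 'a \<Rightarrow> real"
  assumes t: "t \<in> {l<..<h}"
    and int: "\<And>s. s \<in> {l<..<h} \<Longrightarrow> integrable M (f s)"
    and der: "\<And>s x. s \<in> {l<..<h} \<Longrightarrow> ((\<lambda>s. f s x) has_real_derivative f' s x) (at s)"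
    and bd: "\<And>s x. s \<in> {l<..<h} \<Longrightarrow> \<bar>f' s x\<bar> \<le> w x" and w: "integrable M w"
  shows "((\<lambda>s. LINT x|M. f s x) has_real_derivative (LINT x|M. f' t x)) (at t)"
proof -
  have M: "f s \<in> borel_measurable M" if "s \<in> {l<..<h}" for s using int[OF that] by simp
  have eq: "at t = at t within {l<..<h}" using t at_within_open[of t "{l<..<h}"] by simp
  have "((\<lambda>y. ((LINT x|M. f y x) - (LINT x|M. f t x)) / (y - t)) \<longlongrightarrow> (LINT x|M. f' t x)) (at t within {l<..<h})"
  proof (subst tendsto_at_iff_sequentially, intro allI impI)
    fix X :: "nat \<Rightarrow> real" assume X: "\<forall>i. X i \<in> {l<..<h} - {t}" "X \<longlonglongrightarrow> t"
    have lim: "(\<lambda>i. (f (X i) x - f t x) / (X i - t)) \<longlonglongrightarrow> f' t x" for x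
    proof -
      have "((\<lambda>y. (f y x - f t x) / (y - t)) \<longlongrightarrow> f' t x) (at t)"
        using der[OF t, of x] by (simp add: has_field_derivative_iff)
      then show ?thesis unfolding tendsto_at_iff_sequentially using X by (auto simp: comp_def)
    qed
    have b: "\<bar>(f (X i) x - f t x) / (X i - t)\<bar> \<le> w x" for i x
    proof -
      have Xi: "X i \<in> {l<..<h}" "X i \<noteq> t" using X by auto
      have cs: "closed_segment t (X i) \<subseteq> {l<..<h}"
        using Xi t by (auto simp: closed_segment_eq_real_ivl split: if_splits)
      have "norm (f (X i) x - f t x) \<le> w x * norm (X i - t)"
      proof (rule field_differentiable_bound[of "closed_segment t (X i)" _ "\<lambda>s. f' s x"])
        fix z assume "z \<in> closed_segment t (X i)"
        then have z: "z \<in> {l<..<h}" using cs by blast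
        show "((\<lambda>s. f s x) has_field_derivative f' z x) (at z within closed_segment t (X i))"
          by (rule has_field_derivative_at_within[OF der[OF z]])
        show "norm (f' z x) \<le> w x" using bd[OF z] by simp
      qed auto
      then show ?thesis using Xi by (simp add: abs_divide divide_le_eq)
    qed
    have [measurable]: "f t \<in> borel_measurable M" "f (X i) \<in> borel_measurable M" for i
      using X(1) M t by auto
    have [measurable]: "(\<lambda>x. f' t x) \<in> borel_measurable M"
      by (rule borel_measurable_LIMSEQ_real[OF lim]) measurable
    have "(\<lambda>i. LINT x|M. (f (X i) x - f t x) / (X i - t)) \<longlonglongrightarrow> (LINT x|M. f' t x)"
      by (rule integral_dominated_convergence[OF _ _ w]) (simp_all add: lim b del: abs_divide)
    moreover have "(LINT x|M. (f (X i) x - f t x) / (X i - t)) = ((LINT x|M. f (X i) x) - (LINT x|M. f t x)) / (X i - t)" for i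
      using X int t by (subst Bochner_Integration.integral_divide_zero) (subst Bochner_Integration.integral_diff; auto)
    ultimately show "((\<lambda>y. ((LINT x|M. f y x) - (LINT x|M. f t x)) / (y - t)) \<circ> X) \<longlonglongrightarrow> (LINT x|M. f' t x)"
      by (simp only: comp_def)
  qed
  then show ?thesis unfolding has_field_derivative_iff using eq by simp
qed

text \<open>Applied with \<open>k = 1\<close> to the cube in \<open>bump\<close> and with
  \<open>k = 0\<close> to the square in its gradient. At \<open>s = 0\<close> the difference
  quotient is the next lower power of the positive part, which tends to \<open>0\<close>.\<close>

lemma DERIV_pos_part_power:
  "((\<lambda>s::real. max 0 s ^ Suc (Suc k)) has_real_derivative real (Suc (Suc k)) * max 0 s ^ Suc k) (at s)"
proof -
  consider "s > 0" | "s < 0" | "s = 0" by linarith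
  then show ?thesis
  proof cases
    case 1
    have "((\<lambda>s::real. s ^ Suc (Suc k)) has_real_derivative real (Suc (Suc k)) * max 0 s ^ Suc k) (at s)"
      using DERIV_pow[of "Suc (Suc k)" s UNIV] 1 by (simp add: max_def)
    then show ?thesis
      by (rule has_field_derivative_transform_within_open[where S="{0<..}"]) (use 1 in \<open>auto simp: max_def\<close>)
  next
    case 2
    have "((\<lambda>s::real. 0) has_real_derivative real (Suc (Suc k)) * max 0 s ^ Suc k) (at s)"
      using 2 by (auto intro!: derivative_eq_intros)
    then show ?thesis
      by (rule has_field_derivative_transform_within_open[where S="{..<0}"]) (use 2 in \<open>auto simp: max_def\<close>)
  next
    case 3
    have "((\<lambda>h::real. max 0 h ^ Suc k) \<longlongrightarrow> max 0 0 ^ Suc k) (at 0)"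
      by (intro tendsto_intros)
    then have "((\<lambda>h::real. max 0 h ^ Suc k) \<longlongrightarrow> 0) (at 0)" by simp
    then have "((\<lambda>h::real. max 0 h ^ Suc (Suc k) / h) \<longlongrightarrow> 0) (at 0)"
      by (rule Lim_transform_eventually) (auto simp: eventually_at_filter max_def intro!: always_eventually)
    then show ?thesis using 3 by (simp add: has_field_derivative_iff)
  qed
qed

section \<open>Truncated cubic bumps and their derivatives\<close>

definition bump :: "real ^ 'n::finite \<Rightarrow> real \<Rightarrow> real ^ 'n \<Rightarrow> real" where
  "bump c l x = max 0 (l\<^sup>2 - (x - c) \<bullet> (x - c)) ^ 3"

definition bump_grad :: "real ^ 'n::finite \<Rightarrow> real \<Rightarrow> 'n \<Rightarrow> real ^ 'n \<Rightarrow> real" where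
  "bump_grad c l i x = - 6 * (x - c) $ i * max 0 (l\<^sup>2 - (x - c) \<bullet> (x - c)) ^ 2"

definition bump_hess :: "real ^ 'n::finite \<Rightarrow> real \<Rightarrow> 'n \<Rightarrow> 'n \<Rightarrow> real ^ 'n \<Rightarrow> real" where
  "bump_hess c l j i x = - 6 * axis j 1 $ i * max 0 (l\<^sup>2 - (x - c) \<bullet> (x - c)) ^ 2
     + 24 * (x - c) $ i * (x - c) $ j * max 0 (l\<^sup>2 - (x - c) \<bullet> (x - c))"

definition bump_lap :: "real ^ 'n::finite \<Rightarrow> real \<Rightarrow> real ^ 'n \<Rightarrow> real" where
  "bump_lap c l x = - 6 * real CARD('n) * max 0 (l\<^sup>2 - (x - c) \<bullet> (x - c)) ^ 2
     + 24 * ((x - c) \<bullet> (x - c)) * max 0 (l\<^sup>2 - (x - c) \<bullet> (x - c))"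

text \<open>By scaling, the division by \<open>l ^ (CARD('n) + 4)\<close> makes the total integral
  independent of \<open>l\<close>; its value is \<open>bump_mass\<close>.\<close>

definition bump_kernel :: "real ^ 'n::finite \<Rightarrow> real \<Rightarrow> real ^ 'n \<Rightarrow> real" where
  "bump_kernel c l x = max 0 (l\<^sup>2 - (x - c) \<bullet> (x - c)) ^ 2 / l ^ (CARD('n) + 4)"

lemma sum_bump_hess: "(\<Sum>i\<in>UNIV. bump_hess c l i i x) = bump_lap c l x"
proof -
  have "(\<Sum>i\<in>UNIV. bump_hess c l i i x) = (\<Sum>i\<in>UNIV. - 6 * max 0 (l\<^sup>2 - (x - c) \<bullet> (x - c)) ^ 2
     + 24 * max 0 (l\<^sup>2 - (x - c) \<bullet> (x - c)) * ((x - c) $ i * (x - c) $ i))"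
    by (intro sum.cong) (auto simp: bump_hess_def axis_def)
  also have "\<dots> = bump_lap c l x"
    by (subst sum.distrib, subst sum_distrib_left[symmetric]) (simp add: bump_lap_def inner_vec_def)
  finally show ?thesis .
qed

lemma outside_bump:
  assumes "0 \<le> l" "x \<notin> ball c l"
  shows "max 0 (l\<^sup>2 - (x - c) \<bullet> (x - c)) = 0"
proof -
  have "l \<le> norm (x - c)" using assms(2) by (simp add: dist_norm norm_minus_commute)
  then have "l\<^sup>2 \<le> (norm (x - c))\<^sup>2" using assms(1) by (rule power_mono)
  then show ?thesis by (simp add: power2_norm_eq_inner)
qed

lemma inside_bump:
  assumes "x \<in> ball c l"
  shows "0 < l\<^sup>2 - (x - c) \<bullet> (x - c)"
proof -
  have "norm (x - c) < l" using assms by (simp add: dist_norm norm_minus_commute)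
  then have "(norm (x - c))\<^sup>2 < l\<^sup>2" by (rule power_strict_mono) auto
  then show ?thesis by (simp add: power2_norm_eq_inner)
qed

lemma bump_outside:
  assumes "0 \<le> l" "x \<notin> ball c l"
  shows "bump c l x = 0" "bump_grad c l i x = 0" "bump_hess c l i j x = 0" "bump_lap c l x = 0"
    "bump_kernel c l x = 0"
  using outside_bump[OF assms] by (auto simp: bump_def bump_grad_def bump_hess_def bump_lap_def bump_kernel_def)

lemma bump_nonneg: "0 \<le> bump c l x"
  by (simp add: bump_def)

lemma bump_kernel_nonneg: "0 \<le> l \<Longrightarrow> 0 \<le> bump_kernel c l x"
  by (simp add: bump_kernel_def)

lemma bump_has_derivative:
  "(bump c l has_derivative (\<lambda>h. - 6 * max 0 (l\<^sup>2 - (x - c) \<bullet> (x - c)) ^ 2 * ((x - c) \<bullet> h))) (at x)"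
proof -
  have "((\<lambda>x. l\<^sup>2 - (x - c) \<bullet> (x - c)) has_derivative (\<lambda>h. - (2 * ((x - c) \<bullet> h)))) (at x)"
    by (auto intro!: derivative_eq_intros simp: inner_commute)
  from DERIV_compose_FDERIV[OF DERIV_pos_part_power[of 1] this] show ?thesis
    unfolding bump_def[abs_def] by (simp add: numeral_2_eq_2 numeral_3_eq_3 algebra_simps)
qed

lemma bump_grad_has_derivative:
  "(bump_grad c l i has_derivative (\<lambda>h. - 6 * h $ i * max 0 (l\<^sup>2 - (x - c) \<bullet> (x - c)) ^ 2
     + 24 * (x - c) $ i * max 0 (l\<^sup>2 - (x - c) \<bullet> (x - c)) * ((x - c) \<bullet> h))) (at x)"
proof -
  have "((\<lambda>x. l\<^sup>2 - (x - c) \<bullet> (x - c)) has_derivative (\<lambda>h. - (2 * ((x - c) \<bullet> h)))) (at x)"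
    by (auto intro!: derivative_eq_intros simp: inner_commute)
  from DERIV_compose_FDERIV[OF DERIV_pos_part_power[of 0] this]
  have 1: "((\<lambda>x. max 0 (l\<^sup>2 - (x - c) \<bullet> (x - c)) ^ 2) has_derivative
      (\<lambda>h. - 4 * max 0 (l\<^sup>2 - (x - c) \<bullet> (x - c)) * ((x - c) \<bullet> h))) (at x)"
    by (simp add: numeral_2_eq_2 algebra_simps)
  have 2: "((\<lambda>x. - 6 * (x - c) $ i) has_derivative (\<lambda>h. - 6 * h $ i)) (at x)"
    by (auto intro!: derivative_eq_intros bounded_linear.has_derivative[OF bounded_linear_vec_nth])
  show ?thesis unfolding bump_grad_def[abs_def]
    by (rule has_derivative_eq_rhs[OF has_derivative_mult[OF 2 1] ext]) (simp add: algebra_simps)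
qed

lemma has_derivative_imp_axis:
  fixes \<phi> :: "real ^ 'n::finite \<Rightarrow> real"
  assumes "(\<phi> has_derivative A) (at x)"
  shows "((\<lambda>t. \<phi> (x + t *\<^sub>R e)) has_real_derivative A e) (at 0)"
proof -
  have 1: "((\<lambda>t. x + t *\<^sub>R e) has_derivative (\<lambda>t. t *\<^sub>R e)) (at (0::real))"
    by (auto intro!: derivative_eq_intros)
  have 2: "(\<phi> has_derivative A) (at (x + 0 *\<^sub>R e))" using assms by simp
  have lin: "linear A" using assms by (rule has_derivative_linear)
  have "((\<lambda>t. \<phi> (x + t *\<^sub>R e)) has_derivative (\<lambda>t. A (t *\<^sub>R e))) (at 0)"
    using diff_chain_at[OF 1 2] by (simp add: comp_def)
  then show ?thesis unfolding has_field_derivative_def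
    by (rule has_derivative_eq_rhs) (auto simp: linear_cmul[OF lin] mult.commute)
qed

lemma bump_axis_derivative:
  "((\<lambda>t. bump c l (x + t *\<^sub>R axis i 1)) has_real_derivative bump_grad c l i x) (at 0)"
  using has_derivative_imp_axis[OF bump_has_derivative, of c l x "axis i 1"]
  by (simp add: bump_grad_def inner_axis algebra_simps)

lemma bump_grad_axis_derivative:
  "((\<lambda>t. bump_grad c l i (x + t *\<^sub>R axis i 1)) has_real_derivative bump_hess c l i i x) (at 0)"
  using has_derivative_imp_axis[OF bump_grad_has_derivative, of c l i x "axis i 1"]
  by (simp add: bump_hess_def inner_axis algebra_simps)

lemma bump_continuous:
  "continuous_on S (bump c l)" "continuous_on S (bump_grad c l i)" "continuous_on S (bump_hess c l i j)"
  "continuous_on S (bump_lap c l)" "continuous_on S (bump_kernel c l)"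
  unfolding bump_def[abs_def] bump_grad_def[abs_def] bump_hess_def[abs_def] bump_lap_def[abs_def] bump_kernel_def[abs_def]
  by (auto intro!: continuous_intros simp: divide_inverse)

lemma bump_measurable[measurable]:
  "bump c l \<in> borel_measurable borel" "bump_grad c l i \<in> borel_measurable borel"
  "bump_hess c l i j \<in> borel_measurable borel"
  "bump_lap c l \<in> borel_measurable borel" "bump_kernel c l \<in> borel_measurable borel"
  by (auto intro!: borel_measurable_continuous_onI bump_continuous)

lemma integrable_compact_support:
  fixes g :: "'a::euclidean_space \<Rightarrow> real"
  assumes "compact S" "continuous_on S g" "\<And>x. x \<notin> S \<Longrightarrow> g x = 0"
  shows "integrable lborel g"
proof -
  have "g = (\<lambda>x. indicator S x *\<^sub>R g x)" using assms(3) by (fastforce simp: indicator_def)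
  with borel_integrable_compact[OF assms(1,2)] show ?thesis by metis
qed

text \<open>Only pure derivatives along the axes are recorded: the second ones make up the
  Laplacian, and one-dimensional derivatives are what \<open>integral_axis_derivative_zero\<close>
  takes.\<close>

definition axis_diff2 ::
  "(real ^ 'n::finite) set \<Rightarrow> (real ^ 'n \<Rightarrow> real) \<Rightarrow> ('n \<Rightarrow> real ^ 'n \<Rightarrow> real) \<Rightarrow> ('n \<Rightarrow> real ^ 'n \<Rightarrow> real) \<Rightarrow> bool"
where
  "axis_diff2 D \<phi> \<phi>1 \<phi>2 \<longleftrightarrow> continuous_on D \<phi> \<and> (\<forall>i. continuous_on D (\<phi>1 i) \<and> continuous_on D (\<phi>2 i)) \<and>
     (\<forall>x\<in>D. \<forall>i. ((\<lambda>t. \<phi> (x + t *\<^sub>R axis i 1)) has_real_derivative \<phi>1 i x) (at 0) \<and>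
       ((\<lambda>t. \<phi>1 i (x + t *\<^sub>R axis i 1)) has_real_derivative \<phi>2 i x) (at 0))"

text \<open>For each axis, \<open>\<phi> * bump_grad - \<phi>1 * bump\<close> is supported in the
  closed ball, and the mixed terms cancel in its derivative along the axis, whose integral is
  \<open>0\<close>. Summation over the axes gives Green's second identity without boundary
  terms.\<close>

lemma green_bump:
  fixes \<phi> :: "real ^ 'n::finite \<Rightarrow> real"
  assumes \<phi>: "axis_diff2 D \<phi> \<phi>1 \<phi>2" and l: "0 < l" "cball c l \<subseteq> D"
  shows "(LINT x|lborel. \<phi> x * bump_lap c l x) = (LINT x|lborel. (\<Sum>i\<in>UNIV. \<phi>2 i x) * bump c l x)"
proof -
  let ?S = "cball c l"
  have cont: "continuous_on ?S \<phi>" "\<And>i. continuous_on ?S (\<phi>1 i)" "\<And>i. continuous_on ?S (\<phi>2 i)"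
    using \<phi> l(2) continuous_on_subset unfolding axis_diff2_def by blast+
  have out: "x \<notin> ?S \<Longrightarrow> x \<notin> ball c l" for x using ball_subset_cball by blast
  have l0: "0 \<le> l" using l by simp
  note int = integrable_compact_support[OF compact_cball[of c l]]
  have zero: "(LINT x|lborel. \<phi> x * bump_hess c l i i x - \<phi>2 i x * bump c l x) = 0" for i
  proof -
    define W where "W x = \<phi> x * bump_grad c l i x - \<phi>1 i x * bump c l x" for x
    define W' where "W' x = \<phi> x * bump_hess c l i i x - \<phi>2 i x * bump c l x" for x
    have cW: "continuous_on ?S W" and cW': "continuous_on ?S W'"
      unfolding W_def W'_def by (intro continuous_intros cont bump_continuous)+
    have W0: "x \<notin> ball c l \<Longrightarrow> W x = 0" "x \<notin> ball c l \<Longrightarrow> W' x = 0" for x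
      by (simp_all add: W_def W'_def bump_outside[OF l0])
    have der: "((\<lambda>t. W (x + t *\<^sub>R axis i 1)) has_real_derivative W' x) (at 0)" for x
    proof (cases "x \<in> ?S")
      case True
      then have "x \<in> D" using l by blast
      then have d: "((\<lambda>t. \<phi> (x + t *\<^sub>R axis i 1)) has_real_derivative \<phi>1 i x) (at 0)"
        "((\<lambda>t. \<phi>1 i (x + t *\<^sub>R axis i 1)) has_real_derivative \<phi>2 i x) (at 0)"
        using \<phi> unfolding axis_diff2_def by auto
      show ?thesis unfolding W_def W'_def
        by (rule DERIV_cong[OF DERIV_diff[OF DERIV_mult[OF d(1) bump_grad_axis_derivative]
              DERIV_mult[OF d(2) bump_axis_derivative]]]) (simp add: algebra_simps)
    next
      case False
      \<comment> \<open>Off the closed ball \<open>W\<close> vanishes nearby. The sphere belongs to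
        the other case, since \<open>D\<close> contains the closed ball.\<close>
      have op: "open ((\<lambda>t::real. x + t *\<^sub>R axis i 1) -` (- ?S))"
        by (intro open_vimage continuous_intros) auto
      have "((\<lambda>t::real. 0::real) has_real_derivative W' x) (at 0)"
        using W0(2)[OF out[OF False]] by simp
      then show ?thesis
        by (rule has_field_derivative_transform_within_open[OF _ op]) (use False W0(1) out in auto)
    qed
    obtain B where B: "\<And>x. x \<in> ?S \<Longrightarrow> \<bar>W' x\<bar> \<le> B"
      using compact_imp_bounded[OF compact_continuous_image[OF cW' compact_cball]]
      by (metis bounded_iff image_eqI real_norm_def)
    have "0 \<le> B" using B[of c] l by auto
    then have "\<bar>W' x\<bar> \<le> B" for x using B W0(2)[OF out] by (cases "x \<in> ?S") auto
    moreover have "integrable lborel W" by (rule int[OF cW]) (use W0 out in auto)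
    ultimately show ?thesis
      using integral_axis_derivative_zero[OF der _ bounded_cball[of c l]] W0(1)[OF out]
      unfolding W'_def by blast
  qed
  have i1: "integrable lborel (\<lambda>x. \<phi> x * bump_hess c l i i x)" for i
    by (rule int) (simp_all add: bump_outside[OF l0 out] continuous_on_mult cont bump_continuous)
  have i2: "integrable lborel (\<lambda>x. \<phi>2 i x * bump c l x)" for i
    by (rule int) (simp_all add: bump_outside[OF l0 out] continuous_on_mult cont bump_continuous)
  have eq: "(LINT x|lborel. \<phi> x * bump_hess c l i i x) = (LINT x|lborel. \<phi>2 i x * bump c l x)" for i
    using zero[of i] i1[of i] i2[of i] by (simp add: Bochner_Integration.integral_diff)
  have "(LINT x|lborel. \<phi> x * bump_lap c l x) = (\<Sum>i\<in>UNIV. LINT x|lborel. \<phi> x * bump_hess c l i i x)"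
    using i1 by (subst Bochner_Integration.integral_sum[symmetric]) (simp_all add: sum_bump_hess[symmetric] sum_distrib_left)
  also have "\<dots> = (LINT x|lborel. (\<Sum>i\<in>UNIV. \<phi>2 i x) * bump c l x)"
    using i2 by (subst eq, subst Bochner_Integration.integral_sum[symmetric]) (simp_all add: sum_distrib_right)
  finally show ?thesis .
qed

section \<open>Means against the bump kernel as functions of the radius\<close>

definition bump_mean :: "(real ^ 'n::finite \<Rightarrow> real) \<Rightarrow> real ^ 'n \<Rightarrow> real \<Rightarrow> real" where
  "bump_mean v c l = (LINT x|lborel. v x * bump_kernel c l x)"

text \<open>Means are taken of total functions; a function given on a smaller set is first cut off
  by an indicator. Integrability on balls is enough for the product with any bump.\<close>

definition loc_integrable :: "(real ^ 'n::finite \<Rightarrow> real) \<Rightarrow> bool" where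
  "loc_integrable v \<longleftrightarrow> (\<forall>R. integrable lborel (\<lambda>x. indicator (cball 0 R) x * v x))"

lemma loc_integrable_mult:
  assumes v: "loc_integrable v" and w[measurable]: "w \<in> borel_measurable borel"
    and b: "\<And>x. \<bar>w x\<bar> \<le> B" and S: "bounded S" "\<And>x. x \<notin> S \<Longrightarrow> w x = 0"
  shows "integrable lborel (\<lambda>x. v x * w x)"
proof -
  obtain R where R: "S \<subseteq> cball 0 R" using S(1) by (metis bounded_iff mem_cball_0 subsetI)
  have i: "integrable lborel (\<lambda>x. indicator (cball 0 R) x * v x)" using v unfolding loc_integrable_def by blast
  then have [measurable]: "(\<lambda>x. indicator (cball 0 R) x * v x) \<in> borel_measurable borel"
    using borel_measurable_integrable by fastforce
  have eq: "v x * w x = (indicator (cball 0 R) x * v x) * w x" for x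
    using S(2)[of x] R by (cases "x \<in> S") (auto simp: indicator_def)
  show ?thesis unfolding eq
  proof (rule Bochner_Integration.integrable_bound[OF integrable_mult_right[OF i, of B]])
    show "(\<lambda>x. indicator (cball 0 R) x * v x * w x) \<in> borel_measurable lborel" by simp
    have "\<bar>indicator (cball 0 R) x * v x\<bar> * \<bar>w x\<bar> \<le> \<bar>indicator (cball 0 R) x * v x\<bar> * \<bar>B\<bar>" for x
      by (rule mult_left_mono) (use b[of x] in auto)
    then show "AE x in lborel. norm (indicator (cball 0 R) x * v x * w x) \<le> norm (B * (indicator (cball 0 R) x * v x))"
      by (auto simp: abs_mult mult.commute mult.left_commute intro!: AE_I2)
  qed
qed

lemma bounded_bump:
  fixes w :: "real ^ 'n::finite \<Rightarrow> real"
  assumes "continuous_on UNIV w" "\<And>x. x \<notin> ball c l \<Longrightarrow> w x = 0"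
  obtains B where "\<And>x. \<bar>w x\<bar> \<le> B"
proof -
  have "bounded (w ` cball c l)"
    by (rule compact_imp_bounded[OF compact_continuous_image[OF continuous_on_subset[OF assms(1)] compact_cball]]) simp
  then obtain B where B: "\<forall>x\<in>cball c l. \<bar>w x\<bar> \<le> B" by (metis bounded_iff image_eqI real_norm_def)
  have "\<bar>w x\<bar> \<le> max B 0" for x
  proof (cases "x \<in> cball c l")
    case True
    then show ?thesis using B by fastforce
  next
    case False
    then have "x \<notin> ball c l" by simp
    then show ?thesis using assms(2) by simp
  qed
  then show ?thesis using that by blast
qed

lemma loc_integrable_bump:
  assumes "loc_integrable v" "0 \<le> l"
  shows "integrable lborel (\<lambda>x. v x * bump_kernel c l x)" "integrable lborel (\<lambda>x. v x * bump_lap c l x)"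
    "integrable lborel (\<lambda>x. v x * bump c l x)"
proof -
  have "integrable lborel (\<lambda>x. v x * w x)"
    if w: "continuous_on UNIV w" "\<And>x. x \<notin> ball c l \<Longrightarrow> w x = 0" for w
  proof -
    obtain B where "\<And>x. \<bar>w x\<bar> \<le> B" using bounded_bump[OF w] by blast
    then show ?thesis
      by (rule loc_integrable_mult[OF assms(1) borel_measurable_continuous_onI[OF w(1)] _ bounded_ball w(2)])
  qed
  then show "integrable lborel (\<lambda>x. v x * bump_kernel c l x)" "integrable lborel (\<lambda>x. v x * bump_lap c l x)"
    "integrable lborel (\<lambda>x. v x * bump c l x)"
    by (simp_all add: bump_continuous bump_outside[OF assms(2)])
qed

lemma loc_integrable_indicator:
  assumes "compact S" "continuous_on S v"
  shows "loc_integrable (\<lambda>x. indicator S x * v x)"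
  unfolding loc_integrable_def
proof
  fix R
  have "compact (cball 0 R \<inter> S)" using assms by (simp add: compact_Int)
  then have "integrable lborel (\<lambda>x. indicator (cball 0 R \<inter> S) x *\<^sub>R v x)"
    by (rule borel_integrable_compact) (use assms continuous_on_subset in blast)
  then show "integrable lborel (\<lambda>x. indicator (cball 0 R) x * (indicator S x * v x))"
    by (simp add: indicator_inter_arith mult.assoc)
qed

lemma loc_integrable_continuous:
  assumes "continuous_on UNIV v"
  shows "loc_integrable v"
  unfolding loc_integrable_def
proof
  fix R
  have "integrable lborel (\<lambda>x. indicator (cball 0 R) x *\<^sub>R v x)"
    by (rule borel_integrable_compact) (use assms continuous_on_subset in auto)
  then show "integrable lborel (\<lambda>x. indicator (cball 0 R) x * v x)" by simp
qed

text \<open>Uniform in the radius up to \<open>m\<close>, as a dominating function for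
  differentiation in the radius must be.\<close>

lemma bump_lap_le:
  fixes c :: "real ^ 'n::finite"
  assumes "0 \<le> l" "l \<le> m"
  shows "\<bar>bump_lap c l x\<bar> \<le> (6 * real CARD('n) + 24) * m ^ 4 * indicator (cball c m) x"
proof (cases "x \<in> ball c l")
  case True
  define q t where "q = (x - c) \<bullet> (x - c)" and "t = l\<^sup>2 - q"
  have t: "0 < t" "t \<le> l\<^sup>2" "0 \<le> q" "q \<le> l\<^sup>2" using inside_bump[OF True] by (auto simp: q_def t_def)
  have "bump_lap c l x = - 6 * real CARD('n) * t\<^sup>2 + 24 * q * t"
    using t by (simp add: bump_lap_def q_def[symmetric] t_def)
  then have "\<bar>bump_lap c l x\<bar> \<le> 6 * real CARD('n) * t\<^sup>2 + 24 * (q * t)"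
    using t by (simp add: abs_le_iff)
  also have "\<dots> \<le> 6 * real CARD('n) * l ^ 4 + 24 * l ^ 4"
  proof -
    have "t\<^sup>2 \<le> (l\<^sup>2)\<^sup>2" using t by (intro power_mono) auto
    moreover have "q * t \<le> l\<^sup>2 * l\<^sup>2" using t by (intro mult_mono) auto
    ultimately show ?thesis by (intro add_mono mult_left_mono) (auto simp: power4_eq_xxxx power2_eq_square)
  qed
  also have "\<dots> = (6 * real CARD('n) + 24) * l ^ 4" by (simp add: algebra_simps)
  also have "\<dots> \<le> (6 * real CARD('n) + 24) * m ^ 4" using assms by (intro mult_left_mono power_mono) auto
  finally show ?thesis using True assms by simp
next
  case False
  then show ?thesis using bump_outside(4)[OF assms(1) False] assms by simp
qed

text \<open>
  The identity for which the exponents \<open>2\<close> and \<open>N + 4\<close> of the kernel are chosen.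
\<close>

lemma DERIV_bump_kernel:
  fixes c :: "real ^ 'n::finite"
  assumes "0 < l"
  shows "((\<lambda>l. bump_kernel c l x) has_real_derivative bump_lap c l x / (6 * l ^ (CARD('n) + 5))) (at l)"
proof -
  define q t N where "q = (x - c) \<bullet> (x - c)" and "t = max 0 (l\<^sup>2 - q)" and "N = CARD('n)"
  have 1: "((\<lambda>l. l\<^sup>2 - q) has_real_derivative 2 * l) (at l)" by (auto intro!: derivative_eq_intros)
  have 2: "((\<lambda>l. max 0 (l\<^sup>2 - q) ^ 2) has_real_derivative 2 * t * (2 * l)) (at l)"
    using DERIV_chain2[OF DERIV_pos_part_power[of 0] 1] by (simp add: numeral_2_eq_2 t_def)
  have 3: "((\<lambda>l. l ^ (N + 4)) has_real_derivative real (N + 4) * l ^ (N + 3)) (at l)"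
    using DERIV_pow[of "N + 4" l UNIV] by (simp add: add.commute)
  have 4: "((\<lambda>l. max 0 (l\<^sup>2 - q) ^ 2 / l ^ (N + 4)) has_real_derivative
      (2 * t * (2 * l) * l ^ (N + 4) - t\<^sup>2 * (real (N + 4) * l ^ (N + 3))) / (l ^ (N + 4) * l ^ (N + 4))) (at l)"
    using DERIV_divide[OF 2 3] assms by (simp add: t_def)
  have qt: "q * t = (l\<^sup>2 - t) * t" by (cases "0 \<le> l\<^sup>2 - q") (auto simp: t_def)
  have "bump_lap c l x = 6 * (4 * l\<^sup>2 * t - real (N + 4) * t\<^sup>2)"
  proof -
    have "bump_lap c l x = - 6 * real N * t\<^sup>2 + 24 * (q * t)"
      by (simp add: bump_lap_def q_def t_def N_def)
    then show ?thesis unfolding qt by (simp add: algebra_simps power2_eq_square)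
  qed
  moreover have "(2 * t * (2 * l) * l ^ (N + 4) - t\<^sup>2 * (real (N + 4) * l ^ (N + 3))) / (l ^ (N + 4) * l ^ (N + 4))
     = (4 * l\<^sup>2 * t - real (N + 4) * t\<^sup>2) / l ^ (N + 5)"
    using assms by (simp add: field_simps power_add eval_nat_numeral)
  ultimately show ?thesis using 4 unfolding bump_kernel_def q_def[symmetric] N_def[symmetric]
    by (simp only: mult_divide_mult_cancel_left_if) simp
qed

lemma DERIV_bump_mean:
  fixes c :: "real ^ 'n::finite"
  assumes v: "loc_integrable v" and l: "0 < l"
  shows "((\<lambda>l. bump_mean v c l) has_real_derivative
     (LINT x|lborel. v x * bump_lap c l x) / (6 * l ^ (CARD('n) + 5))) (at l)"
proof -
  let ?N = "CARD('n)"
  \<comment> \<open>For radii between \<open>l / 2\<close> and \<open>2 * l\<close>: the bound of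
    \<open>bump_lap_le\<close> with \<open>m = 2 * l\<close> over the smallest denominator.\<close>
  define C where "C = (6 * real ?N + 24) * (2 * l) ^ 4 / (6 * (l / 2) ^ (?N + 5))"
  define w where "w x = C * \<bar>indicator (cball 0 (norm c + 2 * l)) x * v x\<bar>" for x
  have C0: "0 \<le> C" using l by (simp add: C_def)
  have "((\<lambda>s. LINT x|lborel. v x * bump_kernel c s x) has_real_derivative
      (LINT x|lborel. v x * (bump_lap c l x / (6 * l ^ (?N + 5))))) (at l)"
  proof (rule has_real_derivative_integral[of l "l / 2" "2 * l" _ _ _ w])
    show "l \<in> {l / 2<..<2 * l}" using l by simp
    show "integrable lborel (\<lambda>x. v x * bump_kernel c s x)" if "s \<in> {l / 2<..<2 * l}" for s
      using that l by (intro loc_integrable_bump v) auto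
    show "((\<lambda>s. v x * bump_kernel c s x) has_real_derivative v x * (bump_lap c s x / (6 * s ^ (?N + 5)))) (at s)"
      if "s \<in> {l / 2<..<2 * l}" for s x
      using that l DERIV_cmult[OF DERIV_bump_kernel[of s c x], of "v x"] by simp
    show "integrable lborel w" unfolding w_def
      using v unfolding loc_integrable_def by (intro integrable_mult_right integrable_abs) auto
    show "\<bar>v x * (bump_lap c s x / (6 * s ^ (?N + 5)))\<bar> \<le> w x" if "s \<in> {l / 2<..<2 * l}" for s x
    proof -
      have s: "0 < s" "l / 2 \<le> s" "s \<le> 2 * l" using that l by auto
      have "\<bar>bump_lap c s x\<bar> / (6 * s ^ (?N + 5)) \<le> ((6 * real ?N + 24) * (2 * l) ^ 4 * indicator (cball c (2 * l)) x) / (6 * (l / 2) ^ (?N + 5))"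
        using s l by (intro frac_le bump_lap_le mult_left_mono power_mono) auto
      also have "\<dots> = C * indicator (cball c (2 * l)) x" by (simp add: C_def)
      also have "\<dots> \<le> C * indicator (cball 0 (norm c + 2 * l)) x"
      proof -
        have "cball c (2 * l) \<subseteq> cball 0 (norm c + 2 * l)"
          by (simp add: cball_subset_cball_iff)
        then show ?thesis by (intro mult_left_mono C0) (auto simp: indicator_def)
      qed
      finally have "\<bar>v x\<bar> * (\<bar>bump_lap c s x\<bar> / (6 * s ^ (?N + 5))) \<le> \<bar>v x\<bar> * (C * indicator (cball 0 (norm c + 2 * l)) x)"
        by (rule mult_left_mono) simp
      then show ?thesis using s by (simp add: abs_mult w_def mult.commute mult.left_commute)
    qed
  qed
  then show ?thesis by (simp add: bump_mean_def)
qed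

definition bump_mass :: "'n::finite itself \<Rightarrow> real" where
  "bump_mass _ = (LINT x|lborel. bump_kernel (0 :: real ^ 'n) 1 x)"

lemma axis_diff2_const: "axis_diff2 UNIV (\<lambda>_. k) (\<lambda>_ _. 0) (\<lambda>_ _. 0)"
  by (simp add: axis_diff2_def)

text \<open>No polar coordinates: the \<open>l\<close>-derivative of the mass is a multiple of the
  integral of \<open>bump_lap\<close>, which vanishes by \<open>green_bump\<close> for a constant
  function. Translation invariance removes the centre.\<close>

lemma integral_bump_kernel:
  assumes "0 < l"
  shows "(LINT x|lborel. bump_kernel (c :: real ^ 'n::finite) l x) = bump_mass TYPE('n)"
proof -
  have z: "(LINT x|lborel. bump_lap (0 :: real ^ 'n) l x) = 0" if "0 < l" for l
    using green_bump[OF axis_diff2_const[of 1] that, of 0] by simp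
  have "loc_integrable (\<lambda>_. 1 :: real)" by (intro loc_integrable_continuous continuous_intros)
  from DERIV_bump_mean[OF this, of _ "0 :: real ^ 'n"]
  have d: "((\<lambda>l. bump_mean (\<lambda>_. 1) (0 :: real ^ 'n) l) has_real_derivative 0) (at l)" if "0 < l" for l
    using z[OF that] that by (metis (no_types, lifting) div_0 mult_1 Bochner_Integration.integral_cong)
  have "bump_mean (\<lambda>_. 1) (0 :: real ^ 'n) l = bump_mean (\<lambda>_. 1) (0 :: real ^ 'n) 1"
  proof -
    have "\<exists>k. \<forall>l\<in>{0<..}. bump_mean (\<lambda>_. 1) (0 :: real ^ 'n) l = k"
    proof (rule has_field_derivative_zero_constant)
      show "((\<lambda>l. bump_mean (\<lambda>_. 1) (0 :: real ^ 'n) l) has_field_derivative 0) (at l within {0<..})"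
        if "l \<in> {0<..}" for l :: real
        using d that by (simp add: has_field_derivative_at_within)
    qed simp
    then obtain k where "\<forall>l\<in>{0<..}. bump_mean (\<lambda>_. 1) (0 :: real ^ 'n) l = k" ..
    then show ?thesis using assms by simp
  qed
  moreover have "(LINT x|lborel. bump_kernel c l x) = (LINT x|lborel. bump_kernel c l (c + x))"
    by (simp add: integral_translate)
  moreover have "bump_kernel c l (c + x) = bump_kernel 0 l x" for x by (simp add: bump_kernel_def)
  ultimately show ?thesis by (simp add: bump_mean_def bump_mass_def)
qed

lemma bump_mass_pos: "0 < bump_mass TYPE('n::finite)"
proof -
  \<comment> \<open>On the ball of radius \<open>1 / 2\<close> the kernel with \<open>l = 1\<close>
    is at least \<open>(1 - 1 / 4)\<^sup>2 = 9 / 16\<close>.\<close>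
  have i: "integrable lborel (\<lambda>x :: real ^ 'n. (9 / 16) * indicator (cball 0 (1 / 2)) x :: real)"
    using emeasure_lborel_cball_finite[of "0 :: real ^ 'n" "1 / 2"]
    by (intro integrable_mult_right integrable_real_indicator) auto
  have "0 < (9 / 16) * measure lborel (cball (0 :: real ^ 'n) (1 / 2))"
    using content_cball_pos[of "1 / 2" "0 :: real ^ 'n"] by simp
  also have "\<dots> = (LINT x|lborel. (9 / 16) * indicator (cball (0 :: real ^ 'n) (1 / 2)) x)"
    by simp
  also have "\<dots> \<le> (LINT x|lborel. bump_kernel (0 :: real ^ 'n) 1 x)"
  proof (rule integral_mono[OF i])
    show "integrable lborel (bump_kernel (0 :: real ^ 'n) 1)"
      using loc_integrable_bump(1)[OF loc_integrable_continuous[of "\<lambda>_. 1"], of 1 0] by simp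
    show "9 / 16 * indicator (cball 0 (1 / 2)) x \<le> bump_kernel (0 :: real ^ 'n) 1 x" for x
    proof (cases "x \<in> cball 0 (1 / 2)")
      case True
      then have "(norm x)\<^sup>2 \<le> (1 / 2)\<^sup>2" by (intro power_mono) auto
      then have "3 / 4 \<le> 1 - x \<bullet> x" by (simp add: power2_norm_eq_inner) (simp add: power2_eq_square)
      then have "(3 / 4)\<^sup>2 \<le> (max 0 (1 - x \<bullet> x))\<^sup>2" by (intro power_mono) auto
      then show ?thesis using True by (simp add: bump_kernel_def power2_eq_square)
    qed (simp add: bump_kernel_nonneg)
  qed
  finally show ?thesis by (simp add: bump_mass_def)
qed

lemma bump_mean_mono:
  fixes c :: "real ^ 'n::finite"
  assumes v: "loc_integrable v" "loc_integrable w" and l: "0 < l" and b: "\<And>x. x \<in> ball c l \<Longrightarrow> v x \<le> w x"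
  shows "bump_mean v c l \<le> bump_mean w c l"
  unfolding bump_mean_def
proof (rule integral_mono)
  show "integrable lborel (\<lambda>x. v x * bump_kernel c l x)" "integrable lborel (\<lambda>x. w x * bump_kernel c l x)"
    using v l by (simp_all add: loc_integrable_bump)
  fix x show "v x * bump_kernel c l x \<le> w x * bump_kernel c l x"
  proof (cases "x \<in> ball c l")
    case True
    then show ?thesis using b[OF True] l by (intro mult_right_mono bump_kernel_nonneg) auto
  next
    case False
    then show ?thesis using bump_outside(5)[OF less_imp_le[OF l] False] by simp
  qed
qed

lemma bump_mean_const: "0 < l \<Longrightarrow> bump_mean (\<lambda>_. k) (c :: real ^ 'n::finite) l = bump_mass TYPE('n) * k"
  using integral_bump_kernel[of l c] by (simp add: bump_mean_def)

lemma loc_integrable_const: "loc_integrable (\<lambda>_. k)"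
  by (intro loc_integrable_continuous continuous_intros)

lemma bump_mean_approx:
  fixes c :: "real ^ 'n::finite"
  assumes v: "loc_integrable v" and l: "0 < l" and b: "\<And>x. x \<in> ball c l \<Longrightarrow> \<bar>v x - k\<bar> \<le> e"
  shows "\<bar>bump_mean v c l - bump_mass TYPE('n) * k\<bar> \<le> bump_mass TYPE('n) * e"
proof -
  have "bump_mean v c l \<le> bump_mean (\<lambda>_. k + e) c l"
    by (rule bump_mean_mono[OF v loc_integrable_const l]) (use b in force)
  moreover have "bump_mean (\<lambda>_. k - e) c l \<le> bump_mean v c l"
    by (rule bump_mean_mono[OF loc_integrable_const v l]) (use b in force)
  ultimately show ?thesis using l by (simp add: bump_mean_const abs_le_iff algebra_simps)
qed

lemma bump_mean_tendsto:
  fixes c :: "real ^ 'n::finite"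
  assumes v: "loc_integrable v" and c: "isCont v c"
  shows "((\<lambda>l. bump_mean v c l) \<longlongrightarrow> bump_mass TYPE('n) * v c) (at_right 0)"
proof (rule tendstoI)
  fix e :: real assume e: "0 < e"
  define e' where "e' = e / (2 * bump_mass TYPE('n))"
  have e': "0 < e'" using e bump_mass_pos[where 'n='n] by (simp add: e'_def)
  obtain d where d: "0 < d" "\<And>x. dist x c < d \<Longrightarrow> dist (v x) (v c) < e'"
    using c e' unfolding continuous_at_eps_delta by blast
  have "dist (bump_mean v c l) (bump_mass TYPE('n) * v c) < e" if l: "0 < l" "l < d" for l
  proof -
    have "\<bar>bump_mean v c l - bump_mass TYPE('n) * v c\<bar> \<le> bump_mass TYPE('n) * e'"
    proof (rule bump_mean_approx[OF v l(1)])
      fix x assume "x \<in> ball c l"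
      then have "dist x c < d" using l by (simp add: dist_commute)
      then show "\<bar>v x - v c\<bar> \<le> e'" using d(2)[of x] by (simp add: dist_real_def)
    qed
    also have "\<dots> < e" using e bump_mass_pos[where 'n='n] by (simp add: e'_def)
    finally show ?thesis by (simp add: dist_real_def)
  qed
  then show "\<forall>\<^sub>F l in at_right 0. dist (bump_mean v c l) (bump_mass TYPE('n) * v c) < e"
    unfolding eventually_at_right_field using d(1) by auto
qed

section \<open>Weak Laplacians and comparison\<close>

text \<open>
  Bumps are the only test functions needed, since only the monotonicity of means in the radius is used.
\<close>

definition weak_laplacian :: "(real ^ 'n::finite) set \<Rightarrow> (real ^ 'n \<Rightarrow> real) \<Rightarrow> (real ^ 'n \<Rightarrow> real) \<Rightarrow> bool" where
  "weak_laplacian D v F \<longleftrightarrow> open D \<and> continuous_on D v \<and> continuous_on D F \<and>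
     (\<forall>c l. 0 < l \<and> cball c l \<subseteq> D \<longrightarrow>
        (LINT x|lborel. v x * bump_lap c l x) = (LINT x|lborel. F x * bump c l x))"

lemma weak_laplacian_axis_diff2:
  assumes "open D" "axis_diff2 D \<phi> \<phi>1 \<phi>2"
  shows "weak_laplacian D \<phi> (\<lambda>x. \<Sum>i\<in>UNIV. \<phi>2 i x)"
  using assms green_bump[OF assms(2)] unfolding weak_laplacian_def
  by (auto simp: axis_diff2_def intro!: continuous_on_sum)

lemma integrable_bump_cont:
  fixes v :: "real ^ 'n::finite \<Rightarrow> real"
  assumes "continuous_on D v" "cball c l \<subseteq> D" "0 \<le> l"
  shows "integrable lborel (\<lambda>x. v x * bump_lap c l x)" "integrable lborel (\<lambda>x. v x * bump c l x)"
proof -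
  have out: "x \<notin> cball c l \<Longrightarrow> x \<notin> ball c l" for x using ball_subset_cball by blast
  note c = continuous_on_subset[OF assms(1,2)]
  show "integrable lborel (\<lambda>x. v x * bump_lap c l x)" "integrable lborel (\<lambda>x. v x * bump c l x)"
    by (rule integrable_compact_support[OF compact_cball[of c l]];
        simp add: bump_outside[OF assms(3) out] continuous_on_mult c bump_continuous)+
qed

lemma weak_laplacian_diff:
  assumes "weak_laplacian D v F" "weak_laplacian D w G"
  shows "weak_laplacian D (\<lambda>x. v x - w x) (\<lambda>x. F x - G x)"
  unfolding weak_laplacian_def
proof (intro conjI allI impI)
  show "open D" "continuous_on D (\<lambda>x. v x - w x)" "continuous_on D (\<lambda>x. F x - G x)"
    using assms by (auto simp: weak_laplacian_def intro!: continuous_on_diff)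
  fix c l assume l: "0 < l \<and> cball c l \<subseteq> D"
  then have "0 \<le> l" "cball c l \<subseteq> D" by auto
  note i = integrable_bump_cont[OF _ this(2,1)]
  have "continuous_on D v" "continuous_on D w" "continuous_on D F" "continuous_on D G"
    using assms by (auto simp: weak_laplacian_def)
  note i = this[THEN i(1)] this[THEN i(2)]
  have "(LINT x|lborel. v x * bump_lap c l x) = (LINT x|lborel. F x * bump c l x)"
    "(LINT x|lborel. w x * bump_lap c l x) = (LINT x|lborel. G x * bump c l x)"
    using assms l unfolding weak_laplacian_def by blast+
  then show "(LINT x|lborel. (v x - w x) * bump_lap c l x) = (LINT x|lborel. (F x - G x) * bump c l x)"
    using i by (simp add: left_diff_distrib Bochner_Integration.integral_diff)
qed

lemma weak_laplacian_cmult: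
  assumes "weak_laplacian D v F"
  shows "weak_laplacian D (\<lambda>x. k * v x) (\<lambda>x. k * F x)"
  using assms unfolding weak_laplacian_def by (auto intro!: continuous_on_mult_left simp: mult.assoc)

lemma weak_laplacian_subset:
  assumes "weak_laplacian D v F" "open E" "E \<subseteq> D"
  shows "weak_laplacian E v F"
  unfolding weak_laplacian_def
proof (intro conjI allI impI)
  show "open E" "continuous_on E v" "continuous_on E F"
    using assms by (auto simp: weak_laplacian_def intro: continuous_on_subset)
  fix c l assume "0 < l \<and> cball c l \<subseteq> E"
  then have "0 < l \<and> cball c l \<subseteq> D" using assms(3) by (meson order_trans)
  then show "(LINT x|lborel. v x * bump_lap c l x) = (LINT x|lborel. F x * bump c l x)"
    using assms(1) unfolding weak_laplacian_def by simp
qed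

lemma weak_laplacian_cong:
  assumes "weak_laplacian D v F" "\<And>x. x \<in> D \<Longrightarrow> v x = w x" "\<And>x. x \<in> D \<Longrightarrow> F x = G x"
  shows "weak_laplacian D w G"
  unfolding weak_laplacian_def
proof (intro conjI allI impI)
  show "open D" "continuous_on D w" "continuous_on D G"
    using assms continuous_on_cong[of D D v w] continuous_on_cong[of D D F G] by (auto simp: weak_laplacian_def)
  fix c l assume l: "0 < l \<and> cball c l \<subseteq> D"
  then have "x \<notin> D \<Longrightarrow> x \<notin> ball c l" for x using ball_subset_cball by blast
  then have "v x * bump_lap c l x = w x * bump_lap c l x" "F x * bump c l x = G x * bump c l x" for x
    using assms(2,3)[of x] bump_outside(1,4)[of l x c] l by (cases "x \<in> D"; simp)+
  moreover have "(LINT x|lborel. v x * bump_lap c l x) = (LINT x|lborel. F x * bump c l x)"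
    using assms(1) l unfolding weak_laplacian_def by simp
  ultimately show "(LINT x|lborel. w x * bump_lap c l x) = (LINT x|lborel. G x * bump c l x)"
    by (simp only:)
qed

lemma integral_bump_pos:
  fixes c :: "real ^ 'n::finite"
  assumes "0 < l"
  shows "0 < (LINT x|lborel. bump c l x)"
proof -
  have i: "integrable lborel (\<lambda>x. k * bump_kernel c (l / 2) x)" for k
    by (rule loc_integrable_bump(1)[OF loc_integrable_const]) (use assms in simp)
  have i2: "integrable lborel (bump c l)"
    using loc_integrable_bump(3)[OF loc_integrable_const[of 1], of l c] assms by simp
  \<comment> \<open>On the half ball one of the three factors of the bump is at least
    \<open>3 / 4 * l\<^sup>2\<close>, the other two are at least those of the kernel of radius
    \<open>l / 2\<close>, and the power of \<open>l / 2\<close> clears the denominator of that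
    kernel.\<close>
  define k where "k = (3 / 4 * l\<^sup>2) * (l / 2) ^ (CARD('n) + 4)"
  have "0 < k * bump_mass TYPE('n)" using assms bump_mass_pos[where 'n='n] by (simp add: k_def)
  also have "\<dots> = (LINT x|lborel. k * bump_kernel c (l / 2) x)"
    using integral_bump_kernel[of "l / 2" c] assms by simp
  also have "\<dots> \<le> (LINT x|lborel. bump c l x)"
  proof (rule integral_mono[OF i i2])
    fix x
    define q m where "q = (x - c) \<bullet> (x - c)" and "m = max 0 (l\<^sup>2 - q)"
    show "k * bump_kernel c (l / 2) x \<le> bump c l x"
    proof (cases "x \<in> ball c (l / 2)")
      case True
      then have q: "0 < (l / 2)\<^sup>2 - q" using inside_bump q_def by blast
      then have q': "3 / 4 * l\<^sup>2 \<le> l\<^sup>2 - q" by (simp add: power_divide)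
      have "k * bump_kernel c (l / 2) x = (3 / 4 * l\<^sup>2) * ((l / 2)\<^sup>2 - q)\<^sup>2"
        using assms q by (simp add: bump_kernel_def k_def q_def[symmetric])
      also have "\<dots> \<le> m * m\<^sup>2"
        using q q' by (intro mult_mono power_mono) (auto simp: m_def power_divide le_max_iff_disj)
      also have "\<dots> = bump c l x"
        unfolding bump_def q_def[symmetric] m_def[symmetric] by (simp add: power3_eq_cube power2_eq_square)
      finally show ?thesis .
    next
      case False
      then show ?thesis using bump_outside(5)[OF _ False] bump_nonneg[of c l x] assms by simp
    qed
  qed
  finally show ?thesis .
qed

lemma integral_bump_le:
  fixes c :: "real ^ 'n::finite"
  assumes "0 < l"
  shows "(LINT x|lborel. bump c l x) \<le> l ^ (CARD('n) + 6) * bump_mass TYPE('n)"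
proof -
  have i: "integrable lborel (\<lambda>x. k * bump_kernel c l x)" for k
    by (rule loc_integrable_bump(1)[OF loc_integrable_const]) (use assms in simp)
  have i2: "integrable lborel (bump c l)"
    using loc_integrable_bump(3)[OF loc_integrable_const[of 1], of l c] assms by simp
  have "(LINT x|lborel. bump c l x) \<le> (LINT x|lborel. l ^ (CARD('n) + 6) * bump_kernel c l x)"
  proof (rule integral_mono[OF i2 i])
    fix x
    define m where "m = max 0 (l\<^sup>2 - (x - c) \<bullet> (x - c))"
    have m: "0 \<le> m" "m \<le> l\<^sup>2" by (auto simp: m_def)
    have "bump c l x = m * m\<^sup>2" unfolding bump_def m_def[symmetric]
      by (simp add: power3_eq_cube power2_eq_square)
    also have "\<dots> \<le> l\<^sup>2 * m\<^sup>2" using m by (intro mult_right_mono) auto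
    also have "\<dots> = l ^ (CARD('n) + 6) * bump_kernel c l x"
      using assms unfolding bump_kernel_def m_def[symmetric]
      by (simp add: power_add field_simps eval_nat_numeral)
    finally show "bump c l x \<le> l ^ (CARD('n) + 6) * bump_kernel c l x" .
  qed
  then show ?thesis using integral_bump_kernel[OF assms, of c] by simp
qed

text \<open>The mean value property in differentiated form: the means start at a multiple of
  \<open>v c\<close> and change at a rate given by the weak Laplacian. The cut-off \<open>w\<close>
  makes \<open>DERIV_bump_mean\<close> applicable to a function known only on
  \<open>D\<close>.\<close>

lemma weak_laplacian_bump_mean:
  fixes c :: "real ^ 'n::finite"
  assumes v: "weak_laplacian D v F" and l: "0 < l" "cball c l \<subseteq> D"
  defines "w \<equiv> \<lambda>x. indicator (cball c l) x * v x"
  shows "loc_integrable w"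
    and "((\<lambda>s. bump_mean w c s) \<longlongrightarrow> bump_mass TYPE('n) * v c) (at_right 0)"
    and "\<And>s. \<lbrakk>0 < s; s \<le> l\<rbrakk> \<Longrightarrow> ((\<lambda>s. bump_mean w c s) has_real_derivative
       (LINT x|lborel. F x * bump c s x) / (6 * s ^ (CARD('n) + 5))) (at s)"
proof -
  have D: "open D" "continuous_on D v" using v by (auto simp: weak_laplacian_def)
  show w: "loc_integrable w" unfolding w_def
    by (rule loc_integrable_indicator[OF compact_cball]) (use continuous_on_subset D l in blast)
  have "c \<in> D" using l by force
  then have "isCont v c" using D by (simp add: continuous_on_eq_continuous_at)
  moreover have "eventually (\<lambda>x. v x = w x) (nhds c)"
    using eventually_nhds_in_open[of "ball c l" c] l by (auto simp: w_def elim!: eventually_mono)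
  ultimately have "isCont w c" using isCont_cong by blast
  moreover have "w c = v c" using l by (simp add: w_def)
  ultimately show "((\<lambda>s. bump_mean w c s) \<longlongrightarrow> bump_mass TYPE('n) * v c) (at_right 0)"
    using bump_mean_tendsto[OF w] by metis
  fix s :: real assume s: "0 < s" "s \<le> l"
  then have sub: "cball c s \<subseteq> D" using l by force
  have "w x * bump_lap c s x = v x * bump_lap c s x" for x
    using bump_outside(4)[of s x c] s by (cases "x \<in> cball c l") (auto simp: w_def)
  then have "(LINT x|lborel. w x * bump_lap c s x) = (LINT x|lborel. F x * bump c s x)"
    using v s(1) sub unfolding weak_laplacian_def by presburger
  then show "((\<lambda>s. bump_mean w c s) has_real_derivative
       (LINT x|lborel. F x * bump c s x) / (6 * s ^ (CARD('n) + 5))) (at s)"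
    using DERIV_bump_mean[OF w s(1), of c] by simp
qed

text \<open>If \<open>F\<close> were positive at \<open>c\<close>, it would be positive nearby, and
  the means of \<open>v\<close> would increase strictly from the value that the constant
  \<open>v c\<close> has. At a maximum they cannot exceed that value.\<close>

lemma weak_laplacian_at_max:
  fixes c :: "real ^ 'n::finite"
  assumes v: "weak_laplacian D v F" and c: "c \<in> D" and max: "\<And>x. x \<in> D \<Longrightarrow> v x \<le> v c"
  shows "F c \<le> 0"
proof (rule ccontr)
  assume "\<not> F c \<le> 0"
  then have Fc: "0 < F c" by simp
  have D: "open D" "continuous_on D F" using v by (auto simp: weak_laplacian_def)
  have "isCont F c" using D c by (simp add: continuous_on_eq_continuous_at)
  then have "\<exists>d>0. \<forall>x. dist x c < d \<longrightarrow> dist (F x) (F c) < F c / 2"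
    unfolding continuous_at_eps_delta by (elim allE impE) (rule half_gt_zero[OF Fc])
  then obtain d where d: "0 < d" "\<And>x. dist x c < d \<Longrightarrow> dist (F x) (F c) < F c / 2" by auto
  obtain e where e: "0 < e" "cball c e \<subseteq> D" using D(1) c open_contains_cball by blast
  define l where "l = min e (d / 2)"
  have l: "0 < l" "cball c l \<subseteq> D" using d e by (auto simp: l_def)
  have F: "F c / 2 \<le> F x" if "x \<in> cball c l" for x
  proof -
    have "dist x c < d" using that d(1) by (auto simp: l_def dist_commute)
    from d(2)[OF this] show ?thesis unfolding dist_real_def by linarith
  qed
  define m where "m = bump_mean (\<lambda>x. indicator (cball c l) x * v x) c"
  note wm = weak_laplacian_bump_mean[OF v l, folded m_def]
  have pos: "0 < (LINT x|lborel. F x * bump c s x) / (6 * s ^ (CARD('n) + 5))" if s: "0 < s" "s \<le> l" for s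
  proof -
    have sub: "cball c s \<subseteq> D" using l s by force
    have "0 < F c / 2 * (LINT x|lborel. bump c s x)" using Fc integral_bump_pos[OF s(1), of c] by simp
    also have "\<dots> = (LINT x|lborel. F c / 2 * bump c s x)" by simp
    also have "\<dots> \<le> (LINT x|lborel. F x * bump c s x)"
    proof (rule integral_mono)
      show "integrable lborel (\<lambda>x. F c / 2 * bump c s x)"
        using integrable_bump_cont(2)[OF continuous_on_const, of c s UNIV] s by simp
      show "integrable lborel (\<lambda>x. F x * bump c s x)"
        using integrable_bump_cont(2)[OF D(2) sub] s by simp
      fix x show "F c / 2 * bump c s x \<le> F x * bump c s x"
      proof (cases "x \<in> ball c s")
        case True
        then show ?thesis using F[of x] s by (intro mult_right_mono bump_nonneg) auto
      next
        case False
        then show ?thesis using bump_outside(1)[OF _ False] s by simp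
      qed
    qed
    finally show ?thesis using s by simp
  qed
  have inc: "m s < m t" if "0 < s" "s < t" "t \<le> l" for s t
  proof (rule DERIV_pos_imp_increasing[OF that(2)])
    fix r assume "s \<le> r" "r \<le> t"
    then have "0 < r" "r \<le> l" using that by auto
    then show "\<exists>y. (m has_real_derivative y) (at r) \<and> 0 < y" using wm(3) pos by blast
  qed
  \<comment> \<open>The limit at radius \<open>0\<close> gives only a weak inequality; strictness
    comes from the further increase between \<open>l / 2\<close> and \<open>l\<close>.\<close>
  have "bump_mass TYPE('n) * v c \<le> m (l / 2)"
  proof (rule tendsto_upperbound[OF wm(2)])
    show "\<forall>\<^sub>F s in at_right 0. m s \<le> m (l / 2)"
      unfolding eventually_at_right_field using inc[of _ "l / 2"] l by (intro exI[of _ "l / 2"]) force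
  qed simp
  also have "m (l / 2) < m l" using inc l by simp
  also have "m l \<le> bump_mean (\<lambda>_. v c) c l" unfolding m_def
    by (rule bump_mean_mono[OF wm(1) loc_integrable_const l(1)]) (use max subsetD[OF l(2)] in auto)
  also have "\<dots> = bump_mass TYPE('n) * v c" by (rule bump_mean_const[OF l(1)])
  finally show False by simp
qed

text \<open>The condition that superlevel sets lie in compact subsets of \<open>D\<close> stands for
  the boundary conditions and for decay at infinity at once: a positive value then forces a positive
  maximum inside \<open>D\<close>, where \<open>F\<close> would have to be nonpositive.\<close>

lemma weak_laplacian_comparison:
  fixes D :: "(real ^ 'n::finite) set"
  assumes v: "weak_laplacian D v F" and F: "\<And>x. \<lbrakk>x \<in> D; 0 < v x\<rbrakk> \<Longrightarrow> 0 < F x"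
    and cpt: "\<And>e. 0 < e \<Longrightarrow> \<exists>T. compact T \<and> T \<subseteq> D \<and> (\<forall>x\<in>D. e \<le> v x \<longrightarrow> x \<in> T)"
    and x: "x \<in> D"
  shows "v x \<le> 0"
proof (rule ccontr)
  assume "\<not> v x \<le> 0"
  then have pos: "0 < v x" by simp
  obtain T where T: "compact T" "T \<subseteq> D" "\<And>y. \<lbrakk>y \<in> D; v x \<le> v y\<rbrakk> \<Longrightarrow> y \<in> T" using cpt[OF pos] by blast
  have xT: "x \<in> T" using T(3)[OF x] by simp
  have "continuous_on T v" using v T(2) continuous_on_subset by (auto simp: weak_laplacian_def)
  then obtain c where c: "c \<in> T" "\<And>y. y \<in> T \<Longrightarrow> v y \<le> v c"
    using continuous_attains_sup[OF T(1)] xT by blast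
  have "v y \<le> v c" if "y \<in> D" for y
    using c(2)[OF xT] c(2)[of y] T(3)[OF that] by linarith
  then have "F c \<le> 0" using weak_laplacian_at_max[OF v] c(1) T(2) by blast
  moreover have "0 < v c" using c(2)[OF xT] pos by simp
  ultimately show False using F c(1) T(2) by force
qed

text \<open>Up to the radius \<open>l\<close> the derivative of the means is at most
  \<open>bump_mass * B * l\<close> in absolute value. The error depends on \<open>F\<close> only
  through \<open>B\<close>, so it is uniform along a sequence of solutions with a common
  bound.\<close>

lemma weak_laplacian_mean_error:
  fixes c :: "real ^ 'n::finite"
  assumes v: "weak_laplacian D v F" and l: "0 < l" "cball c l \<subseteq> D"
    and B: "\<And>x. x \<in> cball c l \<Longrightarrow> \<bar>F x\<bar> \<le> B"
  shows "\<bar>bump_mean (\<lambda>x. indicator (cball c l) x * v x) c l - bump_mass TYPE('n) * v c\<bar> \<le> bump_mass TYPE('n) * B * l\<^sup>2"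
proof -
  let ?N = "CARD('n)" and ?M = "bump_mass TYPE('n)"
  define m where "m = bump_mean (\<lambda>x. indicator (cball c l) x * v x) c"
  note wm = weak_laplacian_bump_mean[OF v l, folded m_def]
  have D: "continuous_on D F" using v by (auto simp: weak_laplacian_def)
  have B0: "0 \<le> B" using B[of c] l(1) abs_ge_zero[of "F c"] by simp
  have M0: "0 < ?M" by (rule bump_mass_pos)
  have bd: "\<bar>(LINT x|lborel. F x * bump c s x) / (6 * s ^ (?N + 5))\<bar> \<le> B * ?M * l" if s: "0 < s" "s \<le> l" for s
  proof -
    have sub: "cball c s \<subseteq> D" using l s by force
    have i: "integrable lborel (\<lambda>x. F x * bump c s x)" using integrable_bump_cont(2)[OF D sub] s by simp
    have "\<bar>LINT x|lborel. F x * bump c s x\<bar> \<le> (LINT x|lborel. \<bar>F x * bump c s x\<bar>)"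
      by (rule integral_abs_bound)
    also have "\<dots> \<le> (LINT x|lborel. B * bump c s x)"
    proof (rule integral_mono[OF integrable_abs[OF i]])
      show "integrable lborel (\<lambda>x. B * bump c s x)"
        using integrable_bump_cont(2)[OF continuous_on_const, of c s UNIV] s by simp
      fix x show "\<bar>F x * bump c s x\<bar> \<le> B * bump c s x"
      proof (cases "x \<in> ball c s")
        case True
        then show ?thesis using B[of x] s by (auto simp: abs_mult bump_nonneg intro!: mult_right_mono)
      next
        case False
        then show ?thesis using bump_outside(1)[OF _ False] s by simp
      qed
    qed
    also have "\<dots> \<le> B * (s ^ (?N + 6) * ?M)"
      using mult_left_mono[OF integral_bump_le[OF s(1), of c] B0] by simp
    finally have "\<bar>(LINT x|lborel. F x * bump c s x) / (6 * s ^ (?N + 5))\<bar> \<le> B * (s ^ (?N + 6) * ?M) / (6 * s ^ (?N + 5))"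
      using s by (simp add: abs_divide divide_right_mono)
    also have "\<dots> = B * ?M * s / 6" using s by (simp add: field_simps power_add eval_nat_numeral)
    also have "\<dots> \<le> B * ?M * l"
    proof -
      have "B * ?M * s \<le> B * ?M * l" using s B0 M0 by (intro mult_left_mono) auto
      moreover have "0 \<le> B * ?M * s" using s B0 M0 by simp
      ultimately show ?thesis by linarith
    qed
    finally show ?thesis .
  qed
  have "\<bar>m l - m s\<bar> \<le> ?M * B * l\<^sup>2" if s: "0 < s" "s < l" for s
  proof -
    have "norm (m l - m s) \<le> (B * ?M * l) * norm (l - s)"
    proof (rule field_differentiable_bound[of "{s..l}" m])
      fix z assume z: "z \<in> {s..l}"
      then show "(m has_field_derivative (LINT x|lborel. F x * bump c z x) / (6 * z ^ (?N + 5))) (at z within {s..l})"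
        using s by (auto intro: has_field_derivative_at_within[OF wm(3)])
      show "norm ((LINT x|lborel. F x * bump c z x) / (6 * z ^ (?N + 5))) \<le> B * ?M * l"
        using bd[of z] z s by simp
    qed (use s in auto)
    also have "\<dots> \<le> (B * ?M * l) * l" using s l B0 M0 by (intro mult_left_mono) auto
    finally show ?thesis by (simp add: power2_eq_square mult.commute mult.left_commute)
  qed
  then have "\<forall>\<^sub>F s in at_right 0. \<bar>m l - m s\<bar> \<le> ?M * B * l\<^sup>2"
    unfolding eventually_at_right_field using l(1) by (intro exI[of _ l]) simp
  moreover have "((\<lambda>s. \<bar>m l - m s\<bar>) \<longlongrightarrow> \<bar>m l - ?M * v c\<bar>) (at_right 0)"
    by (intro tendsto_intros wm(2))
  ultimately have "\<bar>m l - ?M * v c\<bar> \<le> ?M * B * l\<^sup>2"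
    by (intro tendsto_upperbound[of _ _ "at_right 0"]) auto
  then show ?thesis by (simp add: m_def)
qed

text \<open>Radial functions are written in the squared distance, which is smooth at the centre. The
  case \<open>b = 0\<close> gives radial barriers, the case \<open>a = 0\<close>,
  \<open>b = 1\<close> functions of the type of the Poisson kernel. The last summand is twice the
  product of the gradients of the two factors.\<close>

lemma weak_laplacian_radial:
  fixes z :: "real ^ 'n::finite"
  assumes D: "open D" and I: "\<And>x. x \<in> D \<Longrightarrow> (x - z) \<bullet> (x - z) \<in> I"
    and d1: "\<And>q. q \<in> I \<Longrightarrow> (\<psi> has_real_derivative \<psi>' q) (at q)"
    and d2: "\<And>q. q \<in> I \<Longrightarrow> (\<psi>' has_real_derivative \<psi>'' q) (at q)"
    and c2: "continuous_on I \<psi>''"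
  shows "weak_laplacian D (\<lambda>x. (a + b * x $ n) * \<psi> ((x - z) \<bullet> (x - z)))
     (\<lambda>x. (a + b * x $ n) * (2 * real CARD('n) * \<psi>' ((x - z) \<bullet> (x - z)) +
          4 * ((x - z) \<bullet> (x - z)) * \<psi>'' ((x - z) \<bullet> (x - z))) + 4 * b * (x - z) $ n * \<psi>' ((x - z) \<bullet> (x - z)))"
proof -
  let ?q = "\<lambda>x. (x - z) \<bullet> (x - z)" and ?e = "\<lambda>i. axis i (1::real) :: real ^ 'n"
  define f1 where "f1 i x = b * ?e i $ n * \<psi> (?q x) + (a + b * x $ n) * (2 * (x - z) $ i * \<psi>' (?q x))" for i x
  define f2 where "f2 i x = 4 * b * ?e i $ n * (x - z) $ i * \<psi>' (?q x) +
     (a + b * x $ n) * (2 * \<psi>' (?q x) + 4 * ((x - z) $ i)\<^sup>2 * \<psi>'' (?q x))" for i x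
  have "axis_diff2 D (\<lambda>x. (a + b * x $ n) * \<psi> (?q x)) f1 f2"
    unfolding axis_diff2_def
  proof (intro conjI allI ballI)
    have c: "continuous_on I \<psi>" "continuous_on I \<psi>'"
      by (auto intro!: continuous_at_imp_continuous_on intro: DERIV_isCont[OF d1] DERIV_isCont[OF d2])
    have cq: "continuous_on D (\<lambda>x. f (?q x))" if "continuous_on I f" for f :: "real \<Rightarrow> real"
      by (rule continuous_on_compose2[OF that]) (use I in \<open>auto intro!: continuous_on_inner continuous_on_diff continuous_on_id continuous_on_const\<close>)
    show "continuous_on D (\<lambda>x. (a + b * x $ n) * \<psi> (?q x))"
      by (intro continuous_intros cq[OF c(1)])
    show "continuous_on D (f1 i)" "continuous_on D (f2 i)" for i
      unfolding f1_def f2_def by (intro continuous_intros cq[OF c(1)] cq[OF c(2)] cq[OF c2])+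
    fix x i assume x: "x \<in> D"
    have q: "((\<lambda>t. ?q (x + t *\<^sub>R ?e i)) has_real_derivative 2 * (x - z) $ i) (at 0)"
    proof -
      have "((\<lambda>x. ?q x) has_derivative (\<lambda>h. 2 * ((x - z) \<bullet> h))) (at x)"
        by (auto intro!: derivative_eq_intros simp: inner_commute)
      from has_derivative_imp_axis[OF this, of "?e i"] show ?thesis by (simp add: inner_axis)
    qed
    have n: "((\<lambda>t. a + b * (x + t *\<^sub>R ?e i) $ n) has_real_derivative b * ?e i $ n) (at 0)"
      by (auto intro!: derivative_eq_intros)
    have i: "((\<lambda>t. (x + t *\<^sub>R ?e i - z) $ i) has_real_derivative 1) (at 0)"
      by (auto intro!: derivative_eq_intros simp: axis_def)
    have p: "((\<lambda>t. \<psi> (?q (x + t *\<^sub>R ?e i))) has_real_derivative \<psi>' (?q x) * (2 * (x - z) $ i)) (at 0)"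
      "((\<lambda>t. \<psi>' (?q (x + t *\<^sub>R ?e i))) has_real_derivative \<psi>'' (?q x) * (2 * (x - z) $ i)) (at 0)"
      using DERIV_chain2[where f=\<psi>, OF _ q] DERIV_chain2[where f=\<psi>', OF _ q] d1 d2 I[OF x] by simp_all
    show "((\<lambda>t. (a + b * (x + t *\<^sub>R ?e i) $ n) * \<psi> (?q (x + t *\<^sub>R ?e i))) has_real_derivative f1 i x) (at 0)"
      using DERIV_mult[OF n p(1)] by (simp add: f1_def algebra_simps)
    note d3 = DERIV_mult[OF DERIV_cmult[OF i, of 2] p(2)]
    note d4 = DERIV_add[OF DERIV_cmult[OF p(1), of "b * ?e i $ n"] DERIV_mult[OF n d3]]
    show "((\<lambda>t. f1 i (x + t *\<^sub>R ?e i)) has_real_derivative f2 i x) (at 0)"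
      unfolding f1_def using d4 by (rule DERIV_cong) (simp add: f2_def algebra_simps power2_eq_square)
  qed
  note wl = weak_laplacian_axis_diff2[OF D this]
  show ?thesis
  proof (rule weak_laplacian_cong[OF wl])
    fix x
    have "f2 i x = 4 * b * ?e i $ n * (x - z) $ i * \<psi>' (?q x) + (a + b * x $ n) * (2 * \<psi>' (?q x)) +
       ((a + b * x $ n) * 4 * \<psi>'' (?q x)) * ((x - z) $ i)\<^sup>2" for i
      by (simp add: f2_def algebra_simps)
    then have "(\<Sum>i\<in>UNIV. f2 i x) = (\<Sum>i\<in>UNIV. 4 * b * ?e i $ n * (x - z) $ i * \<psi>' (?q x))
       + (\<Sum>i\<in>(UNIV::'n set). (a + b * x $ n) * (2 * \<psi>' (?q x))) + (\<Sum>i\<in>UNIV. ((a + b * x $ n) * 4 * \<psi>'' (?q x)) * ((x - z) $ i)\<^sup>2)"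
      by (simp only: sum.distrib)
    also have "(\<Sum>i\<in>UNIV. 4 * b * ?e i $ n * (x - z) $ i * \<psi>' (?q x)) = 4 * b * (x - z) $ n * \<psi>' (?q x)"
      by (subst sum.remove[of _ n]) (auto simp: axis_def intro!: sum.neutral)
    also have "(\<Sum>i\<in>UNIV. ((a + b * x $ n) * 4 * \<psi>'' (?q x)) * ((x - z) $ i)\<^sup>2) = ((a + b * x $ n) * 4 * \<psi>'' (?q x)) * ?q x"
      unfolding sum_distrib_left[symmetric] by (simp add: inner_vec_def power2_eq_square)
    finally show "(\<Sum>i\<in>UNIV. f2 i x) = (a + b * x $ n) * (2 * real CARD('n) * \<psi>' (?q x) + 4 * ?q x * \<psi>'' (?q x)) +
      4 * b * (x - z) $ n * \<psi>' (?q x)"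
      by (simp add: algebra_simps)
  qed simp
qed

section \<open>Odd reflection in the half-space\<close>

definition reflect :: "'n::finite \<Rightarrow> real ^ 'n \<Rightarrow> real ^ 'n" where
  "reflect n x = (\<chi> i. if i = n then - x $ i else x $ i)"

lemma reflect_nth[simp]: "reflect n x $ i = (if i = n then - x $ i else x $ i)"
  by (simp add: reflect_def)

lemma reflect_reflect[simp]: "reflect n (reflect n x) = x"
  by (simp add: vec_eq_iff)

lemma inner_diff_reflect: "(reflect n x - y) \<bullet> (reflect n x - y) = (x - reflect n y) \<bullet> (x - reflect n y)"
  unfolding inner_vec_def by (intro sum.cong) (auto simp: algebra_simps)

text \<open>For two points of the half-space, the mirror image of one is farther from the other by
  an explicit amount, which vanishes at the boundary. The estimates for odd bumps rest on
  this.\<close>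

lemma inner_minus_reflect: "(x - reflect n c) \<bullet> (x - reflect n c) = (x - c) \<bullet> (x - c) + 4 * x $ n * c $ n"
proof -
  have "(x - reflect n c) \<bullet> (x - reflect n c) = (x $ n + c $ n)\<^sup>2 + (\<Sum>i\<in>UNIV - {n}. (x $ i - c $ i) * (x $ i - c $ i))"
    unfolding inner_vec_def by (subst sum.remove[of _ n]) (auto simp: power2_eq_square intro!: sum.cong)
  moreover have "(x - c) \<bullet> (x - c) = (x $ n - c $ n)\<^sup>2 + (\<Sum>i\<in>UNIV - {n}. (x $ i - c $ i) * (x $ i - c $ i))"
    unfolding inner_vec_def by (subst sum.remove[of _ n]) (auto simp: power2_eq_square)
  ultimately show ?thesis by (simp add: power2_eq_square algebra_simps)
qed

lemma lborel_distr_reflect: "distr lborel borel (reflect n) = (lborel :: (real ^ 'n::finite) measure)"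
proof -
  define c :: "real ^ 'n \<Rightarrow> real" where "c j = (if j = axis n 1 then -1 else 1)" for j
  have T: "(\<Sum>j\<in>Basis. (c j * (x \<bullet> j)) *\<^sub>R j) = reflect n x" for x :: "real ^ 'n"
  proof (rule euclidean_eqI)
    fix b :: "real ^ 'n" assume b: "b \<in> Basis"
    then obtain i where i: "b = axis i 1" by (auto simp: Basis_vec_def)
    have "(\<Sum>j\<in>Basis. (c j * (x \<bullet> j)) *\<^sub>R j) \<bullet> b = c b * (x \<bullet> b)"
      using b by (rule inner_sum_left_Basis)
    also have "\<dots> = reflect n x \<bullet> b"
      by (auto simp: i c_def inner_axis axis_eq_axis)
    finally show "(\<Sum>j\<in>Basis. (c j * (x \<bullet> j)) *\<^sub>R j) \<bullet> b = reflect n x \<bullet> b" .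
  qed
  have "\<And>j. j \<in> Basis \<Longrightarrow> c j \<noteq> 0" by (simp add: c_def)
  from lborel_affine_euclidean[where c=c and t=0, OF this]
  have "lborel = density (distr lborel borel (\<lambda>x. reflect n x)) (\<lambda>_. (\<Prod>j\<in>Basis. \<bar>c j\<bar>))"
    by (simp add: T)
  moreover have "(\<Prod>j\<in>Basis. \<bar>c j\<bar>) = 1" by (intro prod.neutral) (simp add: c_def)
  ultimately show ?thesis by (simp add: density_1)
qed

lemma reflect_measurable[measurable]: "reflect n \<in> borel_measurable borel"
proof -
  have "continuous_on UNIV (\<lambda>x :: real ^ 'a. if i = n then - x $ i else x $ i)" for i
    by (cases "i = n") (auto intro!: continuous_intros)
  then show ?thesis unfolding reflect_def[abs_def]
    by (intro borel_measurable_continuous_onI continuous_on_vec_lambda)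
qed

text \<open>Since \<open>h\<close> vanishes on the hyperplane, the splitting into the two open
  half-spaces is exact at every point; the lower part is folded up by the invariance of Lebesgue
  measure.\<close>

lemma integral_reflect:
  fixes h :: "real ^ 'n::finite \<Rightarrow> real"
  assumes h: "integrable lborel h" and z: "\<And>x. x $ n = 0 \<Longrightarrow> h x = 0"
  shows "(LINT x|lborel. h x) = (LINT x|lborel. indicator (half_space n) x * (h x + h (reflect n x)))"
proof -
  let ?O = "half_space n"
  have [measurable]: "h \<in> borel_measurable borel" using borel_measurable_integrable[OF h] by simp
  have [measurable]: "?O \<in> sets borel" unfolding half_space_def by measurable
  have [measurable]: "(\<lambda>x. indicator ?O (reflect n x) * h x) \<in> borel_measurable borel" by measurable
  have hr: "integrable lborel (\<lambda>x. h (reflect n x))"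
    using h integrable_distr_eq[of "reflect n" lborel borel h] lborel_distr_reflect[of n] by simp
  have i1: "integrable lborel (\<lambda>x. indicator ?O x * h x)"
    by (rule Bochner_Integration.integrable_bound[OF h]) (auto simp: indicator_def)
  have i2: "integrable lborel (\<lambda>x. indicator ?O x * h (reflect n x))"
    by (rule Bochner_Integration.integrable_bound[OF hr]) (auto simp: indicator_def)
  have i3: "integrable lborel (\<lambda>x. indicator ?O (reflect n x) * h x)"
    by (rule Bochner_Integration.integrable_bound[OF h]) (auto simp: indicator_def)
  have eq: "h x = indicator ?O x * h x + indicator ?O (reflect n x) * h x" for x
    using z[of x] by (cases "x $ n = 0") (auto simp: indicator_def half_space_def)
  have "(LINT x|lborel. h x) = (LINT x|lborel. indicator ?O x * h x) + (LINT x|lborel. indicator ?O (reflect n x) * h x)"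
    by (subst eq) (rule Bochner_Integration.integral_add[OF i1 i3])
  also have "(LINT x|lborel. indicator ?O (reflect n x) * h x) =
      (LINT x|distr lborel borel (reflect n). indicator ?O (reflect n x) * h x)"
    by (simp only: lborel_distr_reflect)
  also have "\<dots> = (LINT x|lborel. indicator ?O x * h (reflect n x))"
    by (subst integral_distr) auto
  finally show ?thesis using i1 i2 by (simp add: distrib_left Bochner_Integration.integral_add)
qed

lemma open_half_space: "open (half_space n)"
proof -
  have "half_space n = {x. axis n 1 \<bullet> x > 0}" by (simp add: half_space_def inner_axis' )
  then show ?thesis by (simp add: open_halfspace_gt)
qed

lemma frontier_half_space: "frontier (half_space n) = {x. x $ n = 0}"
proof -
  have "half_space n = {x. axis n 1 \<bullet> x > 0}" by (simp add: half_space_def inner_axis')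
  moreover have "axis n (1::real) \<noteq> 0" by (simp add: axis_eq_0_iff)
  ultimately show ?thesis using frontier_halfspace_gt[of "axis n (1::real)" 0] by (simp add: inner_axis' inner_real_def)
qed

lemma half_space_measurable[measurable]: "half_space n \<in> sets borel"
  using open_half_space by (rule borel_open)

text \<open>It vanishes on the boundary for every centre and radius, hence is an admissible test
  function even when the ball crosses the boundary. The radius can therefore run to
  infinity.\<close>

definition odd_bump :: "'n::finite \<Rightarrow> real ^ 'n \<Rightarrow> real \<Rightarrow> real ^ 'n \<Rightarrow> real" where
  "odd_bump n c l x = bump c l x - bump (reflect n c) l x"

lemma partial_eqI: "(\<zeta> has_derivative A) (at x) \<Longrightarrow> partial i \<zeta> x = A (axis i 1)"
  using frechet_derivative_at unfolding partial_def by metis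

lemma partial_odd_bump: "partial i (odd_bump n c l) = (\<lambda>x. bump_grad c l i x - bump_grad (reflect n c) l i x)"
proof
  fix x
  show "partial i (odd_bump n c l) x = bump_grad c l i x - bump_grad (reflect n c) l i x"
    unfolding odd_bump_def[abs_def]
    by (subst partial_eqI[OF has_derivative_diff[OF bump_has_derivative bump_has_derivative]])
       (simp add: bump_grad_def inner_axis algebra_simps)
qed

lemma partial_partial_odd_bump:
  "partial j (partial i (odd_bump n c l)) = (\<lambda>x. bump_hess c l j i x - bump_hess (reflect n c) l j i x)"
proof
  fix x
  show "partial j (partial i (odd_bump n c l)) x = bump_hess c l j i x - bump_hess (reflect n c) l j i x"
    unfolding partial_odd_bump
    by (subst partial_eqI[OF has_derivative_diff[OF bump_grad_has_derivative bump_grad_has_derivative]])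
       (simp add: bump_hess_def inner_axis algebra_simps)
qed

lemma laplacian_odd_bump: "laplacian (odd_bump n c l) x = bump_lap c l x - bump_lap (reflect n c) l x"
  by (simp add: laplacian_def partial_partial_odd_bump sum_subtractf sum_bump_hess)

lemma C2_odd_bump: "C2 (odd_bump n c l)"
  unfolding C2_def
proof (intro conjI allI)
  show "odd_bump n c l differentiable_on UNIV"
    unfolding odd_bump_def[abs_def] differentiable_on_def differentiable_def
    using has_derivative_diff[OF bump_has_derivative bump_has_derivative] by blast
  show "partial i (odd_bump n c l) differentiable_on UNIV" for i
    unfolding partial_odd_bump differentiable_on_def differentiable_def
    using has_derivative_diff[OF bump_grad_has_derivative bump_grad_has_derivative] by blast
  show "continuous_on UNIV (partial j (partial i (odd_bump n c l)))" for i j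
    unfolding partial_partial_odd_bump by (intro continuous_intros bump_continuous)
qed

lemma odd_bump_frontier: "x $ n = 0 \<Longrightarrow> odd_bump n c l x = 0"
  by (simp add: odd_bump_def bump_def inner_minus_reflect)

lemma odd_bump_outside: "\<lbrakk>0 \<le> l; x \<notin> ball c l; x \<notin> ball (reflect n c) l\<rbrakk> \<Longrightarrow> odd_bump n c l x = 0"
  by (simp add: odd_bump_def bump_outside)

lemma compact_supp_odd_bump:
  assumes "0 \<le> l"
  shows "compact (supp (odd_bump n c l))"
proof -
  have "{x. odd_bump n c l x \<noteq> 0} \<subseteq> cball c l \<union> cball (reflect n c) l"
  proof (rule subsetI, rule ccontr)
    fix x assume "x \<in> {x. odd_bump n c l x \<noteq> 0}" "x \<notin> cball c l \<union> cball (reflect n c) l"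
    then show False using odd_bump_outside[OF assms, of x c n] by auto
  qed
  then have "bounded {x. odd_bump n c l x \<noteq> 0}"
    using bounded_subset bounded_Un bounded_cball by metis
  then show ?thesis unfolding supp_def by (simp add: compact_closure)
qed

text \<open>A difference of cubes contains the difference of the bases, which is at most
  \<open>4 * x $ n * c $ n\<close>. The resulting factor \<open>x $ n\<close> matches the weight in
  the integrability condition on the absorption term.\<close>

lemma odd_bump_bounds:
  assumes "0 < x $ n" "0 < c $ n"
  shows "0 \<le> odd_bump n c l x" "odd_bump n c l x \<le> 12 * l ^ 4 * c $ n * x $ n"
proof -
  define q \<delta> where "q = (x - c) \<bullet> (x - c)" and "\<delta> = 4 * x $ n * c $ n"
  define m1 m2 where "m1 = max 0 (l\<^sup>2 - q)" and "m2 = max 0 (l\<^sup>2 - (q + \<delta>))"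
  have pos: "0 < \<delta>" using assms by (simp add: \<delta>_def)
  have "0 \<le> q" by (simp add: q_def)
  with pos have m: "0 \<le> m2" "m2 \<le> m1" "m1 \<le> l\<^sup>2" "m1 - m2 \<le> \<delta>"
    by (auto simp: m1_def m2_def max_def)
  have e: "odd_bump n c l x = m1 ^ 3 - m2 ^ 3" by (simp add: odd_bump_def bump_def m1_def m2_def q_def \<delta>_def inner_minus_reflect)
  show "0 \<le> odd_bump n c l x" unfolding e using power_mono[OF m(2,1), of 3] by simp
  have "m1 ^ 3 - m2 ^ 3 = (m1 - m2) * (m1 * m1 + m1 * m2 + m2 * m2)"
    by (simp add: algebra_simps power3_eq_cube)
  also have "\<dots> \<le> \<delta> * (l\<^sup>2 * l\<^sup>2 + l\<^sup>2 * l\<^sup>2 + l\<^sup>2 * l\<^sup>2)"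
    using m pos by (intro mult_mono add_mono) auto
  also have "\<dots> = 12 * l ^ 4 * c $ n * x $ n" by (simp add: \<delta>_def power4_eq_xxxx power2_eq_square)
  finally show "odd_bump n c l x \<le> 12 * l ^ 4 * c $ n * x $ n" by (simp add: e)
qed

lemma partial_odd_bump_frontier:
  assumes "a $ n = 0"
  shows "partial n (odd_bump n c l) a = 12 * c $ n * max 0 (l\<^sup>2 - (a - c) \<bullet> (a - c)) ^ 2"
proof -
  have "(a - reflect n c) \<bullet> (a - reflect n c) = (a - c) \<bullet> (a - c)" using assms by (simp add: inner_minus_reflect)
  then show ?thesis using assms unfolding partial_odd_bump bump_grad_def by simp
qed

lemma integral_scale_return:
  fixes h :: "'a::topological_space \<Rightarrow> real"
  assumes "0 \<le> k" "h \<in> borel_measurable borel"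
  shows "(LINT y|scale_measure (ennreal k) (return borel a). h y) = k * h a"
proof -
  have "scale_measure (ennreal k) (return borel a) = density (return borel a) (\<lambda>_. ennreal k)"
    by (rule measure_eqI) (auto simp: emeasure_density nn_integral_cmult_indicator)
  then have "(LINT y|scale_measure (ennreal k) (return borel a). h y) = (LINT y|return borel a. k *\<^sub>R h y)"
    using assms by (simp add: integral_density)
  also have "\<dots> = k * h a" using assms by (subst integral_return) auto
  finally show ?thesis .
qed

lemma bump_kernel_le:
  fixes c :: "real ^ 'n::finite"
  assumes "0 < l"
  shows "bump_kernel c l x \<le> 1 / l ^ CARD('n)"
proof -
  have "max 0 (l\<^sup>2 - (x - c) \<bullet> (x - c)) ^ 2 \<le> (l\<^sup>2) ^ 2" by (rule power_mono) auto
  then have "bump_kernel c l x \<le> l ^ 4 / l ^ (CARD('n) + 4)"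
    unfolding bump_kernel_def using assms by (intro divide_right_mono) auto
  also have "\<dots> = 1 / l ^ CARD('n)" using assms by (simp add: power_add)
  finally show ?thesis .
qed

text \<open>The kernel is at most \<open>1 / l ^ CARD('n)\<close>, so a fixed ball contributes
  little for large \<open>l\<close>; outside that ball \<open>w\<close> is small, and the kernel has
  a fixed mass.\<close>

lemma bump_mean_at_top:
  fixes c :: "real ^ 'n::finite"
  assumes w: "loc_integrable w" and w0: "\<And>x. 0 \<le> w x" and dec: "\<And>e. 0 < e \<Longrightarrow> \<exists>\<rho>. \<forall>x. x \<notin> cball 0 \<rho> \<longrightarrow> w x \<le> e"
  shows "((\<lambda>l. bump_mean w c l) \<longlongrightarrow> 0) at_top"
proof (rule tendstoI)
  fix e :: real assume e: "0 < e"
  let ?M = "bump_mass TYPE('n)"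
  have M: "0 < ?M" by (rule bump_mass_pos)
  obtain \<rho> where \<rho>: "\<And>x. x \<notin> cball 0 \<rho> \<Longrightarrow> w x \<le> e / (2 * ?M)" using dec[of "e / (2 * ?M)"] e M by auto
  define I where "I = (LINT x|lborel. indicator (cball 0 \<rho>) x * w x)"
  have iI: "integrable lborel (\<lambda>x. indicator (cball 0 \<rho>) x * w x)" using w unfolding loc_integrable_def by blast
  have I0: "0 \<le> I" unfolding I_def by (rule Bochner_Integration.integral_nonneg) (simp add: w0)
  have le: "bump_mean w c l \<le> e / 2 + I / l" if l: "1 \<le> l" for l
  proof -
    have l0: "0 < l" using l by simp
    have i1: "integrable lborel (\<lambda>x. e / (2 * ?M) * bump_kernel c l x)"
      by (rule loc_integrable_bump(1)[OF loc_integrable_const]) (use l in simp)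
    have ln: "1 / l ^ CARD('n) \<le> 1 / l"
      using l self_le_power[OF l, of "CARD('n)"] by (intro divide_left_mono) auto
    have "bump_mean w c l \<le> (LINT x|lborel. e / (2 * ?M) * bump_kernel c l x + (indicator (cball 0 \<rho>) x * w x) * (1 / l))"
      unfolding bump_mean_def
    proof (rule integral_mono)
      show "integrable lborel (\<lambda>x. w x * bump_kernel c l x)" by (rule loc_integrable_bump(1)[OF w]) (use l in simp)
      show "integrable lborel (\<lambda>x. e / (2 * ?M) * bump_kernel c l x + (indicator (cball 0 \<rho>) x * w x) * (1 / l))"
        by (intro Bochner_Integration.integrable_add i1 integrable_mult_left iI)
      fix x
      have k0: "0 \<le> bump_kernel c l x" by (rule bump_kernel_nonneg) (use l in simp)
      show "w x * bump_kernel c l x \<le> e / (2 * ?M) * bump_kernel c l x + (indicator (cball 0 \<rho>) x * w x) * (1 / l)"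
      proof (cases "x \<in> cball 0 \<rho>")
        case True
        have "w x * bump_kernel c l x \<le> w x * (1 / l)"
          using order_trans[OF bump_kernel_le[OF l0, of c x] ln] w0 by (intro mult_left_mono) auto
        moreover have "0 \<le> e / (2 * ?M) * bump_kernel c l x" using k0 e M by simp
        ultimately show ?thesis using True by simp
      next
        case False
        then show ?thesis using mult_right_mono[OF \<rho>[OF False] k0] by simp
      qed
    qed
    also have "\<dots> = (LINT x|lborel. e / (2 * ?M) * bump_kernel c l x) + (LINT x|lborel. (indicator (cball 0 \<rho>) x * w x) * (1 / l))"
      by (intro Bochner_Integration.integral_add i1 integrable_mult_left iI)
    also have "\<dots> = e / (2 * ?M) * ?M + I / l"
      using integral_bump_kernel[OF l0, of c] by (simp add: I_def)
    also have "\<dots> = e / 2 + I / l" using M by simp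
    finally show ?thesis .
  qed
  have ge: "0 \<le> bump_mean w c l" if "1 \<le> l" for l
    unfolding bump_mean_def
    by (rule Bochner_Integration.integral_nonneg) (use that in \<open>simp add: w0 bump_kernel_nonneg\<close>)
  have "dist (bump_mean w c l) 0 < e" if "max 1 (2 * I / e + 1) \<le> l" for l
  proof -
    have l: "1 \<le> l" "2 * I / e < l" using that by auto
    then have "I / l < e / 2" using e by (simp add: field_simps)
    then show ?thesis using le[OF l(1)] ge[OF l(1)] unfolding dist_real_def by linarith
  qed
  then show "\<forall>\<^sub>F l in at_top. dist (bump_mean w c l) 0 < e"
    unfolding eventually_at_top_linorder by blast
qed

lemma loc_integrable_set:
  assumes "\<forall>R>0. set_integrable lborel (S \<inter> ball 0 R) u"
  shows "loc_integrable (\<lambda>x. indicator S x * u x)"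
  unfolding loc_integrable_def
proof
  fix R :: real
  let ?R = "\<bar>R\<bar> + 1"
  have i: "integrable lborel (\<lambda>x. indicator (S \<inter> ball 0 ?R) x *\<^sub>R u x)"
    using assms unfolding set_integrable_def by simp
  then have [measurable]: "(\<lambda>x. indicator (S \<inter> ball 0 ?R) x *\<^sub>R u x) \<in> borel_measurable borel"
    using borel_measurable_integrable by fastforce
  have eq: "indicator (cball 0 R) x * (indicator S x * u x) = indicator (cball 0 R) x * (indicator (S \<inter> ball 0 ?R) x *\<^sub>R u x)" for x
    by (auto simp: indicator_def)
  show "integrable lborel (\<lambda>x. indicator (cball 0 R) x * (indicator S x * u x))"
    unfolding eq
  proof (rule Bochner_Integration.integrable_bound[OF i])
    show "(\<lambda>x. indicator (cball 0 R) x * (indicator (S \<inter> ball 0 ?R) x *\<^sub>R u x)) \<in> borel_measurable lborel"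
      using borel_measurable_integrable[OF i] by (intro borel_measurable_times borel_measurable_indicator) auto
  qed (auto simp: indicator_def)
qed

text \<open>The weak formulation for \<open>odd_bump\<close>. The boundary term is its normal
  derivative at \<open>a\<close>, which is nonzero only when the ball of radius \<open>l\<close>
  about \<open>c\<close> contains \<open>a\<close>.\<close>

lemma measure_solution_odd_bump:
  fixes c a :: "real ^ 'n::finite"
  assumes u: "measure_boundary_solution n g p (scale_measure (ennreal k) (return borel a)) u" and k: "0 \<le> k"
    and g: "continuous_on (half_space n) g" "\<And>x. x \<in> half_space n \<Longrightarrow> 0 \<le> g x" and p: "0 < p"
    and a: "a $ n = 0" and c: "0 < c $ n" and l: "0 < l"
  defines "v \<equiv> \<lambda>x. indicator (half_space n) x * u x"
    and "F \<equiv> \<lambda>x. indicator (half_space n) x * (g x * u x powr p)"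
  shows "loc_integrable v" "loc_integrable (\<lambda>x. F x * x $ n)"
    "integrable lborel (\<lambda>x. F x * odd_bump n c l x)"
    "(LINT x|lborel. v x * bump_lap c l x) - (LINT x|lborel. v x * bump_lap (reflect n c) l x) =
     (LINT x|lborel. F x * odd_bump n c l x) - 12 * k * c $ n * (max 0 (l\<^sup>2 - (a - c) \<bullet> (a - c)))\<^sup>2"
proof -
  let ?O = "half_space n"
  have u0: "continuous_on ?O u" "\<And>x. x \<in> ?O \<Longrightarrow> 0 \<le> u x"
    and iu: "\<forall>R>0. set_integrable lborel (?O \<inter> ball 0 R) u"
    and iF: "\<forall>R>0. set_integrable lborel (?O \<inter> ball 0 R) (\<lambda>x. g x * u x powr p * x $ n)"
    and weak: "\<And>\<zeta>. C2 \<zeta> \<and> compact (supp \<zeta>) \<and> (\<forall>x\<in>frontier ?O. \<zeta> x = 0) \<Longrightarrow>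
        (LINT x:?O|lborel. - u x * laplacian \<zeta> x + g x * u x powr p * \<zeta> x) =
        (LINT y:frontier ?O|(scale_measure (ennreal k) (return borel a)). partial n \<zeta> y)"
    using u unfolding measure_boundary_solution_def by auto
  show v: "loc_integrable v" unfolding v_def by (rule loc_integrable_set[OF iu])
  show Fx: "loc_integrable (\<lambda>x. F x * x $ n)"
    using loc_integrable_set[OF iF] by (simp add: F_def mult.assoc)
  have "continuous_on ?O (\<lambda>x. g x * u x powr p)"
    by (intro continuous_intros g u0 continuous_on_powr') (use u0 p in auto)
  then have [measurable]: "F \<in> borel_measurable borel"
    unfolding F_def real_scaleR_def[symmetric]
    by (rule borel_measurable_continuous_on_indicator[OF half_space_measurable])
  have [measurable]: "odd_bump n c l \<in> borel_measurable borel" unfolding odd_bump_def[abs_def] by measurable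
  obtain R where R: "\<And>x. x \<in> ball c l \<or> x \<in> ball (reflect n c) l \<Longrightarrow> x \<in> cball 0 R"
  proof -
    have "bounded (ball c l \<union> ball (reflect n c) l)" by simp
    then show ?thesis using that unfolding bounded_iff by (metis UnI1 UnI2 mem_cball_0)
  qed
  show iFz: "integrable lborel (\<lambda>x. F x * odd_bump n c l x)"
  proof (rule Bochner_Integration.integrable_bound)
    show "integrable lborel (\<lambda>x. (12 * l ^ 4 * c $ n) * (indicator (cball 0 R) x * (F x * x $ n)))"
      using Fx unfolding loc_integrable_def by (intro integrable_mult_right) blast
    show "AE x in lborel. norm (F x * odd_bump n c l x) \<le> norm ((12 * l ^ 4 * c $ n) * (indicator (cball 0 R) x * (F x * x $ n)))"
    proof (rule AE_I2)
      fix x :: "real ^ 'n"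
      show "norm (F x * odd_bump n c l x) \<le> norm ((12 * l ^ 4 * c $ n) * (indicator (cball 0 R) x * (F x * x $ n)))"
      proof (cases "x \<in> ?O \<and> x \<in> cball 0 R")
        case True
        then have x: "0 < x $ n" by (simp add: half_space_def)
        have "\<bar>F x\<bar> * \<bar>odd_bump n c l x\<bar> \<le> \<bar>F x\<bar> * (12 * l ^ 4 * c $ n * x $ n)"
          using odd_bump_bounds[OF x c, of l] by (intro mult_left_mono) auto
        then show ?thesis using True x c l by (simp add: abs_mult mult.commute mult.left_commute)
      next
        case False
        then consider "x \<notin> ?O" | "x \<notin> ball c l \<and> x \<notin> ball (reflect n c) l" using R by blast
        then have "F x * odd_bump n c l x = 0"
        proof cases
          case 2
          then show ?thesis using odd_bump_outside[of l x c n] l by simp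
        qed (simp add: F_def)
        then show ?thesis by (simp only: norm_zero norm_ge_zero)
      qed
    qed
  qed measurable
  have i1: "integrable lborel (\<lambda>x. v x * bump_lap c l x)" "integrable lborel (\<lambda>x. v x * bump_lap (reflect n c) l x)"
    by (rule loc_integrable_bump(2)[OF v]; use l in simp)+
  have "(LINT x:?O|lborel. - u x * laplacian (odd_bump n c l) x + g x * u x powr p * odd_bump n c l x)
      = (LINT x|lborel. F x * odd_bump n c l x - (v x * bump_lap c l x - v x * bump_lap (reflect n c) l x))"
    unfolding set_lebesgue_integral_def
    by (intro Bochner_Integration.integral_cong refl) (simp add: F_def v_def laplacian_odd_bump algebra_simps)
  also have "\<dots> = (LINT x|lborel. F x * odd_bump n c l x) - ((LINT x|lborel. v x * bump_lap c l x) - (LINT x|lborel. v x * bump_lap (reflect n c) l x))"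
    using i1 iFz by (simp add: Bochner_Integration.integral_diff)
  finally have lhs: "(LINT x:?O|lborel. - u x * laplacian (odd_bump n c l) x + g x * u x powr p * odd_bump n c l x) = \<dots>" .
  have [measurable]: "frontier ?O \<in> sets borel" by simp
  have afr: "a \<in> frontier ?O" using a by (simp add: frontier_half_space)
  have [measurable]: "partial n (odd_bump n c l) \<in> borel_measurable borel"
    unfolding partial_odd_bump by measurable
  have "(LINT y:frontier ?O|(scale_measure (ennreal k) (return borel a)). partial n (odd_bump n c l) y)
      = k * (indicator (frontier ?O) a *\<^sub>R partial n (odd_bump n c l) a)"
    unfolding set_lebesgue_integral_def by (rule integral_scale_return[OF k]) measurable
  also have "\<dots> = 12 * k * c $ n * (max 0 (l\<^sup>2 - (a - c) \<bullet> (a - c)))\<^sup>2"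
    using afr a by (simp add: partial_odd_bump_frontier)
  finally have rhs: "(LINT y:frontier ?O|(scale_measure (ennreal k) (return borel a)). partial n (odd_bump n c l) y) = \<dots>" .
  have "C2 (odd_bump n c l) \<and> compact (supp (odd_bump n c l)) \<and> (\<forall>x\<in>frontier ?O. odd_bump n c l x = 0)"
    using l by (simp add: C2_odd_bump compact_supp_odd_bump odd_bump_frontier frontier_half_space)
  from weak[OF this] show "(LINT x|lborel. v x * bump_lap c l x) - (LINT x|lborel. v x * bump_lap (reflect n c) l x) =
     (LINT x|lborel. F x * odd_bump n c l x) - 12 * k * c $ n * (max 0 (l\<^sup>2 - (a - c) \<bullet> (a - c)))\<^sup>2"
    unfolding lhs rhs by simp
qed

text \<open>
  An antiderivative of \<open>(l\<^sup>2 - d\<^sup>2)\<^sup>2 / l\<^sup>N\<^sup>+\<^sup>5\<close>. The value at \<open>l = d\<close> gives the factor \<open>d\<^sup>-\<^sup>N\<close> of the Poisson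
  kernel.
\<close>

definition radial_prim :: "nat \<Rightarrow> real \<Rightarrow> real \<Rightarrow> real" where
  "radial_prim N d l = - 1 / (real N * l ^ N) + 2 * d\<^sup>2 / (real (N + 2) * l ^ (N + 2)) - d ^ 4 / (real (N + 4) * l ^ (N + 4))"

lemma DERIV_inverse_power:
  assumes "0 < (l::real)" "0 < m"
  shows "((\<lambda>l. k / (real m * l ^ m)) has_real_derivative - k / l ^ (m + 1)) (at l)"
proof -
  have "((\<lambda>l. real m * l ^ m) has_real_derivative real m * (real m * l ^ (m - 1))) (at l)"
    using DERIV_cmult[OF DERIV_pow[of m l UNIV], of "real m"] by simp
  from DERIV_divide[OF DERIV_const[of k] this]
  have "((\<lambda>l. k / (real m * l ^ m)) has_real_derivative
      - (k * (real m * (real m * l ^ (m - 1)))) / (real m * l ^ m * (real m * l ^ m))) (at l)"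
    using assms by simp
  moreover have "- (k * (real m * (real m * l ^ (m - 1)))) / (real m * l ^ m * (real m * l ^ m)) = - k / l ^ (m + 1)"
  proof -
    obtain j where j: "m = Suc j" using assms(2) by (cases m) auto
    define M where "M = real m"
    have M: "M \<noteq> 0" using assms(2) by (simp add: M_def)
    have "- (k * (M * (M * l ^ j))) / (M * (l * l ^ j) * (M * (l * l ^ j))) = - k / (l * (l * l ^ j))"
      using M assms(1) by (simp add: divide_simps)
    then show ?thesis unfolding M_def[symmetric] by (simp add: j)
  qed
  ultimately show ?thesis by simp
qed

lemma DERIV_radial_prim:
  assumes "0 < l" "0 < N"
  shows "(radial_prim N d has_real_derivative (l\<^sup>2 - d\<^sup>2)\<^sup>2 / l ^ (N + 5)) (at l)"
proof -
  note d1 = DERIV_inverse_power[OF assms, of "- 1"]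
    and d2 = DERIV_inverse_power[OF assms(1), of "N + 2" "2 * d\<^sup>2"]
    and d3 = DERIV_inverse_power[OF assms(1), of "N + 4" "d ^ 4"]
  have e: "l ^ (N + 5) = l ^ (N + 1) * l ^ 4" "l ^ (N + 5) = l ^ (N + 3) * l\<^sup>2"
    by (simp_all add: power_add[symmetric] flip: power_add) (simp_all add: add.commute eval_nat_numeral)
  have "(l\<^sup>2 - d\<^sup>2)\<^sup>2 / l ^ (N + 5) = l ^ 4 / l ^ (N + 5) - 2 * d\<^sup>2 * l\<^sup>2 / l ^ (N + 5) + d ^ 4 / l ^ (N + 5)"
    by (simp add: power2_eq_square power4_eq_xxxx algebra_simps flip: diff_divide_distrib add_divide_distrib)
  also have "\<dots> = 1 / l ^ (N + 1) - 2 * d\<^sup>2 / l ^ (N + 3) + d ^ 4 / l ^ (N + 5)"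
  proof -
    have "l ^ 4 / l ^ (N + 5) = 1 / l ^ (N + 1)" unfolding e(1) using assms by simp
    moreover have "2 * d\<^sup>2 * l\<^sup>2 / l ^ (N + 5) = 2 * d\<^sup>2 / l ^ (N + 3)" unfolding e(2) using assms by simp
    ultimately show ?thesis by simp
  qed
  finally have eq: "(l\<^sup>2 - d\<^sup>2)\<^sup>2 / l ^ (N + 5) = - (- 1) / l ^ (N + 1) + - (2 * d\<^sup>2) / l ^ (N + 3) - - (d ^ 4) / l ^ (N + 5)"
    by simp
  show ?thesis
    unfolding radial_prim_def[abs_def] eq
    using DERIV_diff[OF DERIV_add[OF d1 d2] d3] by (simp add: add.commute eval_nat_numeral)
qed

lemma radial_prim_at_top:
  assumes "0 < N"
  shows "(radial_prim N d \<longlongrightarrow> 0) at_top"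
proof -
  have t: "((\<lambda>l. k / (real m * l ^ m)) \<longlongrightarrow> 0) at_top" if "0 < m" for k :: real and m
    using that by real_asymp
  have "(radial_prim N d \<longlongrightarrow> 0 + 0 - 0) at_top"
    unfolding radial_prim_def[abs_def] by (intro tendsto_add tendsto_diff t) (use assms in auto)
  then show ?thesis by simp
qed

text \<open>By \<open>DERIV_radial_prim\<close> and the limit at infinity,
  \<open>radial_const N / d ^ N\<close> is the integral of
  \<open>(l\<^sup>2 - d\<^sup>2)\<^sup>2 / l ^ (N + 5)\<close> over \<open>l \<ge> d\<close>, for
  positive \<open>N\<close> and \<open>d\<close>.\<close>

definition radial_const :: "nat \<Rightarrow> real" where
  "radial_const N = 1 / real N - 2 / real (N + 2) + 1 / real (N + 4)"

lemma radial_const_pos: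
  assumes "0 < N"
  shows "0 < radial_const N"
proof -
  define x where "x = real N"
  have x: "0 < x" using assms by (simp add: x_def)
  have "radial_const N = 1 / x - 2 / (x + 2) + 1 / (x + 4)" by (simp add: radial_const_def x_def)
  also have "\<dots> = 8 / (x * (x + 2) * (x + 4))" using x by (simp add: divide_simps) (simp add: algebra_simps)
  finally show ?thesis using x by simp
qed

lemma radial_prim_diag:
  assumes "0 < d"
  shows "radial_prim N d d = - radial_const N / d ^ N"
proof -
  have "2 * d\<^sup>2 / (real (N + 2) * d ^ (N + 2)) = 2 / real (N + 2) / d ^ N"
    "d ^ 4 / (real (N + 4) * d ^ (N + 4)) = 1 / real (N + 4) / d ^ N"
    using assms by (simp_all add: power_add power2_eq_square)
  then show ?thesis unfolding radial_prim_def radial_const_def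
    by (simp add: diff_divide_distrib add_divide_distrib)
qed

lemma odd_zero:
  fixes w :: "real ^ 'n::finite \<Rightarrow> real"
  assumes "\<And>x. w (reflect n x) = - w x" "x $ n = 0"
  shows "w x = 0"
proof -
  have "reflect n x = x" using assms(2) by (simp add: vec_eq_iff)
  then show ?thesis using assms(1)[of x] by simp
qed

lemma integral_odd_bump:
  fixes w :: "real ^ 'n::finite \<Rightarrow> real"
  assumes w: "continuous_on UNIV w" "\<And>x. w (reflect n x) = - w x" and l: "0 < l"
  shows "(LINT x|lborel. w x * bump c l x) = (LINT x|lborel. indicator (half_space n) x * (w x * odd_bump n c l x))"
proof -
  have "w x = 0" if "x $ n = 0" for x using odd_zero[of w, OF w(2) that] .
  then have "(LINT x|lborel. w x * bump c l x) =
      (LINT x|lborel. indicator (half_space n) x * (w x * bump c l x + w (reflect n x) * bump c l (reflect n x)))"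
    using l by (intro integral_reflect loc_integrable_bump loc_integrable_continuous w) auto
  also have "bump c l (reflect n x) = bump (reflect n c) l x" for x
    by (simp add: bump_def inner_diff_reflect)
  ultimately show ?thesis by (simp add: w odd_bump_def algebra_simps)
qed

text \<open>In the half-space the kernel about \<open>c\<close> dominates its mirror image, so that
  the folded integrand is nonnegative.\<close>

lemma bump_mean_odd_nonneg:
  fixes w :: "real ^ 'n::finite \<Rightarrow> real"
  assumes w: "continuous_on UNIV w" "\<And>x. w (reflect n x) = - w x" "\<And>x. 0 < x $ n \<Longrightarrow> 0 \<le> w x"
    and l: "0 < l" and c: "0 < c $ n"
  shows "0 \<le> bump_mean w c l"
proof -
  have "w x = 0" if "x $ n = 0" for x using odd_zero[of w, OF w(2) that] .
  then have "bump_mean w c l =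
      (LINT x|lborel. indicator (half_space n) x * (w x * bump_kernel c l x + w (reflect n x) * bump_kernel c l (reflect n x)))"
    unfolding bump_mean_def using l by (intro integral_reflect loc_integrable_bump loc_integrable_continuous w) auto
  also have "0 \<le> \<dots>"
  proof (rule Bochner_Integration.integral_nonneg)
    fix x
    show "0 \<le> indicator (half_space n) x * (w x * bump_kernel c l x + w (reflect n x) * bump_kernel c l (reflect n x))"
    proof (cases "x \<in> half_space n")
      case True
      then have x: "0 < x $ n" by (simp add: half_space_def)
      have "0 < 4 * x $ n * c $ n" using x c by simp
      then have "max 0 (l\<^sup>2 - (x - reflect n c) \<bullet> (x - reflect n c)) \<le> max 0 (l\<^sup>2 - (x - c) \<bullet> (x - c))"
        unfolding inner_minus_reflect by (intro max.mono) auto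
      then have "bump_kernel (reflect n c) l x \<le> bump_kernel c l x"
        unfolding bump_kernel_def using l by (intro divide_right_mono power_mono) auto
      moreover have "bump_kernel c l (reflect n x) = bump_kernel (reflect n c) l x"
        by (simp add: bump_kernel_def inner_diff_reflect)
      ultimately have "0 \<le> w x * (bump_kernel c l x - bump_kernel c l (reflect n x))"
        using w(3)[OF x] by simp
      then show ?thesis using True by (simp add: w algebra_simps)
    qed simp
  qed
  finally show ?thesis .
qed

text \<open>
  The regularisation \<open>t > 0\<close> of \<open>x\<^sub>N |x - a|\<^sup>-\<^sup>b\<close> is smooth and odd in \<open>x\<^sub>N\<close>, so its means need no integrability
  of the singular function at \<open>a\<close>.
\<close>

definition regular_power :: "'n::finite \<Rightarrow> real ^ 'n \<Rightarrow> real \<Rightarrow> real \<Rightarrow> real ^ 'n \<Rightarrow> real" where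
  "regular_power n a b t x = x $ n * ((x - a) \<bullet> (x - a) + t\<^sup>2) powr (- b / 2)"

text \<open>For \<open>t = 0\<close> the bound is the exact Laplacian of
  \<open>x $ n * norm (x - a) powr (- b)\<close>, which is negative in the half-space because
  \<open>0 < b < CARD('n)\<close>.\<close>

lemma regular_power_laplacian:
  fixes a :: "real ^ 'n::finite"
  assumes t: "0 < t" and a: "a $ n = 0" and b: "0 < b" "b < real CARD('n)"
  obtains H where "weak_laplacian UNIV (regular_power n a b t) H" "\<And>x. H (reflect n x) = - H x"
    "\<And>x. 0 < x $ n \<Longrightarrow> H x \<le> - b * (real CARD('n) - b) * x $ n * ((x - a) \<bullet> (x - a) + t\<^sup>2) powr (- b / 2 - 1)"
proof -
  let ?N = "real CARD('n)"
  define \<psi>' where "\<psi>' q = (- b / 2) * (q + t\<^sup>2) powr (- b / 2 - 1)" for q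
  define \<psi>'' where "\<psi>'' q = (- b / 2) * ((- b / 2 - 1) * (q + t\<^sup>2) powr (- b / 2 - 2))" for q
  have d: "((\<lambda>q. (q + t\<^sup>2) powr e) has_real_derivative e * (q + t\<^sup>2) powr (e - 1)) (at q)" if "q \<in> {- t\<^sup>2<..}" for e q
    using that by (auto intro!: derivative_eq_intros)
  define H where "H x = (0 + 1 * x $ n) * (2 * ?N * \<psi>' ((x - a) \<bullet> (x - a)) + 4 * ((x - a) \<bullet> (x - a)) * \<psi>'' ((x - a) \<bullet> (x - a)))
      + 4 * 1 * (x - a) $ n * \<psi>' ((x - a) \<bullet> (x - a))" for x
  have "weak_laplacian UNIV (\<lambda>x. (0 + 1 * x $ n) * ((x - a) \<bullet> (x - a) + t\<^sup>2) powr (- b / 2)) H"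
    unfolding H_def
  proof (rule weak_laplacian_radial[where I = "{- t\<^sup>2<..}" and \<psi> = "\<lambda>q. (q + t\<^sup>2) powr (- b / 2)"])
    fix q assume q: "q \<in> {- t\<^sup>2<..}"
    show "((\<lambda>q. (q + t\<^sup>2) powr (- b / 2)) has_real_derivative \<psi>' q) (at q)"
      unfolding \<psi>'_def by (rule d[OF q])
    show "(\<psi>' has_real_derivative \<psi>'' q) (at q)"
    proof -
      have "- b / 2 - 1 - 1 = - b / 2 - 2" by simp
      then show ?thesis
        unfolding \<psi>'_def[abs_def] \<psi>''_def using DERIV_cmult[OF d[OF q, of "- b / 2 - 1"], of "- b / 2"] by (simp only:)
    qed
  next
    show "continuous_on {- t\<^sup>2<..} \<psi>''" unfolding \<psi>''_def[abs_def]
      by (intro continuous_intros) auto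
    show "(x - a) \<bullet> (x - a) \<in> {- t\<^sup>2<..}" for x
      using t inner_ge_zero[of "x - a"] by (simp add: add_nonneg_pos less_le_trans[of _ 0])
  qed simp
  then have wl: "weak_laplacian UNIV (regular_power n a b t) H"
    by (simp add: regular_power_def[abs_def])
  have ra: "reflect n a = a" using a by (simp add: vec_eq_iff)
  have He: "H x = x $ n * ((2 * ?N + 4) * \<psi>' ((x - a) \<bullet> (x - a)) + 4 * ((x - a) \<bullet> (x - a)) * \<psi>'' ((x - a) \<bullet> (x - a)))" for x
    using a by (simp add: H_def algebra_simps)
  have odd: "H (reflect n x) = - H x" for x
    unfolding He inner_diff_reflect ra by simp
  have "H x \<le> - b * (?N - b) * x $ n * ((x - a) \<bullet> (x - a) + t\<^sup>2) powr (- b / 2 - 1)" if x: "0 < x $ n" for x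
  proof -
    define q s where "q = (x - a) \<bullet> (x - a)" and "s = q + t\<^sup>2"
    have q: "0 \<le> q" "q \<le> s" and s: "0 < s" using t by (auto simp: q_def s_def add_nonneg_pos)
    have p: "s powr (- b / 2 - 1) = s * s powr (- b / 2 - 2)"
    proof -
      have "- b / 2 - 1 = 1 + (- b / 2 - 2)" by simp
      then have "s powr (- b / 2 - 1) = s powr 1 * s powr (- b / 2 - 2)" by (simp only: powr_add)
      then show ?thesis using s by simp
    qed
    have "(2 * ?N + 4) * \<psi>' q + 4 * q * \<psi>'' q
        = s powr (- b / 2 - 2) * (- b * (?N + 2) * s + b * (b + 2) * q)"
      unfolding \<psi>'_def \<psi>''_def s_def[symmetric] p by (simp add: algebra_simps)
    \<comment> \<open>The regularisation enters only as \<open>q \<le> s = q + t\<^sup>2\<close> in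
      the positive term.\<close>
    also have "\<dots> \<le> s powr (- b / 2 - 2) * (- b * (?N + 2) * s + b * (b + 2) * s)"
      using q b by (intro mult_left_mono add_left_mono) auto
    also have "\<dots> = - b * (?N - b) * s powr (- b / 2 - 1)" unfolding p by (simp add: algebra_simps)
    finally have "x $ n * ((2 * ?N + 4) * \<psi>' q + 4 * q * \<psi>'' q) \<le> x $ n * (- b * (?N - b) * s powr (- b / 2 - 1))"
      using x by (intro mult_left_mono) auto
    also have "\<dots> = - b * (?N - b) * x $ n * s powr (- b / 2 - 1)" by simp
    finally show ?thesis unfolding He q_def[symmetric] s_def[symmetric] .
  qed
  then show ?thesis using that wl odd by blast
qed

lemma regular_power_simps:
  assumes "0 < t" "a $ n = 0"
  shows "continuous_on S (regular_power n a b t)" "regular_power n a b t (reflect n x) = - regular_power n a b t x"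
    "0 < x $ n \<Longrightarrow> 0 \<le> regular_power n a b t x"
proof -
  have "0 < (x - a) \<bullet> (x - a) + t\<^sup>2" for x :: "real ^ 'a"
    using assms by (intro add_nonneg_pos) auto
  then have "(x - a) \<bullet> (x - a) + t\<^sup>2 \<noteq> 0" for x :: "real ^ 'a" by (metis less_irrefl)
  then show "continuous_on S (regular_power n a b t)" unfolding regular_power_def[abs_def]
    by (intro continuous_intros) auto
  have "reflect n a = a" using assms by (simp add: vec_eq_iff)
  then show "regular_power n a b t (reflect n x) = - regular_power n a b t x"
    by (simp add: regular_power_def inner_diff_reflect)
  show "0 < x $ n \<Longrightarrow> 0 \<le> regular_power n a b t x" by (simp add: regular_power_def)
qed

section \<open>Solutions with a point mass as boundary value\<close>

locale dirac_solution =
  fixes n :: "'n::finite" and g :: "real ^ 'n \<Rightarrow> real" and p k :: real and a :: "real ^ 'n" and u :: "real ^ 'n \<Rightarrow> real"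
  assumes sol: "dirac_boundary_solution n g p k a u" and k: "0 < k"
    and g_cont: "continuous_on (half_space n) g"
    and g_pos: "\<And>x. x \<in> half_space n \<Longrightarrow> 0 < g x" and g_le: "\<And>x. x \<in> half_space n \<Longrightarrow> g x \<le> 1"
    and a: "a $ n = 0" and p: "1 < p" "p < 1 + 2 / (real CARD('n) - 1)" and N: "2 \<le> CARD('n)"
begin

text \<open>With \<open>r = norm (x - a) \<ge> x $ n\<close>, the power \<open>p\<close> of
  \<open>x $ n / r ^ CARD('n)\<close> is at most \<open>x $ n * r powr (- \<beta> - 2)\<close>, and
  this is the order of the Laplacian of \<open>x $ n * r powr (- \<beta>)\<close>.\<close>

definition \<beta> :: real where "\<beta> = (real CARD('n) - 1) * p - 1"

lemma \<beta>: "0 < \<beta>" "\<beta> < real CARD('n)"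
proof -
  have N1: "1 \<le> real CARD('n) - 1" using N by linarith
  have "1 * 1 < (real CARD('n) - 1) * p" using N1 p(1) by (intro mult_le_less_imp_less) auto
  then show "0 < \<beta>" by (simp add: \<beta>_def)
  have "p - 1 < 2 / (real CARD('n) - 1)" using p(2) by simp
  then have "(real CARD('n) - 1) * (p - 1) < 2" using N1 by (simp add: less_divide_eq mult.commute)
  then show "\<beta> < real CARD('n)" by (simp add: \<beta>_def algebra_simps)
qed

lemma measure_sol: "measure_boundary_solution n g p (scale_measure (ennreal k) (return borel a)) u"
  using sol by (simp add: dirac_boundary_solution_def)

lemma u_cont: "continuous_on (half_space n) u" and u_nonneg: "x \<in> half_space n \<Longrightarrow> 0 \<le> u x"
  using measure_sol by (auto simp: measure_boundary_solution_def)

definition pc :: real where "pc = pi powr (- real CARD('n) / 2) * Gamma (real CARD('n) / 2)"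

lemma pc_pos: "0 < pc"
  using N by (simp add: pc_def Gamma_real_pos)

lemma u_le_poisson: "x \<in> half_space n \<Longrightarrow> u x \<le> k * pc * x $ n / norm (x - a) ^ CARD('n)"
  using sol by (simp add: dirac_boundary_solution_def poisson_kernel_def pc_def mult.assoc)

definition v :: "real ^ 'n \<Rightarrow> real" where "v x = indicator (half_space n) x * u x"
definition F :: "real ^ 'n \<Rightarrow> real" where "F x = indicator (half_space n) x * (g x * u x powr p)"

lemmas solution_odd_bump = measure_solution_odd_bump[OF measure_sol less_imp_le[OF k] g_cont
    less_imp_le[OF g_pos] order.strict_trans[OF zero_less_one p(1)] a, folded v_def F_def, simplified]

lemma F_nonneg: "0 \<le> F x"
  using g_pos[of x] by (auto simp: F_def indicator_def)

text \<open>
  The mean of the odd extension of \<open>u\<close>. It runs from a multiple of \<open>u c\<close> at \<open>l = 0\<close> to \<open>0\<close> at infinity, and its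
  derivative is known from the weak formulation: this represents \<open>u c\<close>.
\<close>

definition m :: "real ^ 'n \<Rightarrow> real \<Rightarrow> real" where
  "m c l = bump_mean v c l - bump_mean v (reflect n c) l"

lemma loc_integrable_v: "loc_integrable v"
proof -
  obtain c :: "real ^ 'n" where "c = axis n 1" by simp
  then have "0 < c $ n" by simp
  from solution_odd_bump(1)[OF this zero_less_one] show ?thesis by (simp add: v_def[abs_def])
qed

lemma DERIV_m:
  assumes "0 < c $ n" "0 < l"
  shows "(m c has_real_derivative ((LINT x|lborel. F x * odd_bump n c l x)
     - 12 * k * c $ n * (max 0 (l\<^sup>2 - (a - c) \<bullet> (a - c)))\<^sup>2) / (6 * l ^ (CARD('n) + 5))) (at l)"
  unfolding m_def[abs_def]
  using DERIV_diff[OF DERIV_bump_mean[OF loc_integrable_v assms(2), of c]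
      DERIV_bump_mean[OF loc_integrable_v assms(2), of "reflect n c"]] solution_odd_bump(4)[OF assms]
  by (simp add: diff_divide_distrib[symmetric] v_def[abs_def])

lemma m_at_0:
  assumes c: "0 < c $ n"
  shows "(m c \<longlongrightarrow> bump_mass TYPE('n) * u c) (at_right 0)"
proof -
  have co: "c \<in> half_space n" using c by (simp add: half_space_def)
  have "isCont u c" using u_cont co by (simp add: continuous_on_eq_continuous_at[OF open_half_space])
  moreover have "eventually (\<lambda>x. u x = v x) (nhds c)"
    using eventually_nhds_in_open[OF open_half_space co] by (auto simp: v_def elim!: eventually_mono)
  ultimately have 1: "isCont v c" using isCont_cong by blast
  have "open {x :: real ^ 'n. x $ n < 0}" by (intro open_Collect_less continuous_intros)
  then have "eventually (\<lambda>x. v x = 0) (nhds (reflect n c))"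
    using eventually_nhds_in_open[of "{x :: real ^ 'n. x $ n < 0}" "reflect n c"] c
    by (auto simp: v_def half_space_def elim!: eventually_mono)
  then have 2: "isCont v (reflect n c)" using isCont_cong[of v "\<lambda>_. 0"] by simp
  have "v c = u c" "v (reflect n c) = 0" using c by (auto simp: v_def half_space_def)
  then show ?thesis
    unfolding m_def[abs_def]
    using tendsto_diff[OF bump_mean_tendsto[OF loc_integrable_v 1] bump_mean_tendsto[OF loc_integrable_v 2]] by simp
qed

lemma x_le_norm: "x \<in> half_space n \<Longrightarrow> 0 < x $ n \<and> x $ n \<le> norm (x - a)"
  using component_le_norm_cart[of "x - a" n] a by (simp add: half_space_def)

lemma poisson_le:
  assumes x: "x \<in> half_space n" and C: "0 \<le> C"
  shows "C * x $ n / norm (x - a) ^ CARD('n) \<le> C / norm (x - a) ^ (CARD('n) - 1)"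
proof -
  have xn: "0 < x $ n" "x $ n \<le> norm (x - a)" using x_le_norm[OF x] by auto
  then have r: "0 < norm (x - a)" by linarith
  have e: "norm (x - a) ^ CARD('n) = norm (x - a) * norm (x - a) ^ (CARD('n) - 1)"
    using N by (simp flip: power_Suc)
  have "C * x $ n / norm (x - a) ^ CARD('n) \<le> C * norm (x - a) / norm (x - a) ^ CARD('n)"
    using xn C by (intro divide_right_mono mult_left_mono) auto
  then show ?thesis unfolding e using r by simp
qed

lemma v_nonneg: "0 \<le> v x"
  using u_nonneg[of x] by (auto simp: v_def indicator_def)

text \<open>\<open>u\<close> is at most a multiple of
  \<open>1 / norm (x - a) ^ (CARD('n) - 1)\<close>, which decays because the dimension is at least
  \<open>2\<close>.\<close>

lemma m_at_top: "(m c \<longlongrightarrow> 0) at_top"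
proof -
  have dec: "\<exists>\<rho>. \<forall>x. x \<notin> cball 0 \<rho> \<longrightarrow> v x \<le> e" if e: "0 < e" for e
  proof (intro exI allI impI)
    fix x :: "real ^ 'n" assume x: "x \<notin> cball 0 (norm a + 1 + k * pc / e)"
    show "v x \<le> e"
    proof (cases "x \<in> half_space n")
      case True
      have "norm x - norm a \<le> norm (x - a)" by (rule norm_triangle_ineq2)
      moreover have "norm a + 1 + k * pc / e < norm x" using x by simp
      moreover have "0 < k * pc / e" using k pc_pos e by simp
      ultimately have d: "1 \<le> norm (x - a)" "k * pc / e \<le> norm (x - a)" by linarith+
      have "norm (x - a) \<le> norm (x - a) ^ (CARD('n) - 1)" using N d by (intro self_le_power) auto
      then have "k * pc / norm (x - a) ^ (CARD('n) - 1) \<le> k * pc / norm (x - a)"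
        using d k pc_pos by (intro divide_left_mono mult_pos_pos zero_less_power) auto
      also have "\<dots> \<le> e" using d e by (simp add: divide_le_eq mult.commute)
      finally show ?thesis using u_le_poisson[OF True] poisson_le[OF True, of "k * pc"] k pc_pos True by (simp add: v_def)
    qed (use e in \<open>simp add: v_def\<close>)
  qed
  show ?thesis unfolding m_def[abs_def]
    using tendsto_diff[OF bump_mean_at_top[OF loc_integrable_v v_nonneg dec, of c]
        bump_mean_at_top[OF loc_integrable_v v_nonneg dec, of "reflect n c"]] by simp
qed

definition q0 :: "real ^ 'n \<Rightarrow> real" where "q0 c = norm (c - a)"

lemma q0: "0 < c $ n \<Longrightarrow> 0 < q0 c" "(a - c) \<bullet> (a - c) = (q0 c)\<^sup>2"
  using a by (auto simp: q0_def power2_norm_eq_inner[symmetric] norm_minus_commute)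

text \<open>The absorption term is nonnegative and is dropped. Up to the radius \<open>d\<close> the
  pole lies outside the bump, so the means increase; beyond \<open>d\<close> its contribution is
  integrated exactly by \<open>radial_prim\<close>, and the means vanish at infinity.\<close>

lemma upper_bound:
  assumes c: "c \<in> half_space n"
  shows "u c \<le> 2 * radial_const CARD('n) / bump_mass TYPE('n) * k * c $ n / norm (c - a) ^ CARD('n)"
proof -
  let ?N = "CARD('n)" and ?M = "bump_mass TYPE('n)"
  define d where "d = q0 c"
  have cn: "0 < c $ n" using c by (simp add: half_space_def)
  have d: "0 < d" "(a - c) \<bullet> (a - c) = d\<^sup>2" using q0[of c] cn by (auto simp: d_def)
  have nn: "0 \<le> (LINT x|lborel. F x * odd_bump n c l x)" for l
  proof (rule Bochner_Integration.integral_nonneg)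
    fix x show "0 \<le> F x * odd_bump n c l x"
      using odd_bump_bounds(1)[of x n c l] cn F_nonneg[of x] by (cases "x \<in> half_space n") (auto simp: F_def half_space_def)
  qed
  have "m c s \<le> m c d" if s: "0 < s" "s \<le> d" for s
  proof (rule DERIV_nonneg_imp_nondecreasing[OF s(2)])
    fix l assume l: "s \<le> l" "l \<le> d"
    then have l0: "0 < l" using s by simp
    have "l\<^sup>2 \<le> d\<^sup>2" using l l0 by (intro power_mono) auto
    then have "max 0 (l\<^sup>2 - (a - c) \<bullet> (a - c)) = 0" unfolding d(2) by simp
    then show "\<exists>y. (m c has_real_derivative y) (at l) \<and> 0 \<le> y"
      using DERIV_m[OF cn l0] nn[of l] l0
      by (intro exI[of _ "(LINT x|lborel. F x * odd_bump n c l x) / (6 * l ^ (?N + 5))"] conjI) auto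
  qed
  then have "\<forall>\<^sub>F s in at_right 0. m c s \<le> m c d"
    unfolding eventually_at_right_field using d by (intro exI[of _ d]) simp
  then have 1: "?M * u c \<le> m c d"
    by (rule tendsto_upperbound[OF m_at_0[OF cn]]) simp
  \<comment> \<open>The added antiderivative cancels the pole term, so that the derivative of
    \<open>Q\<close> consists of the absorption term alone.\<close>
  define Q where "Q l = m c l + 2 * k * c $ n * radial_prim ?N d l" for l
  have "Q d \<le> Q R" if R: "d \<le> R" for R
  proof (rule DERIV_nonneg_imp_nondecreasing[OF R])
    fix l assume l: "d \<le> l" "l \<le> R"
    then have l0: "0 < l" using d by simp
    have "d\<^sup>2 \<le> l\<^sup>2" using l d by (intro power_mono) auto
    then have mx: "max 0 (l\<^sup>2 - (a - c) \<bullet> (a - c)) = l\<^sup>2 - d\<^sup>2" unfolding d(2) by simp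
    have "(Q has_real_derivative ((LINT x|lborel. F x * odd_bump n c l x)
     - 12 * k * c $ n * (l\<^sup>2 - d\<^sup>2)\<^sup>2) / (6 * l ^ (?N + 5)) + 2 * k * c $ n * ((l\<^sup>2 - d\<^sup>2)\<^sup>2 / l ^ (?N + 5))) (at l)"
      unfolding Q_def[abs_def]
      by (rule DERIV_add[OF DERIV_m[OF cn l0, unfolded mx] DERIV_cmult[OF DERIV_radial_prim]]) (use l0 in auto)
    moreover have "((LINT x|lborel. F x * odd_bump n c l x)
     - 12 * k * c $ n * (l\<^sup>2 - d\<^sup>2)\<^sup>2) / (6 * l ^ (?N + 5)) + 2 * k * c $ n * ((l\<^sup>2 - d\<^sup>2)\<^sup>2 / l ^ (?N + 5))
     = (LINT x|lborel. F x * odd_bump n c l x) / (6 * l ^ (?N + 5))"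
      by (simp add: diff_divide_distrib)
    ultimately show "\<exists>y. (Q has_real_derivative y) (at l) \<and> 0 \<le> y"
      using nn[of l] l0
      by (intro exI[of _ "(LINT x|lborel. F x * odd_bump n c l x) / (6 * l ^ (?N + 5))"] conjI) auto
  qed
  then have "\<forall>\<^sub>F R in at_top. Q d \<le> Q R" unfolding eventually_at_top_linorder by blast
  moreover have "(Q \<longlongrightarrow> 0 + 2 * k * c $ n * 0) at_top"
    unfolding Q_def[abs_def] by (intro tendsto_add m_at_top tendsto_mult tendsto_const radial_prim_at_top) simp
  ultimately have "Q d \<le> 0" using tendsto_lowerbound[of Q 0 at_top "Q d"] by simp
  then have "m c d \<le> 2 * k * c $ n * (radial_const ?N / d ^ ?N)"
    using radial_prim_diag[OF d(1), of ?N] by (simp add: Q_def)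
  with 1 have "u c * ?M \<le> 2 * k * c $ n * (radial_const ?N / d ^ ?N)" by (simp add: mult.commute)
  then have "u c \<le> 2 * k * c $ n * (radial_const ?N / d ^ ?N) / ?M"
    by (subst pos_le_divide_eq[OF bump_mass_pos])
  then show ?thesis by (simp add: d_def q0_def mult.commute mult.left_commute)
qed

text \<open>One factor \<open>x $ n\<close> is kept and the power \<open>p - 1\<close> of it is
  estimated by the distance to \<open>a\<close>, which gives the bound the shape of the Laplacian of
  \<open>regular_power\<close>.\<close>

lemma F_le:
  assumes x: "x \<in> half_space n"
  shows "F x \<le> (k * pc) powr p * x $ n * norm (x - a) powr (- \<beta> - 2)"
proof -
  define r where "r = norm (x - a)"
  have xn: "0 < x $ n" "x $ n \<le> r" using x_le_norm[OF x] by (auto simp: r_def)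
  have r: "0 < r" using xn by linarith
  have rN: "r ^ CARD('n) = r powr real CARD('n)" using r by (simp add: powr_realpow)
  have "F x = g x * u x powr p" using x by (simp add: F_def)
  also have "\<dots> \<le> 1 * (k * pc * x $ n / r ^ CARD('n)) powr p"
    using u_le_poisson[OF x] u_nonneg[OF x] g_le[OF x] g_pos[OF x] p
    by (intro mult_mono powr_mono2) (auto simp: r_def)
  also have "\<dots> = (k * pc) powr p * x $ n powr p * r powr (- real CARD('n) * p)"
  proof -
    have "k * pc * x $ n / r ^ CARD('n) = (k * pc) * x $ n * r powr (- real CARD('n))"
      by (simp add: rN powr_minus divide_inverse)
    then show ?thesis using k pc_pos xn r by (simp add: powr_mult powr_powr)
  qed
  also have "x $ n powr p = x $ n * x $ n powr (p - 1)"
    using xn powr_add[of "x $ n" 1 "p - 1"] by simp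
  also have "(k * pc) powr p * (x $ n * x $ n powr (p - 1)) * r powr (- real CARD('n) * p)
      \<le> (k * pc) powr p * (x $ n * r powr (p - 1)) * r powr (- real CARD('n) * p)"
    using xn p by (intro mult_right_mono mult_left_mono powr_mono2) auto
  also have "\<dots> = (k * pc) powr p * x $ n * r powr (p - 1 + - real CARD('n) * p)"
    unfolding powr_add by simp
  also have "p - 1 + - real CARD('n) * p = - \<beta> - 2" by (simp add: \<beta>_def algebra_simps)
  finally show ?thesis by (simp add: r_def)
qed

definition E :: "real \<Rightarrow> real" where
  "E t = (LINT x|lborel. indicator (cball a t) x * (F x * x $ n))"

lemma Fx_integrable: "integrable lborel (\<lambda>x. indicator (cball 0 R) x * (F x * x $ n))"
proof -
  obtain c :: "real ^ 'n" where "c = axis n 1" by simp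
  then have "0 < c $ n" by simp
  from solution_odd_bump(2)[OF this zero_less_one] show ?thesis
    unfolding loc_integrable_def F_def by (simp add: mult.assoc)
qed

lemma Fx_nonneg: "0 \<le> F x * x $ n"
  using F_nonneg[of x] by (cases "x \<in> half_space n") (auto simp: F_def half_space_def)

lemma Fx_integrable':
  assumes "t \<le> 1"
  shows "integrable lborel (\<lambda>x. indicator (cball a t) x * (F x * x $ n))"
proof -
  have sub: "cball a t \<subseteq> cball 0 (norm a + 1)" using assms by (simp add: cball_subset_cball_iff)
  have eq: "indicator (cball a t) x * (F x * x $ n) = indicator (cball a t) x * (indicator (cball 0 (norm a + 1)) x * (F x * x $ n))" for x
    using sub by (auto simp: indicator_def)
  show ?thesis
    unfolding eq
  proof (rule Bochner_Integration.integrable_bound[OF Fx_integrable[of "norm a + 1"]])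
    show "(\<lambda>x. indicator (cball a t) x * (indicator (cball 0 (norm a + 1)) x * (F x * x $ n))) \<in> borel_measurable lborel"
      using borel_measurable_integrable[OF Fx_integrable[of "norm a + 1"]]
      by (intro borel_measurable_times[of "indicator (cball a t)"] borel_measurable_indicator) auto
  qed (auto simp: indicator_def)
qed

text \<open>Dominated convergence on shrinking balls; at the one remaining point \<open>a\<close>
  the weight \<open>x $ n\<close> is \<open>0\<close>.\<close>

lemma E_tendsto: "(\<lambda>j. E (1 / real (Suc j))) \<longlonglongrightarrow> 0"
proof -
  have "(\<lambda>j. LINT x|lborel. indicator (cball a (1 / real (Suc j))) x * (F x * x $ n)) \<longlonglongrightarrow> (LINT x :: real ^ 'n|lborel. 0)"
  proof (rule integral_dominated_convergence[OF _ _ Fx_integrable'[of 1]])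
    show "(\<lambda>x. indicator (cball a (1 / real (Suc j))) x * (F x * x $ n)) \<in> borel_measurable lborel" for j
      by (rule borel_measurable_integrable[OF Fx_integrable']) simp
    show "AE x in lborel. (\<lambda>j. indicator (cball a (1 / real (Suc j))) x * (F x * x $ n)) \<longlonglongrightarrow> 0"
    proof (rule AE_I2)
      fix x
      show "(\<lambda>j. indicator (cball a (1 / real (Suc j))) x * (F x * x $ n)) \<longlonglongrightarrow> 0"
      proof (cases "x = a")
        case False
        then have "0 < dist a x" by simp
        then have "eventually (\<lambda>j. inverse (real (Suc j)) < dist a x) sequentially"
          using LIMSEQ_inverse_real_of_nat by (rule order_tendstoD[rotated])
        then show ?thesis
          by (intro tendsto_eventually) (auto elim!: eventually_mono simp: inverse_eq_divide)
      qed (use a in simp)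
    qed
    show "AE x in lborel. norm (indicator (cball a (1 / real (Suc j))) x * (F x * x $ n)) \<le> indicator (cball a 1) x * (F x * x $ n)" for j
    proof (rule AE_I2)
      fix x
      have "cball a (1 / real (Suc j)) \<subseteq> cball a 1" by (intro subset_cball) simp
      then have "indicator (cball a (1 / real (Suc j))) x \<le> (indicator (cball a 1) x :: real)"
        by (auto simp: indicator_def)
      then have "indicator (cball a (1 / real (Suc j))) x * (F x * x $ n) \<le> indicator (cball a 1) x * (F x * x $ n)"
        using Fx_nonneg[of x] by (rule mult_right_mono)
      then show "norm (indicator (cball a (1 / real (Suc j))) x * (F x * x $ n)) \<le> indicator (cball a 1) x * (F x * x $ n)"
        using Fx_nonneg[of x] by (simp add: indicator_def)
    qed
  qed simp_all
  then show ?thesis by (simp add: E_def)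
qed

text \<open>\<open>(k * pc) powr p\<close> comes from \<open>F_le\<close>, the power of
  \<open>2\<close> from replacing \<open>q\<close> by \<open>(q + t\<^sup>2) / 2\<close> where
  \<open>t\<^sup>2 \<le> q\<close>, and the denominator from the Laplacian of
  \<open>regular_power\<close>.\<close>

definition A0 :: real where
  "A0 = (k * pc) powr p * 2 powr (\<beta> / 2 + 1) / (\<beta> * (real CARD('n) - \<beta>))"

lemma A0_nonneg: "0 \<le> A0"
  using \<beta> by (simp add: A0_def)

text \<open>
  The means of \<open>u + A0 * regular_power\<close> have the derivative of those of a harmonic function, up to a nonpositive
  term and the absorption inside \<open>cball a t\<close>; the latter is integrable against \<open>x\<^sub>N\<close> and disappears
  with \<open>t\<close>.
\<close>

lemma lower_bound_aux:
  assumes c: "c \<in> half_space n" and t: "0 < t" "t \<le> 1" "t \<le> q0 c / 2" and R: "q0 c \<le> R"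
  shows "m c R + 2 * k * c $ n * (radial_prim CARD('n) (q0 c) R + radial_const CARD('n) / q0 c ^ CARD('n))
      - (2 * R ^ 4 * c $ n / (q0 c / 2) ^ (CARD('n) + 5)) * E t * R
      \<le> bump_mass TYPE('n) * (u c + A0 * (c $ n * norm (c - a) powr (- \<beta>)))"
proof -
  let ?N = "CARD('n)" and ?M = "bump_mass TYPE('n)"
  define d where "d = q0 c"
  have cn: "0 < c $ n" using c by (simp add: half_space_def)
  have d: "0 < d" "(a - c) \<bullet> (a - c) = d\<^sup>2" using q0[of c] cn by (auto simp: d_def)
  define Z where "Z = regular_power n a \<beta> t"
  obtain H where H: "weak_laplacian UNIV Z H" "\<And>x. H (reflect n x) = - H x"
    "\<And>x. 0 < x $ n \<Longrightarrow> H x \<le> - \<beta> * (real ?N - \<beta>) * x $ n * ((x - a) \<bullet> (x - a) + t\<^sup>2) powr (- \<beta> / 2 - 1)"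
    using regular_power_laplacian[OF t(1) a \<beta>] unfolding Z_def by blast
  note Zs = regular_power_simps[OF t(1) a, where b = \<beta>, folded Z_def]
  have Hc: "continuous_on UNIV H" using H(1) by (simp add: weak_laplacian_def)
  define S where "S l = (LINT x|lborel. F x * odd_bump n c l x) + A0 * (LINT x|lborel. H x * bump c l x)" for l
  have Et: "0 \<le> E t" unfolding E_def
    by (rule Bochner_Integration.integral_nonneg) (simp add: Fx_nonneg)
  \<comment> \<open>Outside \<open>cball a t\<close> the correction outweighs the absorption;
    inside, where this can fail, the term \<open>H\<close> still has the favourable sign.\<close>
  have FH: "F x + A0 * H x \<le> indicator (cball a t) x * F x" if x: "x \<in> half_space n" for x
  proof -
    define q where "q = (x - a) \<bullet> (x - a)"
    have xn: "0 < x $ n" using x by (simp add: half_space_def)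
    have nq: "norm (x - a) = sqrt q" by (simp add: q_def norm_eq_sqrt_inner)
    have "0 < sqrt q" using x_le_norm[OF x] unfolding nq by linarith
    then have q0': "0 < q" by simp
    have bb: "0 < \<beta> * (real ?N - \<beta>)" using \<beta> by simp
    have Hle: "A0 * H x \<le> A0 * (- \<beta> * (real ?N - \<beta>) * x $ n * (q + t\<^sup>2) powr (- \<beta> / 2 - 1))"
      unfolding q_def by (intro mult_left_mono H(3) xn A0_nonneg)
    show ?thesis
    proof (cases "x \<in> cball a t")
      case True
      have "- \<beta> * (real ?N - \<beta>) * x $ n * (q + t\<^sup>2) powr (- \<beta> / 2 - 1) \<le> 0"
        using bb xn by (simp add: mult_nonneg_nonneg)
      from mult_nonneg_nonpos[OF A0_nonneg this] Hle have "A0 * H x \<le> 0" by linarith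
      then show ?thesis using True by simp
    next
      case False
      then have "t < sqrt q" using nq by (simp add: dist_norm norm_minus_commute)
      then have "t\<^sup>2 < (sqrt q)\<^sup>2" using t by (intro power_strict_mono) auto
      then have tq: "t\<^sup>2 \<le> q" using q0' by simp
      have "norm (x - a) powr (- \<beta> - 2) = q powr (- \<beta> / 2 - 1)"
      proof -
        have "norm (x - a) powr (- \<beta> - 2) = (q powr (1 / 2)) powr (- \<beta> - 2)"
          using q0' by (simp add: nq powr_half_sqrt)
        also have "\<dots> = q powr (- \<beta> / 2 - 1)" by (simp add: powr_powr diff_divide_distrib)
        finally show ?thesis .
      qed
      also have "\<dots> \<le> ((q + t\<^sup>2) / 2) powr (- \<beta> / 2 - 1)"
        using tq q0' \<beta> t by (intro powr_mono2') (auto intro: add_pos_nonneg)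
      also have "\<dots> = 2 powr (\<beta> / 2 + 1) * (q + t\<^sup>2) powr (- \<beta> / 2 - 1)"
      proof -
        have e1: "2 powr (- \<beta> / 2 - 1) = inverse (2 powr (\<beta> / 2 + 1))" by (simp flip: powr_minus)
        have e2: "((q + t\<^sup>2) / 2) powr (- \<beta> / 2 - 1) = (q + t\<^sup>2) powr (- \<beta> / 2 - 1) / 2 powr (- \<beta> / 2 - 1)"
          by (rule powr_divide)
        have e3: "S / inverse W = W * S" for S W :: real by (simp add: divide_inverse)
        show ?thesis by (simp only: e1 e2 e3)
      qed
      finally have "(k * pc) powr p * x $ n * norm (x - a) powr (- \<beta> - 2)
          \<le> (k * pc) powr p * x $ n * (2 powr (\<beta> / 2 + 1) * (q + t\<^sup>2) powr (- \<beta> / 2 - 1))"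
        using xn by (intro mult_left_mono) auto
      with F_le[OF x] have "F x \<le> (k * pc) powr p * x $ n * (2 powr (\<beta> / 2 + 1) * (q + t\<^sup>2) powr (- \<beta> / 2 - 1))"
        by (rule order_trans)
      also have "\<dots> = - (A0 * (- \<beta> * (real ?N - \<beta>) * x $ n * (q + t\<^sup>2) powr (- \<beta> / 2 - 1)))"
        using \<beta> by (simp add: A0_def)
      finally show ?thesis using Hle False by simp
    qed
  qed
  have iH: "integrable lborel (\<lambda>x. indicator (half_space n) x * (H x * odd_bump n c l x))" if l: "0 < l" for l
  proof -
    have "integrable lborel (\<lambda>x. H x * bump c l x - H x * bump (reflect n c) l x)"
      by (intro Bochner_Integration.integrable_diff loc_integrable_bump loc_integrable_continuous Hc) (use l in auto)
    then have i: "integrable lborel (\<lambda>x. H x * odd_bump n c l x)" by (simp add: odd_bump_def right_diff_distrib)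
    have [measurable]: "(\<lambda>x. H x * odd_bump n c l x) \<in> borel_measurable borel"
      using borel_measurable_integrable[OF i] by simp
    show ?thesis by (rule Bochner_Integration.integrable_bound[OF i]) (auto simp: indicator_def)
  qed
  have Se: "S l = (LINT x|lborel. F x * odd_bump n c l x + A0 * (indicator (half_space n) x * (H x * odd_bump n c l x)))"
    if l: "0 < l" for l
    unfolding S_def integral_odd_bump[OF Hc H(2) l]
    using iH[OF l] solution_odd_bump(3)[OF cn l] by (subst Bochner_Integration.integral_add) (auto simp: F_def)
  have pw: "F x * odd_bump n c l x + A0 * (indicator (half_space n) x * (H x * odd_bump n c l x))
      \<le> indicator (cball a t) x * F x * odd_bump n c l x" for x l
  proof (cases "x \<in> half_space n")
    case True
    then have "(F x + A0 * H x) * odd_bump n c l x \<le> indicator (cball a t) x * F x * odd_bump n c l x"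
      using odd_bump_bounds(1)[of x n c l] cn by (intro mult_right_mono FH) (auto simp: half_space_def)
    then show ?thesis using True by (simp add: algebra_simps)
  qed (simp add: F_def)
  have i0: "integrable lborel (\<lambda>x. F x * odd_bump n c l x + A0 * (indicator (half_space n) x * (H x * odd_bump n c l x)))"
    if l: "0 < l" for l
    using iH[OF l] solution_odd_bump(3)[OF cn l]
    by (intro Bochner_Integration.integrable_add integrable_mult_right) (auto simp: F_def)
  have S_le: "S l \<le> 12 * l ^ 4 * c $ n * E t" if l: "0 < l" for l
  proof -
    have "S l \<le> (LINT x|lborel. 12 * l ^ 4 * c $ n * (indicator (cball a t) x * (F x * x $ n)))"
      unfolding Se[OF l]
    proof (rule integral_mono[OF i0[OF l]])
      show "integrable lborel (\<lambda>x. 12 * l ^ 4 * c $ n * (indicator (cball a t) x * (F x * x $ n)))"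
        by (intro integrable_mult_right Fx_integrable' t)
      fix x
      have "indicator (cball a t) x * F x * odd_bump n c l x \<le> 12 * l ^ 4 * c $ n * (indicator (cball a t) x * (F x * x $ n))"
      proof (cases "x \<in> half_space n")
        case True
        then have "indicator (cball a t) x * F x * odd_bump n c l x \<le> indicator (cball a t) x * F x * (12 * l ^ 4 * c $ n * x $ n)"
          using odd_bump_bounds(2)[of x n c l] cn F_nonneg[of x] by (intro mult_left_mono) (auto simp: half_space_def)
        then show ?thesis by (simp add: mult.commute mult.left_commute)
      qed (simp add: F_def)
      with pw[of x l] show "F x * odd_bump n c l x + A0 * (indicator (half_space n) x * (H x * odd_bump n c l x))
        \<le> 12 * l ^ 4 * c $ n * (indicator (cball a t) x * (F x * x $ n))" by linarith
    qed
    then show ?thesis by (simp add: E_def)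
  qed
  \<comment> \<open>With \<open>t\<close> and \<open>l\<close> at most \<open>d / 2\<close>, the odd
    bump vanishes on the part of \<open>cball a t\<close> in the half-space, so the remaining term
    drops out.\<close>
  have S_le0: "S l \<le> 0" if l: "0 < l" "l \<le> d / 2" for l
  proof -
    have "S l \<le> (LINT x :: real ^ 'n|lborel. 0)"
      unfolding Se[OF l(1)]
    proof (rule integral_mono[OF i0[OF l(1)]])
      fix x
      have "indicator (cball a t) x * F x * odd_bump n c l x = 0"
      proof (cases "x \<in> cball a t \<and> x \<in> half_space n")
        case True
        have "norm (c - a) \<le> norm (c - x) + norm (x - a)" using norm_triangle_ineq[of "c - x" "x - a"] by simp
        moreover have "norm (x - a) \<le> d / 2" using True t by (simp add: d_def dist_norm norm_minus_commute)
        ultimately have dx: "l \<le> norm (x - c)" using l by (simp add: d_def q0_def norm_minus_commute)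
        then have "l\<^sup>2 \<le> (norm (x - c))\<^sup>2" using l by (intro power_mono) auto
        moreover have "0 \<le> 4 * x $ n * c $ n" using True cn by (simp add: half_space_def)
        ultimately have "l\<^sup>2 - (x - c) \<bullet> (x - c) \<le> 0" "l\<^sup>2 - ((x - c) \<bullet> (x - c) + 4 * x $ n * c $ n) \<le> 0"
          unfolding power2_norm_eq_inner by linarith+
        then have "odd_bump n c l x = 0"
          by (simp add: odd_bump_def bump_def inner_minus_reflect max_absorb1)
        then show ?thesis by simp
      qed (auto simp: F_def)
      with pw[of x l] show "F x * odd_bump n c l x + A0 * (indicator (half_space n) x * (H x * odd_bump n c l x)) \<le> 0"
        by linarith
    qed simp
    then show ?thesis by simp
  qed
  define G where "G l = m c l + A0 * bump_mean Z c l" for l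
  have DG: "(G has_real_derivative (S l - 12 * k * c $ n * (max 0 (l\<^sup>2 - d\<^sup>2))\<^sup>2) / (6 * l ^ (?N + 5))) (at l)" if l: "0 < l" for l
  proof -
    have "(LINT x|lborel. Z x * bump_lap c l x) = (LINT x|lborel. H x * bump c l x)"
      using H(1) l unfolding weak_laplacian_def by auto
    then have "((\<lambda>l. bump_mean Z c l) has_real_derivative (LINT x|lborel. H x * bump c l x) / (6 * l ^ (?N + 5))) (at l)"
      using DERIV_bump_mean[OF loc_integrable_continuous[OF Zs(1)] l, of c] by simp
    from DERIV_add[OF DERIV_m[OF cn l] DERIV_cmult[OF this, of A0]]
    show ?thesis unfolding G_def[abs_def] S_def d(2)
      by (rule DERIV_cong) (simp add: add_divide_distrib diff_divide_distrib)
  qed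
  have "G (d / 2) \<le> G s" if s: "0 < s" "s \<le> d / 2" for s
  proof (rule DERIV_nonpos_imp_nonincreasing[OF s(2)])
    fix l assume l: "s \<le> l" "l \<le> d / 2"
    then have l0: "0 < l" using s by simp
    have "(S l - 12 * k * c $ n * (max 0 (l\<^sup>2 - d\<^sup>2))\<^sup>2) / (6 * l ^ (?N + 5)) \<le> 0"
    proof (rule divide_nonpos_pos)
      have "0 \<le> 12 * k * c $ n * (max 0 (l\<^sup>2 - d\<^sup>2))\<^sup>2" using k cn by simp
      then show "S l - 12 * k * c $ n * (max 0 (l\<^sup>2 - d\<^sup>2))\<^sup>2 \<le> 0" using S_le0[OF l0 l(2)] by linarith
    qed (use l0 in simp)
    then show "\<exists>y. (G has_real_derivative y) (at l) \<and> y \<le> 0" using DG[OF l0] by blast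
  qed
  then have ev: "\<forall>\<^sub>F s in at_right 0. G (d / 2) \<le> G s"
    unfolding eventually_at_right_field using d by (intro exI[of _ "d / 2"]) simp
  have isZ: "isCont Z c" using Zs(1)[of UNIV] by (simp add: continuous_on_eq_continuous_at)
  have "(G \<longlongrightarrow> ?M * u c + A0 * (?M * Z c)) (at_right 0)"
    unfolding G_def[abs_def]
    by (intro tendsto_add tendsto_mult_left m_at_0[OF cn] bump_mean_tendsto[OF loc_integrable_continuous[OF Zs(1)] isZ])
  from tendsto_lowerbound[OF this ev] have 1: "G (d / 2) \<le> ?M * u c + A0 * (?M * Z c)" by simp
  \<comment> \<open>An upper bound for \<open>S l / (6 * l ^ (?N + 5))\<close> between
    \<open>d / 2\<close> and \<open>R\<close>. The factor \<open>E t\<close> makes it disappear as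
    \<open>t\<close> tends to \<open>0\<close>.\<close>
  define C where "C = 2 * R ^ 4 * c $ n / (d / 2) ^ (?N + 5) * E t"
  have SC: "S l / (6 * l ^ (?N + 5)) \<le> C" if l: "d / 2 \<le> l" "l \<le> R" for l
  proof -
    have l0: "0 < l" using l d by linarith
    have "S l / (6 * l ^ (?N + 5)) \<le> 12 * R ^ 4 * c $ n * E t / (6 * (d / 2) ^ (?N + 5))"
    proof (rule frac_le)
      show "0 \<le> 12 * R ^ 4 * c $ n * E t" using cn Et by simp
      have "12 * l ^ 4 * c $ n * E t \<le> 12 * R ^ 4 * c $ n * E t"
        using l l0 cn Et by (intro mult_right_mono mult_left_mono power_mono) auto
      then show "S l \<le> 12 * R ^ 4 * c $ n * E t" using S_le[OF l0] by linarith
      show "6 * (d / 2) ^ (?N + 5) \<le> 6 * l ^ (?N + 5)" using l d by (intro mult_left_mono power_mono) auto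
      show "0 < 6 * (d / 2) ^ (?N + 5)" using d by simp
    qed
    also have "\<dots> = C" by (simp add: C_def)
    finally show ?thesis .
  qed
  have 2: "G d - C * d \<le> G (d / 2) - C * (d / 2)"
  proof (rule DERIV_nonpos_imp_nonincreasing[of "d / 2" d "\<lambda>l. G l - C * l"])
    fix l assume l: "d / 2 \<le> l" "l \<le> d"
    then have l0: "0 < l" using d by linarith
    have "l\<^sup>2 \<le> d\<^sup>2" using l l0 by (intro power_mono) auto
    then have mx: "max 0 (l\<^sup>2 - d\<^sup>2) = 0" by simp
    have "((\<lambda>l. G l - C * l) has_real_derivative S l / (6 * l ^ (?N + 5)) - C * 1) (at l)"
      using DERIV_diff[OF DG[OF l0, unfolded mx] DERIV_cmult_Id[of C]] by simp
    moreover have "S l / (6 * l ^ (?N + 5)) - C * 1 \<le> 0" using SC[of l] l R by (simp add: d_def)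
    ultimately show "\<exists>y. ((\<lambda>l. G l - C * l) has_real_derivative y) (at l) \<and> y \<le> 0" by blast
  qed (use d in simp)
  define Q where "Q l = G l + 2 * k * c $ n * radial_prim ?N d l - C * l" for l
  have 3: "Q R \<le> Q d"
  proof (rule DERIV_nonpos_imp_nonincreasing[of d R Q])
    show "d \<le> R" using R by (simp add: d_def)
    fix l assume l: "d \<le> l" "l \<le> R"
    then have l0: "0 < l" using d by linarith
    have "d\<^sup>2 \<le> l\<^sup>2" using l d by (intro power_mono) auto
    then have mx: "max 0 (l\<^sup>2 - d\<^sup>2) = l\<^sup>2 - d\<^sup>2" by simp
    have "(Q has_real_derivative (S l - 12 * k * c $ n * (l\<^sup>2 - d\<^sup>2)\<^sup>2) / (6 * l ^ (?N + 5))
        + 2 * k * c $ n * ((l\<^sup>2 - d\<^sup>2)\<^sup>2 / l ^ (?N + 5)) - C) (at l)"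
      unfolding Q_def[abs_def]
      using DERIV_diff[OF DERIV_add[OF DG[OF l0, unfolded mx] DERIV_cmult[OF DERIV_radial_prim[OF l0, of ?N d]]] DERIV_cmult_Id]
      by simp
    moreover have "(S l - 12 * k * c $ n * (l\<^sup>2 - d\<^sup>2)\<^sup>2) / (6 * l ^ (?N + 5))
        + 2 * k * c $ n * ((l\<^sup>2 - d\<^sup>2)\<^sup>2 / l ^ (?N + 5)) - C = S l / (6 * l ^ (?N + 5)) - C"
      by (simp add: diff_divide_distrib)
    ultimately have "(Q has_real_derivative S l / (6 * l ^ (?N + 5)) - C) (at l)" by (simp only:)
    moreover have "S l / (6 * l ^ (?N + 5)) - C \<le> 0" using SC[of l] l d by simp
    ultimately show "\<exists>y. (Q has_real_derivative y) (at l) \<and> y \<le> 0" by blast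
  qed
  \<comment> \<open>The correction \<open>Z\<close> may grow at infinity, namely if
    \<open>\<beta> < 1\<close>; oddness still gives its mean a sign.\<close>
  have "0 \<le> bump_mean Z c R"
    by (rule bump_mean_odd_nonneg[OF Zs]) (use R d cn in \<open>auto simp: d_def\<close>)
  then have "m c R \<le> G R" using A0_nonneg by (simp add: G_def)
  then have 4: "m c R + 2 * k * c $ n * (radial_prim ?N d R + radial_const ?N / d ^ ?N) - C * R \<le> G d - C * d"
    using 3 radial_prim_diag[OF d(1), of ?N] by (simp add: Q_def algebra_simps)
  have 5: "0 \<le> C * (d / 2)" using cn Et d R by (simp add: C_def)
  have nc: "norm (c - a) powr (- \<beta>) = (d\<^sup>2) powr (- \<beta> / 2)"
  proof -
    have "d powr (- \<beta>) = (d powr 2) powr (- \<beta> / 2)" by (simp add: powr_powr)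
    then show ?thesis using d(1) by (simp add: d_def q0_def)
  qed
  have "(c - a) \<bullet> (c - a) = d\<^sup>2" by (simp add: d_def q0_def power2_norm_eq_inner)
  then have "Z c = c $ n * (d\<^sup>2 + t\<^sup>2) powr (- \<beta> / 2)" by (simp add: Z_def regular_power_def)
  moreover have "c $ n * (d\<^sup>2 + t\<^sup>2) powr (- \<beta> / 2) \<le> c $ n * (d\<^sup>2) powr (- \<beta> / 2)"
    using cn d \<beta> t by (intro mult_left_mono powr_mono2') auto
  ultimately have "Z c \<le> c $ n * norm (c - a) powr (- \<beta>)" by (simp add: nc)
  then have "?M * (A0 * Z c) \<le> ?M * (A0 * (c $ n * norm (c - a) powr (- \<beta>)))"
    using A0_nonneg bump_mass_pos[where 'n='n] by (intro mult_left_mono) auto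
  then have 6: "?M * u c + A0 * (?M * Z c) \<le> ?M * (u c + A0 * (c $ n * norm (c - a) powr (- \<beta>)))"
    by (simp add: distrib_left mult.left_commute)
  have "m c R + 2 * k * c $ n * (radial_prim ?N d R + radial_const ?N / d ^ ?N) - C * R
      \<le> ?M * (u c + A0 * (c $ n * norm (c - a) powr (- \<beta>)))"
    using 1 2 4 5 6 by linarith
  then show ?thesis by (simp add: C_def d_def)
qed

text \<open>The error term is \<open>E t\<close> times a power of \<open>R\<close>. Hence
  \<open>t\<close> tends to \<open>0\<close> first, along \<open>1 / real (Suc j)\<close>, and
  \<open>R\<close> to infinity afterwards.\<close>

lemma lower_bound:
  assumes c: "c \<in> half_space n"
  shows "2 * radial_const CARD('n) / bump_mass TYPE('n) * k * c $ n / norm (c - a) ^ CARD('n)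
     - A0 * (c $ n * norm (c - a) powr (- \<beta>)) \<le> u c"
proof -
  let ?N = "CARD('n)" and ?M = "bump_mass TYPE('n)"
  let ?B = "?M * (u c + A0 * (c $ n * norm (c - a) powr (- \<beta>)))"
  have cn: "0 < c $ n" using c by (simp add: half_space_def)
  have d: "0 < q0 c" using q0 cn by simp
  have R: "m c R + 2 * k * c $ n * (radial_prim ?N (q0 c) R + radial_const ?N / q0 c ^ ?N) \<le> ?B" if "q0 c \<le> R" for R
  proof (rule tendsto_upperbound)
    have "(\<lambda>j. m c R + 2 * k * c $ n * (radial_prim ?N (q0 c) R + radial_const ?N / q0 c ^ ?N)
      - (2 * R ^ 4 * c $ n / (q0 c / 2) ^ (?N + 5)) * E (1 / real (Suc j)) * R)
      \<longlonglongrightarrow> m c R + 2 * k * c $ n * (radial_prim ?N (q0 c) R + radial_const ?N / q0 c ^ ?N)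
      - (2 * R ^ 4 * c $ n / (q0 c / 2) ^ (?N + 5)) * 0 * R"
      by (intro tendsto_intros E_tendsto)
    then show "(\<lambda>j. m c R + 2 * k * c $ n * (radial_prim ?N (q0 c) R + radial_const ?N / q0 c ^ ?N)
      - (2 * R ^ 4 * c $ n / (q0 c / 2) ^ (?N + 5)) * E (1 / real (Suc j)) * R)
      \<longlonglongrightarrow> m c R + 2 * k * c $ n * (radial_prim ?N (q0 c) R + radial_const ?N / q0 c ^ ?N)" by simp
    have "eventually (\<lambda>j. inverse (real (Suc j)) < q0 c / 2) sequentially"
      using LIMSEQ_inverse_real_of_nat by (rule order_tendstoD) (use d in simp)
    then show "\<forall>\<^sub>F j in sequentially. m c R + 2 * k * c $ n * (radial_prim ?N (q0 c) R + radial_const ?N / q0 c ^ ?N)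
      - (2 * R ^ 4 * c $ n / (q0 c / 2) ^ (?N + 5)) * E (1 / real (Suc j)) * R \<le> ?B"
    proof eventually_elim
      case (elim j)
      show ?case by (rule lower_bound_aux[OF c _ _ _ that]) (use elim in \<open>auto simp: inverse_eq_divide\<close>)
    qed
  qed simp
  have "((\<lambda>R. m c R + 2 * k * c $ n * (radial_prim ?N (q0 c) R + radial_const ?N / q0 c ^ ?N))
      \<longlongrightarrow> 0 + 2 * k * c $ n * (0 + radial_const ?N / q0 c ^ ?N)) at_top"
    by (intro tendsto_intros m_at_top radial_prim_at_top) simp
  moreover have "eventually (\<lambda>R. m c R + 2 * k * c $ n * (radial_prim ?N (q0 c) R + radial_const ?N / q0 c ^ ?N) \<le> ?B) at_top"
    unfolding eventually_at_top_linorder using R by blast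
  ultimately have "0 + 2 * k * c $ n * (0 + radial_const ?N / q0 c ^ ?N) \<le> ?B"
    by (rule tendsto_upperbound) simp
  then have "(2 * k * c $ n * (radial_const ?N / q0 c ^ ?N)) / ?M \<le> u c + A0 * (c $ n * norm (c - a) powr (- \<beta>))"
    by (subst pos_divide_le_eq[OF bump_mass_pos]) (simp add: mult.commute)
  then show ?thesis by (simp add: q0_def mult.commute mult.left_commute)
qed

end

text \<open>
  The constant of the Poisson kernel as it comes out of the means. That it equals \<open>c\<^sub>N\<close> is not needed: the bound by
  \<open>K P\<^sub>0\<close> enters only through the decay of the solution and the size of the absorption near \<open>a\<close>.
\<close>

definition pole_const :: "'n::finite itself \<Rightarrow> real" where
  "pole_const _ = 2 * radial_const CARD('n) / bump_mass TYPE('n)"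

lemma pole_const_pos: "0 < pole_const TYPE('n::finite)"
  using bump_mass_pos[where 'n='n] radial_const_pos[of "CARD('n)"] by (simp add: pole_const_def)

section \<open>Comparison of solutions through their poles\<close>

context dirac_solution
begin

lemma u_le: "c \<in> half_space n \<Longrightarrow> u c \<le> pole_const TYPE('n) * k * c $ n / norm (c - a) ^ CARD('n)"
  using upper_bound by (simp add: pole_const_def)

text \<open>A closed ball in the half-space has \<open>l < c $ n\<close>, by its lowest point. The
  mirrored bump then lives below the boundary and the pole is out of range, so that the odd test
  function reduces to the plain bump.\<close>

lemma weak_laplacian_u: "weak_laplacian (half_space n) u (\<lambda>x. g x * u x powr p)"
  unfolding weak_laplacian_def
proof (intro conjI allI impI)
  show "open (half_space n)" by (rule open_half_space)
  show "continuous_on (half_space n) u" by (rule u_cont)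
  show "continuous_on (half_space n) (\<lambda>x. g x * u x powr p)"
    by (intro continuous_intros g_cont u_cont continuous_on_powr') (use u_nonneg p in auto)
  fix c l assume l: "0 < l \<and> cball c l \<subseteq> half_space n"
  have "c - l *\<^sub>R axis n 1 \<in> cball c l" using l by (simp add: dist_norm)
  then have "c - l *\<^sub>R axis n 1 \<in> half_space n" using l by blast
  then have cl: "l < c $ n" by (simp add: half_space_def)
  then have cn: "0 < c $ n" using l by simp
  have far: "max 0 (l\<^sup>2 - (x - reflect n c) \<bullet> (x - reflect n c)) = 0" if "0 \<le> x $ n" for x
  proof -
    have "l \<le> \<bar>(x - reflect n c) $ n\<bar>" using that cl by simp
    also have "\<dots> \<le> norm (x - reflect n c)" by (rule component_le_norm_cart)
    finally have "l\<^sup>2 \<le> (norm (x - reflect n c))\<^sup>2" using l by (intro power_mono) auto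
    then show ?thesis by (simp add: power2_norm_eq_inner)
  qed
  have z: "v x * bump_lap (reflect n c) l x = 0" "F x * odd_bump n c l x = F x * bump c l x" for x
    using far[of x] by (auto simp: v_def F_def indicator_def half_space_def bump_lap_def odd_bump_def bump_def)
  have "(LINT x|lborel. v x * bump_lap c l x) - (LINT x|lborel. v x * bump_lap (reflect n c) l x)
      = (LINT x|lborel. F x * odd_bump n c l x) - 12 * k * c $ n * (max 0 (l\<^sup>2 - (a - c) \<bullet> (a - c)))\<^sup>2"
    using solution_odd_bump(4)[of c l] cn l by (simp add: v_def F_def)
  then have "(LINT x|lborel. v x * bump_lap c l x) = (LINT x|lborel. F x * bump c l x)
      - 12 * k * c $ n * (max 0 (l\<^sup>2 - (a - c) \<bullet> (a - c)))\<^sup>2"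
    by (simp only: z Bochner_Integration.integral_zero diff_zero)
  moreover have "max 0 (l\<^sup>2 - (a - c) \<bullet> (a - c)) = 0"
    using far[of a] a by (simp add: inner_minus_reflect)
  moreover have "v x * bump_lap c l x = u x * bump_lap c l x" "F x * bump c l x = (g x * u x powr p) * bump c l x" for x
  proof -
    have "x \<notin> half_space n \<Longrightarrow> x \<notin> ball c l" using l ball_subset_cball by blast
    then show "v x * bump_lap c l x = u x * bump_lap c l x" "F x * bump c l x = (g x * u x powr p) * bump c l x"
      using bump_outside(1,4)[of l x c] l by (cases "x \<in> half_space n"; simp add: v_def F_def)+
  qed
  ultimately show "(LINT x|lborel. u x * bump_lap c l x) = (LINT x|lborel. (g x * u x powr p) * bump c l x)"
    by simp
qed

text \<open>Since \<open>\<beta> < CARD('n)\<close>, the correction in \<open>lower_bound\<close> is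
  a small fraction of the leading term near \<open>a\<close>. Together with \<open>u_le\<close> this
  determines the leading coefficient of \<open>u\<close> at the pole.\<close>

lemma near_pole:
  assumes e: "0 < e"
  obtains t where "0 < t" "\<And>x. \<lbrakk>x \<in> half_space n; norm (x - a) < t\<rbrakk> \<Longrightarrow>
    pole_const TYPE('n) * k * x $ n / norm (x - a) ^ CARD('n) \<le> (1 + e) * u x"
proof
  let ?N = "real CARD('n)" and ?c = "pole_const TYPE('n)"
  \<comment> \<open>\<open>t\<close> solves
    \<open>(1 + e) * (A0 + 1) * t powr (?N - \<beta>) = e * ?c * k\<close>; the summand
    \<open>1\<close> keeps the denominator positive.\<close>
  define y t where "y = e * ?c * k / ((1 + e) * (A0 + 1))" and "t = y powr (1 / (?N - \<beta>))"
  have y: "0 < y" using e k pole_const_pos[where 'n='n] A0_nonneg by (simp add: y_def)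
  show "0 < t" using y by (simp add: t_def)
  fix x assume x: "x \<in> half_space n" "norm (x - a) < t"
  define r where "r = norm (x - a)"
  have xn: "0 < x $ n" "x $ n \<le> r" using x_le_norm[OF x(1)] by (auto simp: r_def)
  have r: "0 < r" using xn by linarith
  have "r powr (?N - \<beta>) \<le> t powr (?N - \<beta>)" using r x \<beta> by (intro powr_mono2) (auto simp: r_def)
  also have "\<dots> = y" using y \<beta> by (simp add: t_def powr_powr)
  finally have ry: "r powr (?N - \<beta>) \<le> y" .
  have rb: "r powr (- \<beta>) = r powr (?N - \<beta>) / r ^ CARD('n)"
  proof -
    have "r powr (- \<beta>) = r powr (?N - \<beta>) * r powr (- ?N)" by (simp flip: powr_add)
    then show ?thesis using r by (simp add: powr_minus powr_realpow divide_inverse)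
  qed
  have "(1 + e) * (A0 * r powr (?N - \<beta>)) \<le> (1 + e) * ((A0 + 1) * y)"
    using ry e A0_nonneg by (intro mult_left_mono mult_mono) auto
  also have "\<dots> = e * ?c * k" using e A0_nonneg by (simp add: y_def)
  finally have "(1 + e) * (A0 * r powr (?N - \<beta>)) * (x $ n / r ^ CARD('n)) \<le> e * ?c * k * (x $ n / r ^ CARD('n))"
    using xn r by (intro mult_right_mono) auto
  then have 1: "(1 + e) * (A0 * (x $ n * r powr (- \<beta>))) \<le> e * ?c * k * (x $ n / r ^ CARD('n))"
    by (simp add: rb mult.commute mult.left_commute)
  have "?c * k * x $ n / r ^ CARD('n) - A0 * (x $ n * r powr (- \<beta>)) \<le> u x"
    using lower_bound[OF x(1)] by (simp add: pole_const_def r_def)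
  then have "(1 + e) * (?c * k * x $ n / r ^ CARD('n) - A0 * (x $ n * r powr (- \<beta>))) \<le> (1 + e) * u x"
    using e by (intro mult_left_mono) auto
  moreover have "(1 + e) * (?c * k * x $ n / r ^ CARD('n) - A0 * (x $ n * r powr (- \<beta>)))
      = ?c * k * x $ n / r ^ CARD('n) + e * ?c * k * (x $ n / r ^ CARD('n)) - (1 + e) * (A0 * (x $ n * r powr (- \<beta>)))"
    by (simp add: algebra_simps add_divide_distrib)
  ultimately show "?c * k * x $ n / norm (x - a) ^ CARD('n) \<le> (1 + e) * u x"
    using 1 unfolding r_def by linarith
qed

lemma u_le_far:
  assumes x: "x \<in> half_space n"
  shows "u x \<le> pole_const TYPE('n) * k / norm (x - a) ^ (CARD('n) - 1)"
  using u_le[OF x] poisson_le[OF x, of "pole_const TYPE('n) * k"] k pole_const_pos[where 'n='n] by simp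

end

lemma le_if_le_mult:
  fixes w y :: real
  assumes le: "\<And>e. 0 < e \<Longrightarrow> w \<le> (1 + e) * y" and y: "0 \<le> y"
  shows "w \<le> y"
proof (rule field_le_epsilon)
  fix d :: real assume d: "0 < d"
  define e where "e = d / (y + 1)"
  have "0 < e" using d y by (simp add: e_def)
  from le[OF this] have "w \<le> y + e * y" by (simp add: algebra_simps)
  also have "e * y \<le> d" using d y by (simp add: e_def divide_le_eq mult_left_mono)
  finally show "w \<le> y + d" by simp
qed

text \<open>The factor \<open>1 + e\<close> enters the absorption with the power
  \<open>p > 1\<close>, so \<open>1 + e\<close> times a solution is a supersolution.\<close>

lemma powr_superlinear:
  assumes "0 < e" "0 \<le> y" "(1 + e) * y < x" "1 < (p::real)"
  shows "(1 + e) * y powr p < x powr p"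
proof -
  have "(1 + e) * y powr p \<le> (1 + e) powr p * y powr p"
    using assms powr_mono[of 1 p "1 + e"] by (intro mult_right_mono) auto
  also have "\<dots> = ((1 + e) * y) powr p" using assms by (simp add: powr_mult)
  also have "\<dots> < x powr p" using assms by (intro powr_less_mono2) auto
  finally show ?thesis .
qed

text \<open>
  The factor \<open>1 + e\<close> makes the comparison near \<open>a\<close> strict, also if the two masses agree.
\<close>

lemma dirac_solution_mono:
  fixes a :: "real ^ 'n::finite"
  assumes s1: "dirac_solution n g p k1 a u1" and s2: "dirac_solution n g p k2 a u2" and k: "k1 \<le> k2"
    and x: "x \<in> half_space n"
  shows "u1 x \<le> u2 x"
proof -
  interpret s1: dirac_solution n g p k1 a u1 by (rule s1)
  interpret s2: dirac_solution n g p k2 a u2 by (rule s2)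
  let ?O = "half_space n" and ?c = "pole_const TYPE('n)"
  have c: "0 < ?c" by (rule pole_const_pos)
  have le: "u1 x - (1 + e) * u2 x \<le> 0" if e: "0 < e" for e
  proof (rule weak_laplacian_comparison[OF weak_laplacian_diff[OF s1.weak_laplacian_u weak_laplacian_cmult[OF s2.weak_laplacian_u]] _ _ x])
    fix y assume y: "y \<in> ?O" "0 < u1 y - (1 + e) * u2 y"
    have "(1 + e) * u2 y powr p < u1 y powr p"
      by (rule powr_superlinear[OF e s2.u_nonneg[OF y(1)] _ s1.p(1)]) (use y in simp)
    then have "0 < g y * (u1 y powr p - (1 + e) * u2 y powr p)" using s1.g_pos[OF y(1)] by simp
    then show "0 < g y * u1 y powr p - (1 + e) * (g y * u2 y powr p)" by (simp add: algebra_simps)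
  next
    fix d :: real assume d: "0 < d"
    obtain t where t: "0 < t" "\<And>y. \<lbrakk>y \<in> ?O; norm (y - a) < t\<rbrakk> \<Longrightarrow> ?c * k2 * y $ n / norm (y - a) ^ CARD('n) \<le> (1 + e) * u2 y"
      using s2.near_pole[OF e] by blast
    \<comment> \<open>A difference of at least \<open>d\<close> is excluded near \<open>a\<close> by
      \<open>near_pole\<close>, beyond \<open>R\<close> by decay, and below the height
      \<open>\<eta>\<close> by \<open>u_le\<close> at distance at least \<open>t\<close> from the
      pole.\<close>
    define R \<eta> where "R = max 1 (?c * k1 / d)" and "\<eta> = d * t ^ CARD('n) / (?c * k1)"
    define T where "T = cball a R \<inter> {y. t \<le> norm (y - a)} \<inter> {y. \<eta> \<le> y $ n}"
    have \<eta>: "0 < \<eta>" using d t c s1.k by (simp add: \<eta>_def)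
    show "\<exists>T. compact T \<and> T \<subseteq> ?O \<and> (\<forall>y\<in>?O. d \<le> u1 y - (1 + e) * u2 y \<longrightarrow> y \<in> T)"
    proof (intro exI conjI ballI impI)
      show "compact T" unfolding T_def
        by (intro compact_Int_closed compact_cball closed_Collect_le continuous_intros)
      show "T \<subseteq> ?O" using \<eta> by (auto simp: T_def half_space_def)
      fix y assume y: "y \<in> ?O" "d \<le> u1 y - (1 + e) * u2 y"
      have yn: "0 < y $ n" "y $ n \<le> norm (y - a)" using s1.x_le_norm[OF y(1)] by auto
      then have r: "0 < norm (y - a)" by linarith
      have "0 \<le> (1 + e) * u2 y" using e s2.u_nonneg[OF y(1)] by simp
      then have du: "d \<le> u1 y" using y by linarith
      have far: "t \<le> norm (y - a)"
      proof (rule ccontr)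
        assume "\<not> t \<le> norm (y - a)"
        then have "?c * k2 * y $ n / norm (y - a) ^ CARD('n) \<le> (1 + e) * u2 y" using t(2)[OF y(1)] by simp
        moreover have "?c * k1 * y $ n / norm (y - a) ^ CARD('n) \<le> ?c * k2 * y $ n / norm (y - a) ^ CARD('n)"
          using k c yn r by (intro divide_right_mono mult_right_mono mult_left_mono) auto
        ultimately show False using s1.u_le[OF y(1)] y(2) d by linarith
      qed
      have "norm (y - a) \<le> R"
      proof (rule ccontr)
        assume "\<not> norm (y - a) \<le> R"
        then have R: "1 < norm (y - a)" "?c * k1 / d < norm (y - a)" by (auto simp: R_def)
        have "norm (y - a) \<le> norm (y - a) ^ (CARD('n) - 1)" using R s1.N by (intro self_le_power) auto
        then have "?c * k1 / norm (y - a) ^ (CARD('n) - 1) \<le> ?c * k1 / norm (y - a)"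
          using c s1.k r by (intro divide_left_mono mult_pos_pos zero_less_power) auto
        also have "\<dots> < d" using R r d by (simp add: divide_less_eq mult.commute)
        finally show False using s1.u_le_far[OF y(1)] du by linarith
      qed
      moreover have "\<eta> \<le> y $ n"
      proof -
        have "d \<le> ?c * k1 * y $ n / norm (y - a) ^ CARD('n)" using s1.u_le[OF y(1)] du by linarith
        also have "\<dots> \<le> ?c * k1 * y $ n / t ^ CARD('n)"
          using c s1.k yn t far by (intro divide_left_mono mult_pos_pos zero_less_power power_mono) auto
        finally show ?thesis using c s1.k t by (simp add: \<eta>_def field_simps)
      qed
      ultimately show "y \<in> T" using far by (simp add: T_def dist_norm norm_minus_commute)
    qed
  qed
  have "u1 x \<le> (1 + e) * u2 x" if "0 < e" for e using le[OF that] by simp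
  then show ?thesis using s2.u_nonneg[OF x] by (rule le_if_le_mult)
qed

section \<open>Barriers\<close>

text \<open>The coefficient for which its product with
  \<open>(r\<^sup>2 - |x - y|\<^sup>2) powr (- 2 / (p - 1))\<close> is a supersolution in the ball
  of radius \<open>r\<close>, for an absorption coefficient at least
  \<open>\<gamma>\<close>.\<close>

definition keller_osserman_coeff :: "nat \<Rightarrow> real \<Rightarrow> real \<Rightarrow> real \<Rightarrow> real" where
  "keller_osserman_coeff N p \<gamma> r =
     (2 / (p - 1) * r\<^sup>2 * (2 * real N + 4 * (2 / (p - 1) + 1)) / \<gamma>) powr (1 / (p - 1))"

text \<open>The value of that supersolution at distance \<open>r / 2\<close> from the
  centre.\<close>

definition keller_osserman_bound :: "nat \<Rightarrow> real \<Rightarrow> real \<Rightarrow> real \<Rightarrow> real" where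
  "keller_osserman_bound N p \<gamma> r = keller_osserman_coeff N p \<gamma> r * (3 / 4 * r\<^sup>2) powr (- 2 / (p - 1))"

text \<open>
  Vanishes at \<open>y\<close>, is superharmonic away from the exterior point \<open>y - e\<^sub>N\<close>, and is at least \<open>M\<close> on the part of
  the sphere of radius \<open>r\<close> about \<open>y\<close> in the half-space.
\<close>

definition barrier :: "'n::finite \<Rightarrow> real \<Rightarrow> real \<Rightarrow> real ^ 'n \<Rightarrow> real ^ 'n \<Rightarrow> real" where
  "barrier n M r y x = M / (1 - 1 / (1 + r\<^sup>2) ^ CARD('n)) *
     (1 - 1 / ((x - (y - axis n 1)) \<bullet> (x - (y - axis n 1))) ^ CARD('n))"

text \<open>The exponents \<open>- CARD('n) / 2\<close> and \<open>0\<close> give harmonic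
  functions, the Poisson kernel up to a factor and the coordinate. Exponents strictly between them
  give the superharmonic correction terms.\<close>

lemma weak_laplacian_power:
  fixes a :: "real ^ 'n::finite"
  assumes D: "open D" "a \<notin> D" and a: "a $ n = 0"
  shows "weak_laplacian D (\<lambda>x. x $ n * ((x - a) \<bullet> (x - a)) powr e)
    (\<lambda>x. e * (2 * real CARD('n) + 4 * e) * x $ n * ((x - a) \<bullet> (x - a)) powr (e - 1))"
proof -
  define \<psi>' where "\<psi>' q = e * q powr (e - 1)" for q :: real
  define \<psi>'' where "\<psi>'' q = e * ((e - 1) * q powr (e - 1 - 1))" for q :: real
  have pos: "0 < (x - a) \<bullet> (x - a)" if "x \<in> D" for x using that D by auto
  have "weak_laplacian D (\<lambda>x. (0 + 1 * x $ n) * ((x - a) \<bullet> (x - a)) powr e)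
     (\<lambda>x. (0 + 1 * x $ n) * (2 * real CARD('n) * \<psi>' ((x - a) \<bullet> (x - a)) +
          4 * ((x - a) \<bullet> (x - a)) * \<psi>'' ((x - a) \<bullet> (x - a))) + 4 * 1 * (x - a) $ n * \<psi>' ((x - a) \<bullet> (x - a)))"
  proof (rule weak_laplacian_radial[where I = "{0<..}" and \<psi> = "\<lambda>q. q powr e"])
    fix q :: real assume q: "q \<in> {0<..}"
    show "((\<lambda>q. q powr e) has_real_derivative \<psi>' q) (at q)"
      unfolding \<psi>'_def using q by (auto intro!: derivative_eq_intros)
    show "(\<psi>' has_real_derivative \<psi>'' q) (at q)"
      unfolding \<psi>'_def[abs_def] \<psi>''_def using q by (auto intro!: derivative_eq_intros)
  next
    show "continuous_on {0<..} \<psi>''" unfolding \<psi>''_def[abs_def] by (intro continuous_intros) auto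
  qed (use D pos in auto)
  then show ?thesis
  proof (rule weak_laplacian_cong)
    fix x assume x: "x \<in> D"
    define q where "q = (x - a) \<bullet> (x - a)"
    have q: "0 < q" using pos[OF x] by (simp add: q_def)
    have "q * q powr (e - 1 - 1) = q powr (e - 1)"
      using q powr_add[of q 1 "e - 1 - 1"] by simp
    then have e: "4 * q * \<psi>'' q = 4 * e * (e - 1) * q powr (e - 1)"
      by (simp add: \<psi>''_def)
    show "(0 + 1 * x $ n) * (2 * real CARD('n) * \<psi>' ((x - a) \<bullet> (x - a)) +
          4 * ((x - a) \<bullet> (x - a)) * \<psi>'' ((x - a) \<bullet> (x - a))) + 4 * 1 * (x - a) $ n * \<psi>' ((x - a) \<bullet> (x - a))
       = e * (2 * real CARD('n) + 4 * e) * x $ n * ((x - a) \<bullet> (x - a)) powr (e - 1)"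
      unfolding q_def[symmetric] e using a by (simp add: \<psi>'_def algebra_simps)
  qed simp
qed

text \<open>
  As long as \<open>\<gamma> m\<^sup>p\<^sup>-\<^sup>1 \<rho>\<^sup>2\<close> is below the level, the Gaussian \<open>exp (- N |x - z|\<^sup>2 / \<rho>\<^sup>2)\<close>, normalised to \<open>m\<close> at
  \<open>|x - z| = \<rho>\<close> and \<open>0\<close> at \<open>|x - z| = 3 \<rho>\<close>, is a subsolution in between; the factor is its
  relative size at \<open>|x - z| = 2 \<rho>\<close>.
\<close>

definition harnack_level :: "'n::finite itself \<Rightarrow> real" where
  "harnack_level _ = exp (- 9 * real CARD('n))"

definition harnack_factor :: "'n::finite itself \<Rightarrow> real" where
  "harnack_factor _ = (exp (- 4 * real CARD('n)) - exp (- 9 * real CARD('n))) / (exp (- real CARD('n)) - exp (- 9 * real CARD('n)))"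

lemma harnack_factor: "0 < harnack_factor TYPE('n::finite)" "harnack_factor TYPE('n) < 1"
  by (simp_all add: harnack_factor_def)

context dirac_solution
begin

text \<open>The constant grows with \<open>k\<close>. It shows that \<open>u\<close> vanishes at the
  flat boundary away from \<open>a\<close>, which keeps the comparison sets compact, and it does not
  enter the resulting bounds.\<close>

lemma u_le_linear:
  assumes r: "0 < r" and ya: "2 * r \<le> norm (y - a)" and z: "z \<in> ball y r" "z \<in> half_space n"
  shows "u z \<le> pole_const TYPE('n) * k / r ^ CARD('n) * z $ n"
proof -
  have zn: "0 < z $ n" using z by (simp add: half_space_def)
  have "norm (y - a) \<le> norm (y - z) + norm (z - a)" using norm_triangle_ineq[of "y - z" "z - a"] by simp
  then have za: "r \<le> norm (z - a)" using z ya by (simp add: dist_norm)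
  have "u z \<le> pole_const TYPE('n) * k * z $ n / norm (z - a) ^ CARD('n)" by (rule u_le[OF z(2)])
  also have "\<dots> \<le> pole_const TYPE('n) * k * z $ n / r ^ CARD('n)"
    using pole_const_pos[where 'n='n] k zn r za
    by (intro divide_left_mono mult_pos_pos zero_less_power power_mono mult_nonneg_nonneg) auto
  finally show ?thesis by simp
qed

text \<open>The ball may cross the boundary. The comparison runs on its part in the half-space: the
  supersolution blows up at the sphere, and \<open>u\<close> vanishes at the flat part. The bound is
  free of \<open>k\<close>.\<close>

lemma keller_osserman:
  assumes \<gamma>: "0 < \<gamma>" and r: "0 < r" and ya: "2 * r \<le> norm (y - a)"
    and g: "\<And>x. \<lbrakk>x \<in> ball y r; x \<in> half_space n\<rbrakk> \<Longrightarrow> \<gamma> \<le> g x"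
    and x: "x \<in> ball y (r / 2)" "x \<in> half_space n"
  shows "u x \<le> keller_osserman_bound CARD('n) p \<gamma> r"
proof -
  let ?N = "real CARD('n)" and ?O = "half_space n" and ?q = "\<lambda>x. (x - y) \<bullet> (x - y)"
  define \<alpha> E C where "\<alpha> = 2 / (p - 1)" and "E = \<alpha> * r\<^sup>2 * (2 * ?N + 4 * (\<alpha> + 1)) / \<gamma>"
    and "C = keller_osserman_coeff CARD('n) p \<gamma> r"
  have \<alpha>: "0 < \<alpha>" using p by (simp add: \<alpha>_def)
  have E: "0 < E" using \<alpha> r \<gamma> by (auto simp: E_def intro!: divide_pos_pos mult_pos_pos add_nonneg_pos)
  have C: "0 < C" "C = E powr (1 / (p - 1))"
    using E by (auto simp: C_def keller_osserman_coeff_def E_def \<alpha>_def)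
  define D where "D = ball y r \<inter> ?O"
  define U where "U x = C * (r\<^sup>2 - ?q x) powr (- \<alpha>)" for x
  have qD: "?q x \<in> {..<r\<^sup>2}" if "x \<in> D" for x
    using that inside_bump[of x y r] by (simp add: D_def)
  \<comment> \<open>With this exponent the Laplacian of \<open>U\<close> and the power
    \<open>p\<close> of \<open>U\<close> blow up at the same order at the sphere.\<close>
  have pD: "\<alpha> * p = \<alpha> + 2" using p by (simp add: \<alpha>_def field_simps)
  define \<psi>' where "\<psi>' q = C * (\<alpha> * (r\<^sup>2 - q) powr (- \<alpha> - 1))" for q
  define \<psi>'' where "\<psi>'' q = C * (\<alpha> * ((\<alpha> + 1) * (r\<^sup>2 - q) powr (- \<alpha> - 2)))" for q
  define LU where "LU x = (1 + 0 * x $ n) * (2 * ?N * \<psi>' (?q x) + 4 * ?q x * \<psi>'' (?q x)) + 4 * 0 * (x - y) $ n * \<psi>' (?q x)" for x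
  have "weak_laplacian D (\<lambda>x. (1 + 0 * x $ n) * (C * (r\<^sup>2 - ?q x) powr (- \<alpha>))) LU"
    unfolding LU_def
  proof (rule weak_laplacian_radial[where I = "{..<r\<^sup>2}" and \<psi> = "\<lambda>q. C * (r\<^sup>2 - q) powr (- \<alpha>)"])
    fix q assume q: "q \<in> {..<r\<^sup>2}"
    have d: "((\<lambda>q. (r\<^sup>2 - q) powr e) has_real_derivative - e * (r\<^sup>2 - q) powr (e - 1)) (at q)" for e
      using q by (auto intro!: derivative_eq_intros)
    show "((\<lambda>q. C * (r\<^sup>2 - q) powr (- \<alpha>)) has_real_derivative \<psi>' q) (at q)"
      using DERIV_cmult[OF d[of "- \<alpha>"], of C] by (simp add: \<psi>'_def)
    have e: "- \<alpha> - 1 - 1 = - \<alpha> - 2" "- (- \<alpha> - 1) = \<alpha> + 1" by simp_all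
    show "(\<psi>' has_real_derivative \<psi>'' q) (at q)"
      using DERIV_cmult[OF d[of "- \<alpha> - 1", unfolded e], of "C * \<alpha>"]
      unfolding \<psi>'_def[abs_def] \<psi>''_def by (simp only: mult.assoc)
  next
    show "continuous_on {..<r\<^sup>2} \<psi>''" unfolding \<psi>''_def[abs_def] by (intro continuous_intros) auto
    show "open D" unfolding D_def by (intro open_Int open_ball open_half_space)
  qed (use qD in auto)
  then have wlU: "weak_laplacian D U LU" by (simp add: U_def[abs_def])
  have wlu: "weak_laplacian D u (\<lambda>x. g x * u x powr p)"
    by (rule weak_laplacian_subset[OF weak_laplacian_u]) (auto simp: D_def open_half_space)
  have LU: "LU x \<le> \<gamma> * U x powr p" if xD: "x \<in> D" for x
  proof -
    define s where "s = r\<^sup>2 - ?q x"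
    have s: "0 < s" "s \<le> r\<^sup>2" using qD[OF xD] by (auto simp: s_def)
    have s1: "s powr (- \<alpha> - 1) = s * s powr (- \<alpha> - 2)"
    proof -
      have e: "- \<alpha> - 1 = 1 + (- \<alpha> - 2)" by simp
      show ?thesis by (subst e, subst powr_add) (use s in simp)
    qed
    have "LU x = C * \<alpha> * s powr (- \<alpha> - 2) * (2 * ?N * s + 4 * (?q x) * (\<alpha> + 1))"
      unfolding LU_def \<psi>'_def \<psi>''_def s_def[symmetric] s1 by (simp add: algebra_simps)
    also have "\<dots> \<le> C * \<alpha> * s powr (- \<alpha> - 2) * (2 * ?N * r\<^sup>2 + 4 * r\<^sup>2 * (\<alpha> + 1))"
      using s qD[OF xD] C \<alpha> by (intro mult_left_mono add_mono mult_right_mono) auto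
    also have "\<dots> = C * (\<gamma> * E) * s powr (- \<alpha> - 2)"
    proof -
      have "\<gamma> * E = \<alpha> * r\<^sup>2 * (2 * ?N + 4 * (\<alpha> + 1))" using \<gamma> by (simp add: E_def)
      then show ?thesis by (simp add: algebra_simps)
    qed
    also have "\<dots> = \<gamma> * (C powr p) * s powr (- \<alpha> * p)"
    proof -
      have "C powr p = C powr 1 * C powr (p - 1)" using powr_add[of C 1 "p - 1"] by simp
      also have "C powr (p - 1) = E" using p E by (simp add: C(2) powr_powr)
      finally have "C powr p = C * E" using C(1) by simp
      moreover have "- \<alpha> * p = - \<alpha> - 2" using pD by simp
      ultimately show ?thesis by (simp only:) simp
    qed
    also have "\<dots> = \<gamma> * U x powr p"
      using C(1) s by (simp add: U_def s_def[symmetric] powr_mult powr_powr)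
    finally show ?thesis .
  qed
  have Upos: "0 \<le> U x" for x using C(1) by (simp add: U_def)
  have xD: "x \<in> D" using x r by (auto simp: D_def)
  have "u x - U x \<le> 0"
  proof (rule weak_laplacian_comparison[OF weak_laplacian_diff[OF wlu wlU] _ _ xD])
    fix z assume z: "z \<in> D" "0 < u z - U z"
    then have zO: "z \<in> ball y r" "z \<in> ?O" by (auto simp: D_def)
    have "U z powr p < u z powr p" using z Upos p by (intro powr_less_mono2) auto
    then have "\<gamma> * U z powr p < \<gamma> * u z powr p" using \<gamma> by simp
    also have "\<dots> \<le> g z * u z powr p" using g[OF zO] by (intro mult_right_mono) auto
    finally show "0 < g z * u z powr p - LU z" using LU[OF z(1)] by simp
  next
    fix d :: real assume d: "0 < d"
    define M M' \<eta> where "M = pole_const TYPE('n) * k / r ^ CARD('n)" and "M' = M * (\<bar>y $ n\<bar> + r)" and "\<eta> = d / M"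
    have M: "0 < M" using pole_const_pos[where 'n='n] k r by (simp add: M_def)
    have \<eta>: "0 < \<eta>" using d M by (simp add: \<eta>_def)
    have M': "0 < M'" using M r by (simp add: M'_def add_nonneg_pos)
    \<comment> \<open>The inequality \<open>U z \<le> M'\<close> is multiplied out to a closed
      condition, which fails on the sphere because its right side is \<open>0\<close> there.\<close>
    define T where "T = cball y r \<inter> {x. \<eta> \<le> x $ n} \<inter> {x. C \<le> M' * max 0 (r\<^sup>2 - ?q x) powr \<alpha>}"
    show "\<exists>T. compact T \<and> T \<subseteq> D \<and> (\<forall>z\<in>D. d \<le> u z - U z \<longrightarrow> z \<in> T)"
    proof (intro exI conjI ballI impI)
      have "continuous_on UNIV (\<lambda>x. M' * max 0 (r\<^sup>2 - ?q x) powr \<alpha>)"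
        by (intro continuous_intros continuous_on_powr') (use \<alpha> in auto)
      note c = this
      show "compact T" unfolding T_def
        by (intro compact_Int_closed compact_cball closed_Collect_le continuous_on_const c
            continuous_on_component continuous_on_id)
      show "T \<subseteq> D"
      proof
        fix z assume z: "z \<in> T"
        then have "max 0 (r\<^sup>2 - ?q z) \<noteq> 0" using C(1) by (auto simp: T_def)
        then have "z \<in> ball y r" using outside_bump[of r z y] r by (meson less_imp_le)
        then show "z \<in> D" using z \<eta> by (auto simp: T_def D_def half_space_def)
      qed
      fix z assume z: "z \<in> D" "d \<le> u z - U z"
      then have zO: "z \<in> ball y r" "z \<in> ?O" by (auto simp: D_def)
      have uM: "u z \<le> M * z $ n" unfolding M_def by (rule u_le_linear[OF r ya zO])
      have "\<eta> \<le> z $ n" using uM z(2) Upos[of z] M by (simp add: \<eta>_def divide_le_eq mult.commute)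
      moreover have "C \<le> M' * max 0 (r\<^sup>2 - ?q z) powr \<alpha>"
      proof -
        have "z $ n \<le> \<bar>y $ n\<bar> + r"
          using component_le_norm_cart[of "z - y" n] zO(1) by (simp add: dist_norm norm_minus_commute)
        then have "M * z $ n \<le> M'" unfolding M'_def using M by (intro mult_left_mono) auto
        then have "U z \<le> M'" using uM z(2) d by linarith
        moreover have s: "0 < r\<^sup>2 - ?q z" using qD[OF z(1)] by simp
        ultimately have "U z * (r\<^sup>2 - ?q z) powr \<alpha> \<le> M' * (r\<^sup>2 - ?q z) powr \<alpha>" by (intro mult_right_mono) auto
        moreover have "U z * (r\<^sup>2 - ?q z) powr \<alpha> = C" using s by (simp add: U_def powr_minus)
        ultimately show ?thesis using s by simp
      qed
      ultimately show "z \<in> T" using zO(1) by (auto simp: T_def)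
    qed
  qed
  then have "u x \<le> U x" by simp
  also have "\<dots> \<le> C * (3 / 4 * r\<^sup>2) powr (- \<alpha>)"
  proof -
    have "0 < (r / 2)\<^sup>2 - ?q x" by (rule inside_bump[OF x(1)])
    then have "3 / 4 * r\<^sup>2 \<le> r\<^sup>2 - ?q x" by (simp add: power_divide)
    then show ?thesis unfolding U_def using C r \<alpha> by (intro mult_left_mono powr_mono2') auto
  qed
  finally show ?thesis by (simp add: keller_osserman_bound_def C_def \<alpha>_def)
qed

text \<open>The power \<open>- CARD('n)\<close> of the squared distance is steeper than the
  fundamental solution and thus strictly subharmonic. The barrier is therefore strictly
  superharmonic, as \<open>weak_laplacian_comparison\<close> demands.\<close>

lemma boundary_barrier:
  assumes y: "y $ n = 0" and r: "0 < r" and ya: "2 * r \<le> norm (y - a)"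
    and M: "0 < M" "\<And>x. \<lbrakk>x \<in> ball y r; x \<in> half_space n\<rbrakk> \<Longrightarrow> u x \<le> M"
    and x: "x \<in> ball y r" "x \<in> half_space n"
  shows "u x \<le> barrier n M r y x"
proof -
  let ?N = "CARD('n)" and ?O = "half_space n"
  define z where "z = y - axis n 1"
  let ?q = "\<lambda>x. (x - z) \<bullet> (x - z)"
  define B where "B = M / (1 - 1 / (1 + r\<^sup>2) ^ ?N)"
  have N0: "0 < ?N" using N by simp
  have "1 < (1 + r\<^sup>2) ^ ?N" using r N0 by (intro one_less_power) auto
  then have b: "0 < 1 - 1 / (1 + r\<^sup>2) ^ ?N" by simp
  have B: "0 < B" using M b by (simp add: B_def)
  define D where "D = ball y r \<inter> ?O"
  define w where "w x = B * (1 - 1 / ?q x ^ ?N)" for x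
  have qe: "?q x = (x - y) \<bullet> (x - y) + 1 + 2 * x $ n" for x
  proof -
    have "x - z = (x - y) + axis n 1" by (simp add: z_def)
    then have "?q x = ((x - y) + axis n 1) \<bullet> ((x - y) + axis n 1)" by (simp only:)
    also have "\<dots> = (x - y) \<bullet> (x - y) + 2 * ((x - y) \<bullet> axis n 1) + 1"
      by (simp only: inner_add_left inner_add_right) (simp add: inner_commute inner_axis_axis)
    finally show ?thesis using y by (simp add: inner_axis inner_axis_axis)
  qed
  have qD: "1 \<le> ?q x" if "0 \<le> x $ n" for x using that by (simp add: qe)
  define \<psi>' where "\<psi>' q = - (- (B * real ?N)) / q ^ (?N + 1)" for q :: real
  define \<psi>'' where "\<psi>'' q = - (B * real ?N * real (?N + 1)) / q ^ (?N + 1 + 1)" for q :: real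
  define Lw where "Lw x = (1 + 0 * x $ n) * (2 * real ?N * \<psi>' (?q x) + 4 * ?q x * \<psi>'' (?q x)) + 4 * 0 * (x - z) $ n * \<psi>' (?q x)" for x
  have "weak_laplacian D (\<lambda>x. (1 + 0 * x $ n) * (B + (- (B * real ?N)) / (real ?N * ?q x ^ ?N))) Lw"
    unfolding Lw_def
  proof (rule weak_laplacian_radial[where I = "{0<..}" and \<psi> = "\<lambda>q. B + (- (B * real ?N)) / (real ?N * q ^ ?N)"])
    fix q :: real assume q: "q \<in> {0<..}"
    then have q0: "0 < q" by simp
    show "((\<lambda>q. B + (- (B * real ?N)) / (real ?N * q ^ ?N)) has_real_derivative \<psi>' q) (at q)"
      using DERIV_add[OF DERIV_const[of B] DERIV_inverse_power[OF q0 N0, of "- (B * real ?N)"]] by (simp add: \<psi>'_def)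
    have "((\<lambda>q. (B * real ?N * real (?N + 1)) / (real (?N + 1) * q ^ (?N + 1))) has_real_derivative \<psi>'' q) (at q)"
      unfolding \<psi>''_def using q0 by (intro DERIV_inverse_power) auto
    then show "(\<psi>' has_real_derivative \<psi>'' q) (at q)"
      by (simp add: \<psi>'_def[abs_def] del: of_nat_add of_nat_Suc)
  next
    show "continuous_on {0<..} \<psi>''" unfolding \<psi>''_def[abs_def] by (intro continuous_intros) auto
    show "open D" unfolding D_def by (intro open_Int open_ball open_half_space)
    show "?q x \<in> {0<..}" if "x \<in> D" for x using qD[of x] that by (auto simp: D_def half_space_def)
  qed
  then have wlw: "weak_laplacian D w Lw"
    by (rule weak_laplacian_cong) (use N0 in \<open>auto simp: w_def right_diff_distrib\<close>)
  have Lw: "Lw x < 0" if "x \<in> D" for x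
  proof -
    have q: "0 < ?q x" using qD[of x] that by (auto simp: D_def half_space_def)
    have "Lw x = B * real ?N / ?q x ^ (?N + 1) * (2 * real ?N - 4 * real (?N + 1))"
      using q by (simp add: Lw_def \<psi>'_def \<psi>''_def field_simps)
    also have "\<dots> < 0" using q B N0 by (intro mult_pos_neg divide_pos_pos mult_pos_pos) auto
    finally show ?thesis .
  qed
  have wlu: "weak_laplacian D u (\<lambda>x. g x * u x powr p)"
    by (rule weak_laplacian_subset[OF weak_laplacian_u]) (auto simp: D_def open_half_space)
  have w0: "0 \<le> w x" if "0 \<le> x $ n" for x
  proof -
    have "1 \<le> ?q x ^ ?N" using qD[OF that] by (rule one_le_power)
    then have "1 / ?q x ^ ?N \<le> 1" by simp
    then show ?thesis unfolding w_def using B by (intro mult_nonneg_nonneg) auto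
  qed
  have xD: "x \<in> D" using x by (simp add: D_def)
  have "u x - w x \<le> 0"
  proof (rule weak_laplacian_comparison[OF weak_laplacian_diff[OF wlu wlw] _ _ xD])
    fix s assume s: "s \<in> D" "0 < u s - w s"
    then have "0 \<le> g s * u s powr p" using g_pos[of s] by (simp add: D_def)
    then show "0 < g s * u s powr p - Lw s" using Lw[OF s(1)] by linarith
  next
    fix d :: real assume d: "0 < d"
    define M1 \<eta> where "M1 = pole_const TYPE('n) * k / r ^ CARD('n)" and "\<eta> = d / M1"
    have M1: "0 < M1" using pole_const_pos[where 'n='n] k r by (simp add: M1_def)
    have \<eta>: "0 < \<eta>" using d M1 by (simp add: \<eta>_def)
    define T where "T = cball y r \<inter> {x. \<eta> \<le> x $ n} \<inter> {x. B * (1 - 1 / (max 1 (?q x)) ^ ?N) \<le> M - d}"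
    show "\<exists>T. compact T \<and> T \<subseteq> D \<and> (\<forall>s\<in>D. d \<le> u s - w s \<longrightarrow> s \<in> T)"
    proof (intro exI conjI ballI impI)
      have "max 1 t \<noteq> (0::real)" for t by (simp add: max_def)
      then have "continuous_on UNIV (\<lambda>x. B * (1 - 1 / (max 1 (?q x)) ^ ?N))"
        by (intro continuous_intros) auto
      note c = this
      show "compact T" unfolding T_def
        by (intro compact_Int_closed compact_cball closed_Collect_le continuous_on_const c
            continuous_on_component continuous_on_id)
      show "T \<subseteq> D"
      proof
        fix s assume s: "s \<in> T"
        then have sn: "0 < s $ n" "dist y s \<le> r" using \<eta> by (auto simp: T_def)
        have q1: "1 \<le> ?q s" using qD sn by simp
        \<comment> \<open>On the sphere \<open>?q s \<ge> 1 + r\<^sup>2\<close> in the half-space,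
          so the barrier is at least \<open>M\<close> there, contrary to the bound
          \<open>M - d\<close> in \<open>T\<close>.\<close>
        have "dist y s \<noteq> r"
        proof
          assume "dist y s = r"
          then have "norm (s - y) = r" by (simp add: dist_norm norm_minus_commute)
          then have "(s - y) \<bullet> (s - y) = r\<^sup>2" using power2_norm_eq_inner[of "s - y"] by simp
          then have "1 + r\<^sup>2 \<le> ?q s" using sn by (simp add: qe)
          then have "(1 + r\<^sup>2) ^ ?N \<le> ?q s ^ ?N" by (intro power_mono) auto
          then have "1 / ?q s ^ ?N \<le> 1 / (1 + r\<^sup>2) ^ ?N"
            by (intro divide_left_mono mult_pos_pos zero_less_power) (use q1 in \<open>auto simp: add_pos_nonneg\<close>)
          then have "B * (1 - 1 / (1 + r\<^sup>2) ^ ?N) \<le> B * (1 - 1 / ?q s ^ ?N)" using B by simp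
          also have "\<dots> \<le> M - d" using s q1 by (simp add: T_def max_absorb2)
          also have "B * (1 - 1 / (1 + r\<^sup>2) ^ ?N) = M"
            by (rule iffD1[OF nonzero_eq_divide_eq B_def]) (rule less_imp_neq[OF b, symmetric])
          finally have "M \<le> M - d" .
          then show False using d by simp
        qed
        then show "s \<in> D" using sn by (simp add: D_def half_space_def)
      qed
      fix s assume s: "s \<in> D" "d \<le> u s - w s"
      then have sO: "s \<in> ball y r" "s \<in> ?O" by (auto simp: D_def)
      have sn: "0 < s $ n" using sO by (simp add: half_space_def)
      have uM: "u s \<le> M1 * s $ n" unfolding M1_def by (rule u_le_linear[OF r ya sO])
      have ws: "0 \<le> w s" using w0 sn by simp
      have "\<eta> \<le> s $ n" using uM s(2) ws M1 by (simp add: \<eta>_def divide_le_eq mult.commute)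
      moreover have "B * (1 - 1 / (max 1 (?q s)) ^ ?N) \<le> M - d"
        using s(2) M(2)[OF sO] qD[of s] sn by (simp add: w_def max_absorb2)
      ultimately show "s \<in> T" using sO(1) by (auto simp: T_def)
    qed
  qed
  then show ?thesis by (simp add: w_def B_def barrier_def z_def)
qed

end

section \<open>Lower bounds: a local subsolution at the pole and a Harnack step\<close>

context dirac_solution
begin

text \<open>The subsolution is \<open>\<kappa>\<close> times the Poisson kernel shape, minus the
  multiple of the coordinate that agrees with it on the sphere, minus a correction whose Laplacian
  pays for the absorption. The mass \<open>\<kappa>\<close> may be less than that of
  \<open>u\<close>: the relative size of the correction is governed by
  \<open>\<gamma> * \<kappa> powr (p - 1)\<close>.\<close>

lemma pole_lower_bound:
  assumes r: "0 < r" and \<gamma>: "0 < \<gamma>" and g: "\<And>x. \<lbrakk>x \<in> ball a r; x \<in> half_space n\<rbrakk> \<Longrightarrow> g x \<le> \<gamma>"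
    and \<kappa>: "0 < \<kappa>" "\<kappa> \<le> pole_const TYPE('n) * k" and x: "x \<in> ball a r" "x \<in> half_space n"
  shows "\<kappa> * (x $ n / norm (x - a) ^ CARD('n) - x $ n / r ^ CARD('n))
      - \<gamma> * \<kappa> powr p / (\<beta> * (real CARD('n) - \<beta>)) * (x $ n * norm (x - a) powr (- \<beta>)) \<le> u x"
proof -
  let ?N = "real CARD('n)" and ?O = "half_space n" and ?q = "\<lambda>x. (x - a) \<bullet> (x - a)" and ?c = "pole_const TYPE('n)"
  define D where "D = ball a r \<inter> ?O"
  define b where "b = \<beta> * (?N - \<beta>)"
  have b: "0 < b" using \<beta> by (simp add: b_def)
  have D: "open D" "a \<notin> D" using a by (auto simp: D_def half_space_def intro!: open_Int open_half_space[unfolded half_space_def])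
  note wp = weak_laplacian_power[OF D a]
  define w where "w x = \<kappa> * (x $ n * ?q x powr (- ?N / 2)) - \<kappa> / r ^ CARD('n) * (x $ n * ?q x powr 0)
    - \<gamma> * \<kappa> powr p / b * (x $ n * ?q x powr (- \<beta> / 2))" for x
  define Lw where "Lw x = \<gamma> * \<kappa> powr p * (x $ n * ?q x powr (- \<beta> / 2 - 1))" for x
  have wlw: "weak_laplacian D w Lw"
  proof (rule weak_laplacian_cong[OF weak_laplacian_diff[OF weak_laplacian_diff[OF weak_laplacian_cmult[OF wp[of "- ?N / 2"], of \<kappa>]
          weak_laplacian_cmult[OF wp[of 0], of "\<kappa> / r ^ CARD('n)"]] weak_laplacian_cmult[OF wp[of "- \<beta> / 2"], of "\<gamma> * \<kappa> powr p / b"]]])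
    fix x assume "x \<in> D"
    have "(- \<beta> / 2) * (2 * ?N + 4 * (- \<beta> / 2)) = - b" by (simp add: b_def algebra_simps)
    then show "\<kappa> * (- ?N / 2 * (2 * ?N + 4 * (- ?N / 2)) * x $ n * ?q x powr (- ?N / 2 - 1)) -
         \<kappa> / r ^ CARD('n) * (0 * (2 * ?N + 4 * 0) * x $ n * ?q x powr (0 - 1)) -
         \<gamma> * \<kappa> powr p / b * (- \<beta> / 2 * (2 * ?N + 4 * (- \<beta> / 2)) * x $ n * ?q x powr (- \<beta> / 2 - 1)) = Lw x"
      using b by (simp only: Lw_def) simp
  qed (simp add: w_def)
  have wlu: "weak_laplacian D u (\<lambda>x. g x * u x powr p)"
    by (rule weak_laplacian_subset[OF weak_laplacian_u]) (auto simp: D_def open_half_space)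
  have nq: "?q x powr (e / 2) = norm (x - a) powr e" if "x \<in> ?O" for e x
  proof -
    have "0 < norm (x - a)" using x_le_norm[OF that] by linarith
    then have "(norm (x - a))\<^sup>2 powr (e / 2) = norm (x - a) powr e"
      by (simp add: powr_powr flip: powr_numeral)
    then show ?thesis by (simp add: power2_norm_eq_inner)
  qed
  have weq: "w x = \<kappa> * (x $ n / norm (x - a) ^ CARD('n) - x $ n / r ^ CARD('n))
      - \<gamma> * \<kappa> powr p / b * (x $ n * norm (x - a) powr (- \<beta>))" if "x \<in> ?O" for x
  proof -
    have n0: "0 < norm (x - a)" using x_le_norm[OF that] by linarith
    then have "norm (x - a) powr (- ?N) = 1 / norm (x - a) ^ CARD('n)"
      by (simp add: powr_minus powr_realpow divide_inverse)
    moreover have "?q x powr 0 = 1" using n0 by simp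
    ultimately show ?thesis unfolding w_def nq[OF that] by (simp add: right_diff_distrib)
  qed
  have w_le: "w x \<le> \<kappa> * x $ n / norm (x - a) ^ CARD('n)" "w x \<le> \<kappa> * (x $ n / norm (x - a) ^ CARD('n) - x $ n / r ^ CARD('n))"
    if "x \<in> ?O" for x
  proof -
    have xn: "0 < x $ n" using that by (simp add: half_space_def)
    have "0 \<le> \<gamma> * \<kappa> powr p / b * (x $ n * norm (x - a) powr (- \<beta>))" using \<gamma> b xn by simp
    then show 1: "w x \<le> \<kappa> * (x $ n / norm (x - a) ^ CARD('n) - x $ n / r ^ CARD('n))" unfolding weq[OF that] by linarith
    have "\<kappa> * (x $ n / norm (x - a) ^ CARD('n) - x $ n / r ^ CARD('n)) \<le> \<kappa> * (x $ n / norm (x - a) ^ CARD('n))"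
      using \<kappa> xn r by (intro mult_left_mono) auto
    then show "w x \<le> \<kappa> * x $ n / norm (x - a) ^ CARD('n)" using 1 by simp
  qed
  have le: "w x - (1 + e) * u x \<le> 0" if e: "0 < e" for e
  proof (rule weak_laplacian_comparison[OF weak_laplacian_diff[OF wlw weak_laplacian_cmult[OF wlu]]])
    show "x \<in> D" using x by (simp add: D_def)
    fix y assume y: "y \<in> D" "0 < w y - (1 + e) * u y"
    then have yO: "y \<in> ball a r" "y \<in> ?O" by (auto simp: D_def)
    have yn: "0 < y $ n" "y $ n \<le> norm (y - a)" using x_le_norm[OF yO(2)] by auto
    then have n0: "0 < norm (y - a)" by linarith
    have uy: "0 \<le> u y" by (rule u_nonneg[OF yO(2)])
    then have wy: "0 < w y" using y(2) e by (meson add_nonneg_nonneg diff_gt_0_iff_gt less_eq_real_def mult_nonneg_nonneg order_le_less_trans zero_le_one)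
    have "(1 + e) * (g y * u y powr p) \<le> \<gamma> * ((1 + e) * u y powr p)"
      using g[OF yO] e by (simp add: mult.left_commute mult_left_mono mult_right_mono)
    also have "\<dots> < \<gamma> * w y powr p"
      using powr_superlinear[OF e uy _ p(1), of "w y"] y(2) \<gamma> by simp
    also have "\<dots> \<le> \<gamma> * (\<kappa> * y $ n / norm (y - a) ^ CARD('n)) powr p"
      using wy w_le(1)[OF yO(2)] p \<gamma> by (intro mult_left_mono powr_mono2) auto
    also have "(\<kappa> * y $ n / norm (y - a) ^ CARD('n)) powr p \<le> \<kappa> powr p * (y $ n * norm (y - a) powr (- \<beta> - 2))"
    proof -
      have "\<kappa> * y $ n / norm (y - a) ^ CARD('n) = \<kappa> * y $ n * norm (y - a) powr (- ?N)"
        using n0 by (simp add: powr_minus powr_realpow divide_inverse)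
      then have "(\<kappa> * y $ n / norm (y - a) ^ CARD('n)) powr p = \<kappa> powr p * (y $ n powr p * norm (y - a) powr (- ?N * p))"
        using \<kappa> yn n0 by (simp add: powr_mult powr_powr)
      also have "y $ n powr p = y $ n * y $ n powr (p - 1)" using yn powr_add[of "y $ n" 1 "p - 1"] by simp
      also have "\<kappa> powr p * (y $ n * y $ n powr (p - 1) * norm (y - a) powr (- ?N * p))
          \<le> \<kappa> powr p * (y $ n * norm (y - a) powr (p - 1) * norm (y - a) powr (- ?N * p))"
        using yn p by (intro mult_left_mono mult_right_mono powr_mono2) auto
      also have "\<dots> = \<kappa> powr p * (y $ n * norm (y - a) powr (p - 1 + - ?N * p))"
        unfolding powr_add by simp
      also have "p - 1 + - ?N * p = - \<beta> - 2" by (simp add: \<beta>_def algebra_simps)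
      finally show ?thesis .
    qed
    also have "\<kappa> powr p * (y $ n * norm (y - a) powr (- \<beta> - 2)) = \<kappa> powr p * (y $ n * ?q y powr (- \<beta> / 2 - 1))"
      using nq[OF yO(2), of "- \<beta> - 2"] by (simp add: diff_divide_distrib)
    finally show "0 < Lw y - (1 + e) * (g y * u y powr p)"
      using \<gamma> by (simp add: Lw_def mult.assoc)
  next
    fix d :: real assume d: "0 < d"
    obtain t where t: "0 < t" "\<And>y. \<lbrakk>y \<in> ?O; norm (y - a) < t\<rbrakk> \<Longrightarrow> ?c * k * y $ n / norm (y - a) ^ CARD('n) \<le> (1 + e) * u y"
      using near_pole[OF e] by blast
    \<comment> \<open>\<open>max t\<close> keeps the last condition continuous at \<open>a\<close>;
      on \<open>T\<close> itself the distance to \<open>a\<close> is at least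
      \<open>t\<close>.\<close>
    define T where "T = cball a r \<inter> {y. t \<le> norm (y - a)} \<inter> {y. 0 \<le> y $ n} \<inter>
      {y. d \<le> \<kappa> * (y $ n / (max t (norm (y - a))) ^ CARD('n) - y $ n / r ^ CARD('n))}"
    show "\<exists>T. compact T \<and> T \<subseteq> D \<and> (\<forall>y\<in>D. d \<le> w y - (1 + e) * u y \<longrightarrow> y \<in> T)"
    proof (intro exI conjI ballI impI)
      have "max t s \<noteq> 0" for s using t(1) by (simp add: max_def)
      then have "continuous_on UNIV (\<lambda>y. \<kappa> * (y $ n / (max t (norm (y - a))) ^ CARD('n) - y $ n / r ^ CARD('n)))"
        using r by (intro continuous_intros) auto
      note c = this
      show "compact T" unfolding T_def
        by (intro compact_Int_closed compact_cball closed_Collect_le continuous_on_const c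
            continuous_on_component continuous_on_id continuous_on_norm continuous_on_diff)
      show "T \<subseteq> D"
      proof
        fix y assume y: "y \<in> T"
        then have dy: "d \<le> \<kappa> * (y $ n / norm (y - a) ^ CARD('n) - y $ n / r ^ CARD('n))"
          and yr: "norm (y - a) \<le> r" and y0: "0 \<le> y $ n"
          by (auto simp: T_def max_absorb2 dist_norm norm_minus_commute)
        have "y $ n \<noteq> 0" using dy d by auto
        moreover have "norm (y - a) \<noteq> r" using dy d by auto
        ultimately show "y \<in> D" using yr y0 by (simp add: D_def half_space_def dist_norm norm_minus_commute)
      qed
      fix y assume y: "y \<in> D" "d \<le> w y - (1 + e) * u y"
      then have yO: "y \<in> ball a r" "y \<in> ?O" by (auto simp: D_def)
      have yn: "0 < y $ n" "y $ n \<le> norm (y - a)" using x_le_norm[OF yO(2)] by auto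
      then have n0: "0 < norm (y - a)" by linarith
      have far: "t \<le> norm (y - a)"
      proof (rule ccontr)
        assume "\<not> t \<le> norm (y - a)"
        then have "?c * k * y $ n / norm (y - a) ^ CARD('n) \<le> (1 + e) * u y" using t(2)[OF yO(2)] by simp
        moreover have "\<kappa> * y $ n / norm (y - a) ^ CARD('n) \<le> ?c * k * y $ n / norm (y - a) ^ CARD('n)"
          using \<kappa> yn n0 by (intro divide_right_mono mult_right_mono) auto
        ultimately show False using w_le(1)[OF yO(2)] y(2) d by linarith
      qed
      have "0 \<le> (1 + e) * u y" using e u_nonneg[OF yO(2)] by simp
      then have "d \<le> \<kappa> * (y $ n / norm (y - a) ^ CARD('n) - y $ n / r ^ CARD('n))"
        using w_le(2)[OF yO(2)] y(2) by linarith
      then show "y \<in> T" using far yO(1) yn by (simp add: T_def max_absorb2 dist_norm norm_minus_commute)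
    qed
  qed
  have "w x \<le> (1 + e) * u x" if "0 < e" for e using le[OF that] by simp
  then have "w x \<le> u x" using u_nonneg[OF x(2)] by (rule le_if_le_mult)
  then show ?thesis using weq[OF x(2)] by (simp add: b_def)
qed

text \<open>Comparison on the annulus between the radii \<open>\<rho>\<close> and
  \<open>3 * \<rho>\<close>: the normalised Gaussian is \<open>m \<le> u\<close> on the inner sphere
  and \<open>0 \<le> u\<close> on the outer one. Doubling the radius costs the factor
  \<open>harnack_factor\<close>.\<close>

lemma harnack_step:
  fixes m :: real
  assumes \<rho>: "0 < \<rho>" and sub: "cball z (3 * \<rho>) \<subseteq> half_space n" and g: "\<And>x. x \<in> cball z (3 * \<rho>) \<Longrightarrow> g x \<le> \<gamma>"
    and m: "0 < m" "\<gamma> * m powr (p - 1) * \<rho>\<^sup>2 \<le> harnack_level TYPE('n)"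
    and u: "\<And>x. x \<in> cball z \<rho> \<Longrightarrow> m \<le> u x" and x: "x \<in> cball z (2 * \<rho>)"
  shows "harnack_factor TYPE('n) * m \<le> u x"
proof (cases "x \<in> cball z \<rho>")
  case True
  have "harnack_factor TYPE('n) * m \<le> 1 * m" using m harnack_factor(2)[where 'n='n] by (intro mult_right_mono) auto
  then show ?thesis using u[OF True] by simp
next
  case False
  let ?N = "real CARD('n)" and ?q = "\<lambda>x. (x - z) \<bullet> (x - z)"
  define E where "E = exp (- ?N) - exp (- 9 * ?N)"
  have N0: "1 \<le> ?N" using N by simp
  have E: "0 < E" "E \<le> 1" using N0 by (auto simp: E_def intro: order_trans[of _ "exp (- ?N)"])
  define D where "D = ball z (3 * \<rho>) - cball z \<rho>"
  have op: "open D" by (simp add: D_def open_Diff)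
  define w where "w x = m / E * (exp (- ?N / \<rho>\<^sup>2 * ?q x) - exp (- 9 * ?N))" for x
  define \<psi>' where "\<psi>' q = m / E * ((- ?N / \<rho>\<^sup>2) * exp (- ?N / \<rho>\<^sup>2 * q))" for q
  define \<psi>'' where "\<psi>'' q = m / E * ((- ?N / \<rho>\<^sup>2) * ((- ?N / \<rho>\<^sup>2) * exp (- ?N / \<rho>\<^sup>2 * q)))" for q
  define Lw where "Lw x = (1 + 0 * x $ n) * (2 * ?N * \<psi>' (?q x) + 4 * ?q x * \<psi>'' (?q x)) + 4 * 0 * (x - z) $ n * \<psi>' (?q x)" for x
  have "weak_laplacian D (\<lambda>x. (1 + 0 * x $ n) * (m / E * (exp (- ?N / \<rho>\<^sup>2 * ?q x) - exp (- 9 * ?N)))) Lw"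
    unfolding Lw_def
  proof (rule weak_laplacian_radial[where I = UNIV and \<psi> = "\<lambda>q. m / E * (exp (- ?N / \<rho>\<^sup>2 * q) - exp (- 9 * ?N))"])
    fix q :: real
    have d: "((\<lambda>q. exp (e * q)) has_real_derivative e * exp (e * q)) (at q)" for e :: real
      by (auto intro!: derivative_eq_intros)
    show "((\<lambda>q. m / E * (exp (- ?N / \<rho>\<^sup>2 * q) - exp (- 9 * ?N))) has_real_derivative \<psi>' q) (at q)"
      unfolding \<psi>'_def by (rule DERIV_cmult) (rule DERIV_cong[OF DERIV_diff[OF d DERIV_const]], simp)
    show "(\<psi>' has_real_derivative \<psi>'' q) (at q)"
      unfolding \<psi>'_def[abs_def] \<psi>''_def by (intro DERIV_cmult d)
  next
    show "continuous_on UNIV \<psi>''" unfolding \<psi>''_def[abs_def] by (intro continuous_intros)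
  qed (use op in auto)
  then have wlw: "weak_laplacian D w Lw" by (simp add: w_def[abs_def])
  have DO: "D \<subseteq> cball z (3 * \<rho>)" by (auto simp: D_def)
  have wlu: "weak_laplacian D u (\<lambda>x. g x * u x powr p)"
    by (rule weak_laplacian_subset[OF weak_laplacian_u op]) (use DO sub in blast)
  have nq: "?q x = (dist z x)\<^sup>2" for x by (simp add: power2_norm_eq_inner dist_norm norm_minus_commute)
  have qD: "\<rho>\<^sup>2 \<le> ?q x" "?q x \<le> 9 * \<rho>\<^sup>2" if "x \<in> D" for x
  proof -
    have "\<rho> \<le> dist z x" "dist z x \<le> 3 * \<rho>" using that by (auto simp: D_def)
    then have "\<rho>\<^sup>2 \<le> (dist z x)\<^sup>2" "(dist z x)\<^sup>2 \<le> (3 * \<rho>)\<^sup>2"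
      using \<rho> power_mono[of \<rho> "dist z x" 2] power_mono[of "dist z x" "3 * \<rho>" 2] by auto
    then show "\<rho>\<^sup>2 \<le> ?q x" "?q x \<le> 9 * \<rho>\<^sup>2" unfolding nq by (auto simp: power_mult_distrib)
  qed
  have Lw: "m * harnack_level TYPE('n) / \<rho>\<^sup>2 \<le> Lw x" if "x \<in> D" for x
  proof -
    have "Lw x = m / E * exp (- ?N / \<rho>\<^sup>2 * ?q x) * (?N / \<rho>\<^sup>2) * (4 * ?N * (?q x / \<rho>\<^sup>2) - 2 * ?N)"
      by (simp add: Lw_def \<psi>'_def \<psi>''_def algebra_simps)
    \<comment> \<open>With \<open>t = ?q x / \<rho>\<^sup>2\<close> between \<open>1\<close> and
      \<open>9\<close>, the exponential is at least \<open>exp (- 9 * ?N)\<close> and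
      \<open>4 * ?N * t - 2 * ?N \<ge> 2 * ?N \<ge> 1\<close>.\<close>
    also have "\<dots> \<ge> m / 1 * exp (- 9 * ?N) * (1 / \<rho>\<^sup>2) * 1"
    proof (intro mult_mono divide_left_mono divide_right_mono)
      define t where "t = ?q x / \<rho>\<^sup>2"
      have "1 \<le> t" "t \<le> 9" using qD[OF that] \<rho> by (auto simp: t_def pos_divide_le_eq pos_le_divide_eq)
      then have t: "?N * t \<le> ?N * 9" "?N * 1 \<le> ?N * t" using N0 by (auto intro!: mult_left_mono)
      have "- ?N / \<rho>\<^sup>2 * ?q x = - (?N * t)" by (simp add: t_def)
      then show "exp (- 9 * ?N) \<le> exp (- ?N / \<rho>\<^sup>2 * ?q x)" using t by simp
      show "1 \<le> 4 * ?N * (?q x / \<rho>\<^sup>2) - 2 * ?N" unfolding t_def[symmetric] mult.assoc using t N0 by linarith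
    qed (use E N0 m \<rho> in auto)
    finally show ?thesis by (simp add: harnack_level_def)
  qed
  have cw: "continuous_on (cball z (3 * \<rho>)) (\<lambda>x. w x - u x)"
    unfolding w_def by (intro continuous_intros continuous_on_subset[OF u_cont sub])
  have xD: "x \<in> D" using False x \<rho> by (auto simp: D_def)
  have "w x - u x \<le> 0"
  proof (rule weak_laplacian_comparison[OF weak_laplacian_diff[OF wlw wlu] _ _ xD])
    fix s assume s: "s \<in> D" "0 < w s - u s"
    have sO: "s \<in> half_space n" using s DO sub by blast
    have us: "0 \<le> u s" by (rule u_nonneg[OF sO])
    have g0: "0 < g s" by (rule g_pos[OF sO])
    have "?N / \<rho>\<^sup>2 * \<rho>\<^sup>2 \<le> ?N / \<rho>\<^sup>2 * ?q s" using qD(1)[OF s(1)] by (intro mult_left_mono) auto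
    then have "exp (- ?N / \<rho>\<^sup>2 * ?q s) \<le> exp (- ?N)" using \<rho> by simp
    then have "w s \<le> m / E * E" unfolding w_def using m E by (intro mult_left_mono) (auto simp: E_def)
    then have ws: "w s \<le> m" using E by simp
    have "g s * u s powr p < g s * w s powr p"
      using s us g0 p by (intro mult_strict_left_mono powr_less_mono2) auto
    also have "\<dots> \<le> \<gamma> * m powr p"
      using g[of s] s DO us ws p g0 by (intro mult_mono powr_mono2) auto
    also have "m powr p = m * m powr (p - 1)" using m powr_add[of m 1 "p - 1"] by simp
    also have "\<gamma> * (m * m powr (p - 1)) \<le> m * harnack_level TYPE('n) / \<rho>\<^sup>2"
    proof -
      have "\<gamma> * m powr (p - 1) \<le> harnack_level TYPE('n) / \<rho>\<^sup>2" using m(2) \<rho> by (simp add: pos_le_divide_eq)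
      then have "m * (\<gamma> * m powr (p - 1)) \<le> m * (harnack_level TYPE('n) / \<rho>\<^sup>2)" using m(1) by (intro mult_left_mono) auto
      then show ?thesis by (simp add: mult.left_commute)
    qed
    finally show "0 < Lw s - g s * u s powr p" using Lw[OF s(1)] by linarith
  next
    fix d :: real assume d: "0 < d"
    define T where "T = {s \<in> cball z (3 * \<rho>) - ball z \<rho>. d \<le> w s - u s}"
    show "\<exists>T. compact T \<and> T \<subseteq> D \<and> (\<forall>s\<in>D. d \<le> w s - u s \<longrightarrow> s \<in> T)"
    proof (intro exI conjI ballI impI)
      have cA: "compact (cball z (3 * \<rho>) - ball z \<rho>)" by (intro compact_diff compact_cball open_ball)
      have "closed {s \<in> cball z (3 * \<rho>) - ball z \<rho>. d \<le> w s - u s}"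
        using continuous_closed_preimage[OF continuous_on_subset[OF cw, of "cball z (3 * \<rho>) - ball z \<rho>"] compact_imp_closed[OF cA], of "{d..}"]
        by (auto simp: vimage_def Int_def conj_commute)
      then show "compact T" unfolding T_def using cA
        by (metis (no_types, lifting) compact_Int_closed inf.absorb_iff2 mem_Collect_eq subsetI)
      show "T \<subseteq> D"
      proof
        fix s assume s: "s \<in> T"
        then have ds: "\<rho> \<le> dist z s" "dist z s \<le> 3 * \<rho>" "d \<le> w s - u s" by (auto simp: T_def)
        have "s \<in> cball z (3 * \<rho>)" using s by (auto simp: T_def)
        then have us: "0 \<le> u s" using sub u_nonneg by blast
        have "dist z s \<noteq> \<rho>"
        proof
          assume e: "dist z s = \<rho>"
          then have "w s = m / E * E" unfolding w_def nq e using \<rho> by (simp add: E_def)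
          then have "w s = m" using E by simp
          moreover have "m \<le> u s" by (rule u) (use e in simp)
          ultimately show False using ds d by linarith
        qed
        moreover have "dist z s \<noteq> 3 * \<rho>"
        proof
          assume e: "dist z s = 3 * \<rho>"
          then have "w s = 0" unfolding w_def nq e using \<rho> by (simp add: power_mult_distrib)
          then show False using ds d us by linarith
        qed
        ultimately show "s \<in> D" using ds by (simp add: D_def)
      qed
      fix s assume "s \<in> D" "d \<le> w s - u s"
      then show "s \<in> T" by (auto simp: T_def D_def)
    qed
  qed
  moreover have "harnack_factor TYPE('n) * m \<le> w x"
  proof -
    have "(dist z x)\<^sup>2 \<le> (2 * \<rho>)\<^sup>2" using x \<rho> by (intro power_mono) auto
    then have "?N / \<rho>\<^sup>2 * ?q x \<le> ?N / \<rho>\<^sup>2 * (4 * \<rho>\<^sup>2)" unfolding nq by (intro mult_left_mono) (auto simp: power_mult_distrib)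
    then have "exp (- 4 * ?N) \<le> exp (- ?N / \<rho>\<^sup>2 * ?q x)" using \<rho> by simp
    then have "m / E * (exp (- 4 * ?N) - exp (- 9 * ?N)) \<le> w x" unfolding w_def using m E by (intro mult_left_mono) auto
    then show ?thesis by (simp add: harnack_factor_def E_def mult.commute)
  qed
  ultimately show ?thesis by linarith
qed

end

section \<open>The limit of the solutions\<close>

lemma transverse_norm_L2: "transverse_norm f x = L2_set (\<lambda>i. x $ i) (UNIV - {f})"
  by (simp add: transverse_norm_def L2_set_def)

lemma transverse_norm_nonneg: "0 \<le> transverse_norm f x"
  by (simp add: transverse_norm_L2)

lemma transverse_norm_triangle: "transverse_norm f (x + y) \<le> transverse_norm f x + transverse_norm f y"
  using L2_set_triangle_ineq[of "\<lambda>i. x $ i" "\<lambda>i. y $ i"] by (simp add: transverse_norm_L2)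

lemma transverse_norm_le_norm: "transverse_norm f x \<le> norm x"
proof -
  have "(\<Sum>i\<in>UNIV - {f}. (x $ i)\<^sup>2) \<le> (\<Sum>i\<in>UNIV. (x $ i)\<^sup>2)" by (rule sum_mono2) auto
  then show ?thesis by (simp add: transverse_norm_def norm_vec_def L2_set_def)
qed

lemma transverse_norm_lipschitz: "transverse_norm f x \<le> transverse_norm f y + norm (x - y)"
  using transverse_norm_triangle[of f y "x - y"] transverse_norm_le_norm[of f "x - y"] by simp

lemma component_le_transverse_norm: "i \<noteq> f \<Longrightarrow> \<bar>x $ i\<bar> \<le> transverse_norm f x"
  unfolding transverse_norm_L2
  using member_le_L2_set[of "UNIV - {f}" i "\<lambda>i. \<bar>x $ i\<bar>"] by (simp add: L2_set_def)

lemma transverse_norm_eq_0_iff: "transverse_norm f x = 0 \<longleftrightarrow> x \<in> axis_line f"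
  by (simp add: transverse_norm_L2 L2_set_eq_0_iff axis_line_def) auto

lemma continuous_transverse_norm: "continuous_on S (transverse_norm f)"
  unfolding transverse_norm_def[abs_def] by (intro continuous_intros)

lemma partial_eq_0:
  assumes "open S" "\<And>x. x \<in> S \<Longrightarrow> \<zeta> x = 0" "x \<in> S"
  shows "partial i \<zeta> x = 0"
proof -
  have "(\<zeta> has_derivative (\<lambda>_. 0)) (at x)"
    by (rule has_derivative_transform_within_open[OF has_derivative_const assms(1,3)]) (simp add: assms(2))
  then show ?thesis by (simp add: partial_eqI)
qed

lemma supp_outside:
  assumes "x \<notin> supp \<zeta>"
  shows "\<zeta> x = 0" "partial i \<zeta> x = 0" "laplacian \<zeta> x = 0"
proof -
  have op: "open (- supp \<zeta>)" unfolding supp_def by (intro open_Compl closed_closure)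
  have z: "\<zeta> x = 0" if "x \<in> - supp \<zeta>" for x
    using that closure_subset[of "{x. \<zeta> x \<noteq> 0}"] by (auto simp: supp_def)
  then show "\<zeta> x = 0" using assms by simp
  have p: "partial i \<zeta> x = 0" if "x \<in> - supp \<zeta>" for x i using partial_eq_0[OF op z that] .
  then show "partial i \<zeta> x = 0" using assms by simp
  have "partial i (partial i \<zeta>) x = 0" for i
    by (rule partial_eq_0[OF op]) (use p assms in auto)
  then show "laplacian \<zeta> x = 0" by (simp add: laplacian_def)
qed

lemma C2_continuous:
  assumes "C2 \<zeta>"
  shows "continuous_on S \<zeta>" "continuous_on S (laplacian \<zeta>)"
proof -
  show "continuous_on S \<zeta>"
    using assms differentiable_imp_continuous_on continuous_on_subset unfolding C2_def by blast
  have "continuous_on UNIV (laplacian \<zeta>)"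
    using assms unfolding C2_def laplacian_def[abs_def] by (intro continuous_on_sum) auto
  then show "continuous_on S (laplacian \<zeta>)" using continuous_on_subset by blast
qed

lemma continuous_bump_mean:
  fixes w :: "real ^ 'n::finite \<Rightarrow> real"
  assumes w: "loc_integrable w" and l: "0 < l"
  shows "continuous_on UNIV (\<lambda>x. bump_mean w x l)"
  unfolding continuous_on_sequentially
proof (intro ballI allI impI)
  fix c :: "real ^ 'n" and X :: "nat \<Rightarrow> real ^ 'n" assume "(\<forall>k. X k \<in> UNIV) \<and> X \<longlonglongrightarrow> c"
  then have X: "X \<longlonglongrightarrow> c" by simp
  obtain R where R: "\<And>k. norm (X k) \<le> R"
    using convergent_imp_Bseq[OF convergentI[OF X]] unfolding Bseq_def by auto
  have dom: "integrable lborel (\<lambda>x. \<bar>indicator (cball 0 (R + l)) x * w x\<bar> * (1 / l ^ CARD('n)))"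
    using w unfolding loc_integrable_def by (intro integrable_mult_left integrable_abs) auto
  have "(\<lambda>k. LINT x|lborel. w x * bump_kernel (X k) l x) \<longlonglongrightarrow> (LINT x|lborel. w x * bump_kernel c l x)"
  proof (rule integral_dominated_convergence[OF _ _ dom])
    show "(\<lambda>x. w x * bump_kernel c l x) \<in> borel_measurable lborel"
      "(\<lambda>x. w x * bump_kernel (X k) l x) \<in> borel_measurable lborel" for k
      by (rule borel_measurable_integrable[OF loc_integrable_bump(1)[OF w]]; use l in simp)+
    have "(\<lambda>k. w x * bump_kernel (X k) l x) \<longlonglongrightarrow> w x * bump_kernel c l x" for x
      unfolding bump_kernel_def using l by (intro tendsto_intros X) auto
    then show "AE x in lborel. (\<lambda>k. w x * bump_kernel (X k) l x) \<longlonglongrightarrow> w x * bump_kernel c l x" by simp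
    have "norm (w x * bump_kernel (X k) l x) \<le> \<bar>indicator (cball 0 (R + l)) x * w x\<bar> * (1 / l ^ CARD('n))" for k x
    proof (cases "x \<in> ball (X k) l")
      case True
      have "norm x \<le> norm (X k) + norm (x - X k)" using norm_triangle_ineq[of "X k" "x - X k"] by simp
      then have "norm x \<le> R + l" using True R[of k] by (simp add: dist_norm norm_minus_commute)
      moreover have "\<bar>bump_kernel (X k) l x\<bar> \<le> 1 / l ^ CARD('n)"
        using bump_kernel_le[OF l, of "X k" x] bump_kernel_nonneg[of l "X k" x] l by simp
      ultimately show ?thesis
        using mult_left_mono[of "\<bar>bump_kernel (X k) l x\<bar>" "1 / l ^ CARD('n)" "\<bar>w x\<bar>"] by (simp add: abs_mult)
    next
      case False
      then show ?thesis using bump_outside(5)[OF _ False] l by simp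
    qed
    then show "AE x in lborel. norm (w x * bump_kernel (X k) l x) \<le> \<bar>indicator (cball 0 (R + l)) x * w x\<bar> * (1 / l ^ CARD('n))" for k
      by simp
  qed
  then show "((\<lambda>x. bump_mean w x l) \<circ> X) \<longlonglongrightarrow> bump_mean w c l" by (simp add: bump_mean_def comp_def)
qed

section \<open>Monotone limit and its boundary values off the line\<close>

locale fading_absorption =
  fixes f n :: "'n::finite" and a :: "real ^ 'n" and p :: real and \<omega> :: "real \<Rightarrow> real"
    and K :: "nat \<Rightarrow> real" and u :: "nat \<Rightarrow> real ^ 'n \<Rightarrow> real" and g :: "real ^ 'n \<Rightarrow> real"
  assumes g_def: "g = (\<lambda>x. h_weight \<omega> (transverse_norm f x))"
    and N: "2 \<le> CARD('n)" and fn: "f \<noteq> n" and aL: "a \<in> axis_line f"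
    and p: "1 < p" "p < 1 + 2 / (real CARD('n) - 1)"
    and \<omega>_cont: "continuous_on {0<..} \<omega>" and \<omega>_pos: "\<forall>s>0. 0 < \<omega> s"
    and mu_anti: "antimono_on {0<..} (mu \<omega>)"
    and K_pos: "\<forall>j. 0 < K j" and K_mono: "mono K"
    and sols: "\<forall>j. dirac_boundary_solution n g p (K j) a (u j)"
begin

abbreviation \<Omega> where "\<Omega> \<equiv> half_space n"
abbreviation tn where "tn \<equiv> transverse_norm f"

lemma tn_pos: "x \<in> \<Omega> \<Longrightarrow> 0 < tn x"
  using component_le_transverse_norm[of n f x] fn by (auto simp: half_space_def)

lemma a_n: "a $ n = 0"
  using aL fn by (auto simp: axis_line_def)

lemma g_eq: "g x = exp (- mu \<omega> (tn x))"
  by (simp add: g_def h_weight_def mu_def)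

lemma mu_mono: "\<lbrakk>0 < s; s \<le> t\<rbrakk> \<Longrightarrow> mu \<omega> t \<le> mu \<omega> s"
  using mu_anti by (auto simp: monotone_on_def)

lemma mu_pos: "0 < s \<Longrightarrow> 0 < mu \<omega> s"
  using \<omega>_pos by (simp add: mu_def)

lemma g_ge: "\<lbrakk>0 < s; s \<le> tn x\<rbrakk> \<Longrightarrow> exp (- mu \<omega> s) \<le> g x"
  using mu_mono[of s "tn x"] by (simp add: g_eq)

lemma g_le: "\<lbrakk>x \<in> \<Omega>; tn x \<le> s\<rbrakk> \<Longrightarrow> g x \<le> exp (- mu \<omega> s)"
  using mu_mono[OF tn_pos] by (simp add: g_eq)

lemma g_cont: "continuous_on \<Omega> g"
proof -
  have "continuous_on {0<..} (mu \<omega>)" unfolding mu_def[abs_def]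
    by (intro continuous_intros \<omega>_cont) auto
  then have "continuous_on \<Omega> (\<lambda>x. mu \<omega> (tn x))"
    by (rule continuous_on_compose2) (use tn_pos continuous_transverse_norm in auto)
  then show ?thesis unfolding g_eq[abs_def] by (intro continuous_intros)
qed

lemma dirac: "dirac_solution n g p (K j) a (u j)"
proof
  show "dirac_boundary_solution n g p (K j) a (u j)" using sols by simp
  show "0 < K j" using K_pos by simp
  show "0 < g x" for x by (simp add: g_eq)
  show "g x \<le> 1" if "x \<in> \<Omega>" for x using mu_pos[OF tn_pos[OF that]] by (simp add: g_eq)
qed (use g_cont a_n p N in auto)

lemma u_mono: "\<lbrakk>i \<le> j; x \<in> \<Omega>\<rbrakk> \<Longrightarrow> u i x \<le> u j x"
  using dirac_solution_mono[OF dirac dirac] K_mono by (simp add: monoD)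

lemma u_nonneg: "x \<in> \<Omega> \<Longrightarrow> 0 \<le> u j x"
  using dirac_solution.u_nonneg[OF dirac] .

lemma u_cont: "continuous_on \<Omega> (u j)"
  using dirac_solution.u_cont[OF dirac] .

text \<open>The radius is half the distance to the line: on that ball the absorption has a lower
  bound depending only on \<open>y\<close>, and \<open>a\<close> is at least two radii away. One
  bound thus serves all \<open>u j\<close>.\<close>

definition ubound :: "real ^ 'n \<Rightarrow> real" where
  "ubound y = keller_osserman_bound CARD('n) p (exp (- mu \<omega> (tn y / 2))) (tn y / 2)"

lemma tn_dist_a: "tn y \<le> norm (y - a)"
  using transverse_norm_lipschitz[of f y a] aL by (simp add: transverse_norm_eq_0_iff[symmetric])

lemma u_le_ubound:
  assumes y: "0 < tn y" and x: "x \<in> ball y (tn y / 4)" "x \<in> \<Omega>"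
  shows "u j x \<le> ubound y"
  unfolding ubound_def
proof (rule dirac_solution.keller_osserman[OF dirac])
  show "2 * (tn y / 2) \<le> norm (y - a)" using tn_dist_a by simp
  fix z assume "z \<in> ball y (tn y / 2)"
  then have "tn y / 2 \<le> tn z" using transverse_norm_lipschitz[of f y z] by (simp add: dist_norm)
  then show "exp (- mu \<omega> (tn y / 2)) \<le> g z" using y by (intro g_ge) auto
qed (use y x in auto)

definition u_lim :: "real ^ 'n \<Rightarrow> real" where "u_lim x = lim (\<lambda>j. u j x)"

lemma u_convergent:
  assumes x: "x \<in> \<Omega>"
  shows "convergent (\<lambda>j. u j x)"
proof (rule Bseq_mono_convergent)
  have "\<bar>u j x\<bar> \<le> ubound x" for j
    using u_le_ubound[OF tn_pos[OF x], of x j] tn_pos[OF x] u_nonneg[OF x, of j] x by simp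
  then show "Bseq (\<lambda>j. u j x)" by (intro BseqI') auto
  show "\<forall>m n. m \<le> n \<longrightarrow> u m x \<le> u n x" using u_mono x by blast
qed

lemma u_tendsto: "x \<in> \<Omega> \<Longrightarrow> (\<lambda>j. u j x) \<longlonglongrightarrow> u_lim x"
  using u_convergent by (simp add: u_lim_def convergent_LIMSEQ_iff)

lemma u_le_lim: "x \<in> \<Omega> \<Longrightarrow> u j x \<le> u_lim x"
  using u_tendsto[of x] u_mono[OF _, of _ _ x] by (intro incseq_le) (auto simp: incseq_def)

lemma u_lim_nonneg: "x \<in> \<Omega> \<Longrightarrow> 0 \<le> u_lim x"
  using u_nonneg u_le_lim order_trans by blast

lemma u_lim_le_ubound: "\<lbrakk>0 < tn y; x \<in> ball y (tn y / 4); x \<in> \<Omega>\<rbrakk> \<Longrightarrow> u_lim x \<le> ubound y"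
  by (rule LIMSEQ_le_const2[OF u_tendsto]) (use u_le_ubound in auto)

text \<open>By \<open>weak_laplacian_mean_error\<close> the normalised means of all
  \<open>u j\<close> differ from the values at the centre by a multiple of \<open>l\<^sup>2\<close>,
  uniformly in \<open>j\<close> and in the centre. This passes to the limit, which is thereby a
  locally uniform limit of its continuous means.\<close>

lemma u_lim_cont: "continuous_on \<Omega> u_lim"
proof (rule continuous_at_imp_continuous_on, rule ballI)
  fix y assume y: "y \<in> \<Omega>"
  let ?M = "bump_mass TYPE('n)"
  obtain e where e: "0 < e" "cball y e \<subseteq> \<Omega>" using open_half_space y open_contains_cball by blast
  \<comment> \<open>\<open>cball y (2 * l0)\<close> lies in the half-space and where
    \<open>ubound y\<close> is valid; balls of radius less than \<open>l0\<close> about centres in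
    \<open>ball y l0\<close> stay inside it.\<close>
  define l0 where "l0 = min e (tn y / 8) / 2"
  have l0: "0 < l0" using e tn_pos[OF y] by (simp add: l0_def)
  define S where "S = cball y (2 * l0)"
  have "S \<subseteq> cball y e" unfolding S_def by (intro subset_cball) (simp add: l0_def)
  then have SO: "S \<subseteq> \<Omega>" using e by blast
  have Sb: "x \<in> ball y (tn y / 4)" if "x \<in> S" for x
    using that tn_pos[OF y] by (auto simp: S_def l0_def)
  define B where "B = ubound y powr p"
  have uB: "0 \<le> u j x" "u j x \<le> ubound y" if "x \<in> S" for x j
    using u_nonneg u_le_ubound[OF tn_pos[OF y] Sb[OF that]] SO that by auto
  have FB: "\<bar>g x * u j x powr p\<bar> \<le> B" if "x \<in> S" for x j
  proof -
    have "x \<in> \<Omega>" using SO that by blast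
    then have "0 < g x" "g x \<le> 1" using dirac_solution.g_pos[OF dirac] dirac_solution.g_le[OF dirac] by auto
    moreover have "u j x powr p \<le> B" unfolding B_def using uB[OF that] p by (intro powr_mono2) auto
    ultimately have "g x * u j x powr p \<le> 1 * B" by (intro mult_mono) auto
    then show ?thesis using \<open>0 < g x\<close> by simp
  qed
  define w where "w x = indicator S x * u_lim x" for x
  have m1: "(\<lambda>x. indicator S x * u j x) \<in> borel_measurable borel" for j
    unfolding real_scaleR_def[symmetric]
    by (rule borel_measurable_continuous_on_indicator[OF _ continuous_on_subset[OF u_cont SO]]) (simp add: S_def)
  have lim1: "(\<lambda>j. indicator S x * u j x) \<longlonglongrightarrow> w x" for x
    unfolding w_def using u_tendsto[of x] SO by (cases "x \<in> S") auto
  have m2: "w \<in> borel_measurable borel" by (rule borel_measurable_LIMSEQ_real[OF lim1 m1])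
  have wb: "\<bar>w x\<bar> \<le> ubound y" for x
  proof (cases "x \<in> S")
    case True
    then have "x \<in> \<Omega>" using SO by blast
    then show ?thesis using u_lim_nonneg u_lim_le_ubound[OF tn_pos[OF y] Sb[OF True]] True by (simp add: w_def)
  next
    case False
    have "0 \<le> ubound y" using uB[of y 0] l0 by (simp add: S_def)
    then show ?thesis using False by (simp add: w_def)
  qed
  have lw: "loc_integrable w" unfolding loc_integrable_def
  proof
    fix R
    have [measurable]: "w \<in> borel_measurable borel" by (rule m2)
    show "integrable lborel (\<lambda>x. indicator (cball 0 R) x * w x)"
    proof (rule integrable_bounded_support[of _ "ubound y" S])
      show "\<bar>indicator (cball 0 R) x * w x\<bar> \<le> ubound y" for x
        using wb[of x] by (auto simp: indicator_def intro: order_trans[OF abs_ge_zero])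
      show "(\<lambda>x. indicator (cball 0 R) x * w x) \<in> borel_measurable borel"
        by (intro borel_measurable_times borel_measurable_indicator m2) auto
    qed (auto simp: S_def w_def)
  qed
  have err: "\<bar>bump_mean w x l - ?M * u_lim x\<bar> \<le> ?M * B * l\<^sup>2" if x: "x \<in> ball y l0" and l: "0 < l" "l < l0" for x l
  proof -
    have sub: "cball x l \<subseteq> S"
    proof
      fix z assume "z \<in> cball x l"
      then show "z \<in> S" using x l dist_triangle[of y z x] by (simp add: S_def)
    qed
    then have sub': "cball x l \<subseteq> \<Omega>" using SO by blast
    have xO: "x \<in> \<Omega>" using sub' l by auto
    have ej: "\<bar>bump_mean (\<lambda>z. indicator S z * u j z) x l - ?M * u j x\<bar> \<le> ?M * B * l\<^sup>2" for j
    proof -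
      have "indicator S z * u j z * bump_kernel x l z = indicator (cball x l) z * u j z * bump_kernel x l z" for z
        using sub bump_outside(5)[of l z x] l by (cases "z \<in> cball x l") (auto simp: indicator_def)
      then have "bump_mean (\<lambda>z. indicator S z * u j z) x l = bump_mean (\<lambda>z. indicator (cball x l) z * u j z) x l"
        by (simp only: bump_mean_def)
      moreover have "\<bar>bump_mean (\<lambda>z. indicator (cball x l) z * u j z) x l - ?M * u j x\<bar> \<le> ?M * B * l\<^sup>2"
        by (rule weak_laplacian_mean_error[OF dirac_solution.weak_laplacian_u[OF dirac] l(1) sub'])
           (use FB sub in blast)
      ultimately show ?thesis by (simp only:)
    qed
    have "(\<lambda>j. LINT z|lborel. indicator S z * u j z * bump_kernel x l z) \<longlonglongrightarrow> (LINT z|lborel. w z * bump_kernel x l z)"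
    proof (rule integral_dominated_convergence)
      show "integrable lborel (\<lambda>z. ubound y * bump_kernel x l z)"
        by (rule loc_integrable_bump(1)[OF loc_integrable_const]) (use l in simp)
      show "(\<lambda>z. w z * bump_kernel x l z) \<in> borel_measurable lborel" using m2 by simp
      show "(\<lambda>z. indicator S z * u j z * bump_kernel x l z) \<in> borel_measurable lborel" for j using m1[of j] by simp
      show "AE z in lborel. (\<lambda>j. indicator S z * u j z * bump_kernel x l z) \<longlonglongrightarrow> w z * bump_kernel x l z"
        by (intro AE_I2 tendsto_mult_right lim1)
      show "AE z in lborel. norm (indicator S z * u j z * bump_kernel x l z) \<le> ubound y * bump_kernel x l z" for j
      proof (rule AE_I2)
        fix z
        have k0: "0 \<le> bump_kernel x l z" by (rule bump_kernel_nonneg) (use l in simp)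
        have "\<bar>indicator S z * u j z\<bar> \<le> ubound y"
          using uB[of z j] uB[of y j] l0 by (cases "z \<in> S") (auto simp: S_def)
        then have "\<bar>indicator S z * u j z\<bar> * bump_kernel x l z \<le> ubound y * bump_kernel x l z"
          using k0 by (rule mult_right_mono)
        then show "norm (indicator S z * u j z * bump_kernel x l z) \<le> ubound y * bump_kernel x l z"
          using k0 by (simp add: abs_mult)
      qed
    qed
    then have "(\<lambda>j. bump_mean (\<lambda>z. indicator S z * u j z) x l) \<longlonglongrightarrow> bump_mean w x l" by (simp add: bump_mean_def)
    then have "(\<lambda>j. \<bar>bump_mean (\<lambda>z. indicator S z * u j z) x l - ?M * u j x\<bar>) \<longlonglongrightarrow> \<bar>bump_mean w x l - ?M * u_lim x\<bar>"
      by (intro tendsto_intros u_tendsto xO)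
    then show ?thesis by (rule LIMSEQ_le_const2) (use ej in auto)
  qed
  have M: "0 < ?M" by (rule bump_mass_pos)
  have B0: "0 \<le> B" by (simp add: B_def)
  have "uniform_limit (ball y l0) (\<lambda>l x. bump_mean w x l / ?M) u_lim (at_right 0)"
  proof (rule uniform_limitI)
    fix d :: real assume d: "0 < d"
    define l1 where "l1 = min l0 (min 1 (d / (B + 1)))"
    have l1: "0 < l1" using l0 d B0 by (simp add: l1_def)
    have "\<forall>x\<in>ball y l0. dist (bump_mean w x l / ?M) (u_lim x) < d" if l: "0 < l" "l < l1" for l
    proof
      fix x assume x: "x \<in> ball y l0"
      have "bump_mean w x l / ?M - u_lim x = (bump_mean w x l - ?M * u_lim x) / ?M" using M by (simp add: diff_divide_distrib)
      then have "dist (bump_mean w x l / ?M) (u_lim x) = \<bar>bump_mean w x l - ?M * u_lim x\<bar> / ?M"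
        using M by (simp add: dist_real_def)
      also have "\<dots> \<le> (?M * B * l\<^sup>2) / ?M" using M err[OF x l(1)] l by (intro divide_right_mono) (auto simp: l1_def)
      also have "\<dots> = B * l\<^sup>2" using M by simp
      also have "\<dots> \<le> B * l" using B0 l power_decreasing[of 1 2 l] by (intro mult_left_mono) (auto simp: l1_def)
      also have "\<dots> < (B + 1) * l1" using B0 l by (intro mult_less_le_imp_less) auto
      also have "\<dots> \<le> d"
      proof -
        have "l1 \<le> d / (B + 1)" by (simp add: l1_def)
        then show ?thesis using B0 by (simp add: pos_le_divide_eq mult.commute)
      qed
      finally show "dist (bump_mean w x l / ?M) (u_lim x) < d" .
    qed
    then show "\<forall>\<^sub>F l in at_right 0. \<forall>x\<in>ball y l0. dist (bump_mean w x l / ?M) (u_lim x) < d"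
      unfolding eventually_at_right_field using l1 by blast
  qed
  moreover have "\<forall>\<^sub>F l in at_right 0. continuous_on (ball y l0) (\<lambda>x. bump_mean w x l / ?M)"
  proof -
    have "continuous_on (ball y l0) (\<lambda>x. bump_mean w x l / ?M)" if "0 < l" for l
      using continuous_on_subset[OF continuous_bump_mean[OF lw that], of "ball y l0"] M by (intro continuous_on_divide continuous_on_const) auto
    then show ?thesis unfolding eventually_at_right_field by (intro exI[of _ 1]) simp
  qed
  ultimately have "continuous_on (ball y l0) u_lim"
    by (intro uniform_limit_theorem) auto
  then show "isCont u_lim y" using l0 by (simp add: continuous_on_eq_continuous_at)
qed

text \<open>A test function supported in the open half-space is admissible in the boundary problem,
  with boundary term \<open>0\<close>. On its compact support the continuous limit bounds all
  \<open>u j\<close> and supplies the dominating function.\<close>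

lemma u_lim_interior: "interior_solution n g p u_lim"
  unfolding interior_solution_def
proof (intro conjI ballI allI impI)
  show "continuous_on \<Omega> u_lim" by (rule u_lim_cont)
  show "x \<in> \<Omega> \<Longrightarrow> 0 \<le> u_lim x" for x by (rule u_lim_nonneg)
  fix \<zeta> assume \<zeta>: "C2 \<zeta> \<and> compact (supp \<zeta>) \<and> supp \<zeta> \<subseteq> \<Omega>"
  then have SO: "supp \<zeta> \<subseteq> \<Omega>" and cS: "compact (supp \<zeta>)" by auto
  note c = C2_continuous[of \<zeta>]
  have j0: "(LINT x:\<Omega>|lborel. - u j x * laplacian \<zeta> x + g x * u j x powr p * \<zeta> x) = 0" for j
  proof -
    have fr: "\<zeta> x = 0" "partial n \<zeta> x = 0" if "x \<in> frontier \<Omega>" for x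
    proof -
      have "x \<notin> supp \<zeta>" using that SO unfolding frontier_half_space by (auto simp: half_space_def)
      then show "\<zeta> x = 0" "partial n \<zeta> x = 0" by (simp_all add: supp_outside)
    qed
    have "(LINT x:\<Omega>|lborel. - u j x * laplacian \<zeta> x + g x * u j x powr p * \<zeta> x) =
        (LINT y:frontier \<Omega>|(scale_measure (ennreal (K j)) (return borel a)). partial n \<zeta> y)"
      using dirac_solution.measure_sol[OF dirac, of j] \<zeta> fr(1) unfolding measure_boundary_solution_def by blast
    also have "\<dots> = (LINT y|(scale_measure (ennreal (K j)) (return borel a)). 0)"
      unfolding set_lebesgue_integral_def
      by (intro Bochner_Integration.integral_cong refl) (use fr(2) in \<open>auto simp: indicator_def\<close>)
    finally show ?thesis by simp
  qed
  define I where "I v x = indicator \<Omega> x *\<^sub>R (- v x * laplacian \<zeta> x + g x * v x powr p * \<zeta> x)" for v :: "real ^ 'n \<Rightarrow> real" and x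
  have Im: "I v \<in> borel_measurable lborel" if v: "continuous_on \<Omega> v" "\<And>x. x \<in> \<Omega> \<Longrightarrow> 0 \<le> v x" for v
  proof -
    have "I v \<in> borel_measurable borel" unfolding I_def[abs_def]
      by (intro borel_measurable_continuous_on_indicator half_space_measurable continuous_intros v(1) g_cont continuous_on_powr')
         (use c \<zeta> v p in auto)
    then show ?thesis by simp
  qed
  define G where "G x = indicator (supp \<zeta>) x *\<^sub>R (u_lim x * \<bar>laplacian \<zeta> x\<bar> + u_lim x powr p * \<bar>\<zeta> x\<bar>)" for x
  have Gi: "integrable lborel G" unfolding G_def[abs_def]
  proof (rule borel_integrable_compact[OF cS])
    have "continuous_on (supp \<zeta>) u_lim" by (rule continuous_on_subset[OF u_lim_cont SO])
    then show "continuous_on (supp \<zeta>) (\<lambda>x. u_lim x * \<bar>laplacian \<zeta> x\<bar> + u_lim x powr p * \<bar>\<zeta> x\<bar>)"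
      by (intro continuous_intros continuous_on_powr') (use c \<zeta> p u_lim_nonneg in auto)
  qed
  have "(\<lambda>j. LINT x|lborel. I (u j) x) \<longlonglongrightarrow> (LINT x|lborel. I u_lim x)"
  proof (rule integral_dominated_convergence[OF _ _ Gi])
    show "I u_lim \<in> borel_measurable lborel" by (rule Im[OF u_lim_cont u_lim_nonneg])
    show "I (u j) \<in> borel_measurable lborel" for j by (rule Im[OF u_cont u_nonneg])
    have "(\<lambda>j. I (u j) x) \<longlonglongrightarrow> I u_lim x" for x
    proof (cases "x \<in> \<Omega>")
      case True
      have "(\<lambda>j. u j x powr p) \<longlonglongrightarrow> u_lim x powr p"
        by (rule tendsto_powr'[OF u_tendsto[OF True] tendsto_const]) (use p u_nonneg[OF True] in auto)
      then show ?thesis unfolding I_def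
        by (intro tendsto_scaleR tendsto_add tendsto_mult tendsto_minus tendsto_const u_tendsto[OF True])
    qed (simp add: I_def)
    then show "AE x in lborel. (\<lambda>j. I (u j) x) \<longlonglongrightarrow> I u_lim x" by simp
    have "norm (I (u j) x) \<le> G x" for j x
    proof (cases "x \<in> supp \<zeta>")
      case True
      then have xO: "x \<in> \<Omega>" using SO by blast
      have u: "0 \<le> u j x" "u j x \<le> u_lim x" using u_nonneg u_le_lim xO by auto
      have gx: "0 < g x" "g x \<le> 1" using dirac_solution.g_pos[OF dirac] dirac_solution.g_le[OF dirac] xO by auto
      have "\<bar>- u j x * laplacian \<zeta> x + g x * u j x powr p * \<zeta> x\<bar>
          \<le> u j x * \<bar>laplacian \<zeta> x\<bar> + g x * u j x powr p * \<bar>\<zeta> x\<bar>"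
        using u gx by (intro order_trans[OF abs_triangle_ineq]) (simp add: abs_mult)
      also have "\<dots> \<le> u_lim x * \<bar>laplacian \<zeta> x\<bar> + 1 * u_lim x powr p * \<bar>\<zeta> x\<bar>"
        using u gx p by (intro add_mono mult_mono mult_right_mono powr_mono2) auto
      finally show ?thesis using xO True by (simp add: I_def G_def)
    next
      case False
      then show ?thesis by (simp add: I_def G_def supp_outside)
    qed
    then show "AE x in lborel. norm (I (u j) x) \<le> G x" for j by simp
  qed
  moreover have "(LINT x|lborel. I (u j) x) = 0" for j
    using j0[of j] by (simp add: I_def set_lebesgue_integral_def)
  ultimately have "(LINT x|lborel. I u_lim x) = 0" by (simp add: LIMSEQ_const_iff)
  then show "(LINT x:\<Omega>|lborel. - u_lim x * laplacian \<zeta> x + g x * u_lim x powr p * \<zeta> x) = 0"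
    by (simp add: I_def set_lebesgue_integral_def)
qed

lemma barrier_tendsto: "(barrier n M r y \<longlongrightarrow> 0) (at y within S)"
proof -
  have q: "(y - (y - axis n 1)) \<bullet> (y - (y - axis n 1 :: real ^ 'n)) = 1" by (simp add: inner_axis_axis)
  have "isCont (barrier n M r y) y"
    unfolding barrier_def[abs_def] by (intro continuous_intros) (use q in auto)
  then have "(barrier n M r y \<longlongrightarrow> barrier n M r y y) (at y)" by (simp add: isCont_def)
  moreover have "barrier n M r y y = 0" unfolding barrier_def q by simp
  ultimately show ?thesis using tendsto_within_subset by fastforce
qed

text \<open>Near a boundary point off the line \<open>ubound\<close> bounds all \<open>u j\<close>
  by one constant, so a single barrier lies above the whole sequence and its limit.\<close>

lemma u_lim_zero: "boundary_value_zero_on n (frontier \<Omega> - axis_line f) u_lim"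
  unfolding boundary_value_zero_on_def
proof
  fix y assume y: "y \<in> frontier \<Omega> - axis_line f"
  then have yn: "y $ n = 0" by (simp add: frontier_half_space)
  have ty: "0 < tn y" using y transverse_norm_eq_0_iff[of f y] transverse_norm_nonneg[of f y] by auto
  define r M where "r = tn y / 4" and "M = \<bar>ubound y\<bar> + 1"
  have r: "0 < r" using ty by (simp add: r_def)
  have le: "u_lim x \<le> barrier n M r y x" if x: "x \<in> ball y r" "x \<in> \<Omega>" for x
  proof (rule LIMSEQ_le_const2[OF u_tendsto[OF x(2)]], intro exI allI impI)
    fix j
    show "u j x \<le> barrier n M r y x"
    proof (rule dirac_solution.boundary_barrier[OF dirac yn r _ _ _ x])
      show "2 * r \<le> norm (y - a)" using tn_dist_a[of y] ty by (simp add: r_def)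
      show "0 < M" by (simp add: M_def)
      show "u j x \<le> M" if "x \<in> ball y r" "x \<in> \<Omega>" for x
        using u_le_ubound[OF ty, of x j] that by (simp add: M_def r_def)
    qed
  qed
  have "eventually (\<lambda>x. x \<in> ball y r \<and> x \<in> \<Omega>) (at y within \<Omega>)"
    using r unfolding eventually_at by (intro exI[of _ r]) (auto simp: dist_commute)
  then have ev: "eventually (\<lambda>x. 0 \<le> u_lim x) (at y within \<Omega>)" "eventually (\<lambda>x. u_lim x \<le> barrier n M r y x) (at y within \<Omega>)"
    by (auto elim!: eventually_mono intro: u_lim_nonneg le)
  show "(u_lim \<longlongrightarrow> 0) (at y within \<Omega>)"
    by (rule tendsto_sandwich[OF ev tendsto_const barrier_tendsto])
qed

end

section \<open>Propagation along the line\<close>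

lemma transverse_norm_scale: "transverse_norm f (c *\<^sub>R x) = \<bar>c\<bar> * transverse_norm f x"
  by (simp add: transverse_norm_def power_mult_distrib sum_distrib_left[symmetric] real_sqrt_mult)

lemma norm_minus_axis: "norm (x - axis f (x $ f)) = transverse_norm f x"
proof -
  have "(\<Sum>i\<in>UNIV. (norm ((x - axis f (x $ f)) $ i))\<^sup>2) = (\<Sum>i\<in>UNIV - {f}. (x $ i)\<^sup>2)"
    by (subst sum.remove[of _ f]) (auto simp: axis_def intro!: sum.cong)
  then show ?thesis by (simp add: norm_vec_def L2_set_def transverse_norm_def)
qed

context fading_absorption
begin

definition hf :: real where "hf = harnack_factor TYPE('n)"
definition hl :: real where "hl = harnack_level TYPE('n)"

lemma hf: "0 < hf" "hf < 1"
  using harnack_factor by (simp_all add: hf_def)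

lemma hl_pos: "0 < hl" by (simp add: hl_def harnack_level_def)

text \<open>The conditions on height and transverse distance are convex, so they hold along the
  segment from \<open>z\<close> to \<open>z'\<close>. After each step the value is smaller, which
  only relaxes the level condition of \<open>harnack_step\<close>.\<close>

lemma harnack_chain:
  assumes \<rho>: "0 < \<rho>" and z: "3 * \<rho> < z $ n" "tn z + 3 * \<rho> \<le> s" and z': "3 * \<rho> < z' $ n" "tn z' + 3 * \<rho> \<le> s"
    and m: "0 < m" "exp (- mu \<omega> s) * m powr (p - 1) * \<rho>\<^sup>2 \<le> hl"
    and u: "\<And>x. x \<in> cball z \<rho> \<Longrightarrow> m \<le> u j x" and k: "norm (z' - z) \<le> real k * \<rho>"
    and x: "x \<in> cball z' \<rho>"
  shows "hf ^ k * m \<le> u j x"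
proof (cases "k = 0")
  case True
  then show ?thesis using k x u by simp
next
  case False
  define c where "c i = z + (real i / real k) *\<^sub>R (z' - z)" for i
  have cn: "cball (c i) (3 * \<rho>) \<subseteq> \<Omega>" "\<And>y. y \<in> cball (c i) (3 * \<rho>) \<Longrightarrow> tn y \<le> s" if i: "i \<le> k" for i
  proof -
    define t where "t = real i / real k"
    have t: "0 \<le> t" "t \<le> 1" using i False by (auto simp: t_def)
    have ci: "c i = (1 - t) *\<^sub>R z + t *\<^sub>R z'" by (simp add: c_def t_def[symmetric] algebra_simps)
    have "(1 - t) * (z $ n) + t * (z' $ n) > 3 * \<rho>"
    proof -
      have "0 \<le> (1 - t) * (z $ n - 3 * \<rho>)" "0 \<le> t * (z' $ n - 3 * \<rho>)" using t z z' by auto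
      moreover have "0 < (1 - t) * (z $ n - 3 * \<rho>) \<or> 0 < t * (z' $ n - 3 * \<rho>)"
        using t z z' by (cases "t = 0") auto
      ultimately have "0 < (1 - t) * (z $ n - 3 * \<rho>) + t * (z' $ n - 3 * \<rho>)" by linarith
      then show ?thesis by (simp add: algebra_simps)
    qed
    then have n: "3 * \<rho> < c i $ n" by (simp add: ci)
    have "tn (c i) \<le> (1 - t) * tn z + t * tn z'"
      using transverse_norm_triangle[of f "(1 - t) *\<^sub>R z" "t *\<^sub>R z'"] t by (simp add: ci transverse_norm_scale)
    also have "\<dots> \<le> (1 - t) * (s - 3 * \<rho>) + t * (s - 3 * \<rho>)"
      using t z z' by (intro add_mono mult_left_mono) auto
    also have "\<dots> = s - 3 * \<rho>" by (simp add: algebra_simps)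
    finally have t': "tn (c i) \<le> s - 3 * \<rho>" .
    show "cball (c i) (3 * \<rho>) \<subseteq> \<Omega>"
    proof
      fix y assume "y \<in> cball (c i) (3 * \<rho>)"
      then have "\<bar>(c i - y) $ n\<bar> \<le> 3 * \<rho>"
        using component_le_norm_cart[of "c i - y" n] by (simp add: dist_norm)
      then show "y \<in> \<Omega>" using n by (simp add: half_space_def)
    qed
    show "tn y \<le> s" if "y \<in> cball (c i) (3 * \<rho>)" for y
      using transverse_norm_lipschitz[of f y "c i"] that t' by (simp add: dist_norm norm_minus_commute)
  qed
  have "\<forall>y\<in>cball (c i) \<rho>. hf ^ i * m \<le> u j y" if "i \<le> k" for i
    using that
  proof (induction i)
    case 0
    then show ?case using u by (simp add: c_def)
  next
    case (Suc i)
    show ?case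
    proof
      fix y assume y: "y \<in> cball (c (Suc i)) \<rho>"
      have "c (Suc i) - c i = (real (Suc i) / real k - real i / real k) *\<^sub>R (z' - z)"
        by (simp add: c_def scaleR_diff_left)
      also have "real (Suc i) / real k - real i / real k = 1 / real k" by (simp flip: diff_divide_distrib)
      finally have "norm (c (Suc i) - c i) = norm (z' - z) / real k" by simp
      also have "\<dots> \<le> \<rho>" using k False by (simp add: pos_divide_le_eq mult.commute)
      finally have "y \<in> cball (c i) (2 * \<rho>)"
        using y dist_triangle[of "c i" y "c (Suc i)"] by (simp add: dist_norm norm_minus_commute)
      have hfi: "0 < hf ^ i" "hf ^ i \<le> 1"
        using hf by (auto intro: power_le_one)
      have "hf * (hf ^ i * m) \<le> u j y"
      proof (rule dirac_solution.harnack_step[OF dirac \<rho> cn(1), folded hf_def hl_def])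
        show "i \<le> k" using Suc by simp
        show "y \<in> cball (c i) (2 * \<rho>)" by fact
        show "0 < hf ^ i * m" using hfi m by simp
        show "hf ^ i * m \<le> u j x" if "x \<in> cball (c i) \<rho>" for x using Suc that by simp
        show "g x \<le> exp (- mu \<omega> s)" if "x \<in> cball (c i) (3 * \<rho>)" for x
          using cn[of i] Suc that by (intro g_le) auto
        have "(hf ^ i * m) powr (p - 1) \<le> m powr (p - 1)"
          using hfi m p mult_right_mono[of "hf ^ i" 1 m] by (intro powr_mono2) auto
        then have "exp (- mu \<omega> s) * (hf ^ i * m) powr (p - 1) * \<rho>\<^sup>2 \<le> exp (- mu \<omega> s) * m powr (p - 1) * \<rho>\<^sup>2"
          by (intro mult_right_mono mult_left_mono) auto
        then show "exp (- mu \<omega> s) * (hf ^ i * m) powr (p - 1) * \<rho>\<^sup>2 \<le> hl" using m(2) by linarith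
      qed
      then show "hf ^ Suc i * m \<le> u j y" by simp
    qed
  qed
  from this[of k] x False show ?thesis by (simp add: c_def)
qed

text \<open>Written with \<open>powr\<close> to match the form of the limsup hypothesis.\<close>

definition rad :: "nat \<Rightarrow> real" where "rad j = 2 powr (- real j)"

lemma rad_pos: "0 < rad j" and rad_le: "rad j \<le> 1" and rad_Suc: "rad (Suc j) = rad j / 2"
proof -
  show "0 < rad j" by (simp add: rad_def)
  show "rad j \<le> 1" using powr_mono[of "- real j" 0 2] by (simp add: rad_def)
  have "2 powr (- real (Suc j)) = 2 powr (- real j) * 2 powr (- 1)" by (subst powr_add[symmetric]) (simp add: algebra_simps)
  then show "rad (Suc j) = rad j / 2" by (simp add: rad_def powr_minus)
qed

lemma rad_power: "rad j = (1 / 2) ^ j"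
  by (induction j) (simp_all add: rad_Suc, simp add: rad_def)

definition mur :: "nat \<Rightarrow> real" where "mur j = mu \<omega> (rad j)"

lemma mur_Suc: "mur j \<le> mur (Suc j)"
  unfolding mur_def by (rule mu_mono) (use rad_pos[of j] in \<open>auto simp: rad_Suc\<close>)

lemma mur_mono: "i \<le> j \<Longrightarrow> mur i \<le> mur j"
  using mur_Suc by (rule lift_Suc_mono_le)

text \<open>
  The largest value for which \<open>harnack_level\<close> permits steps of length \<open>1\<close>, hence all steps used, where the
  absorption coefficient is at most \<open>exp (- mur j)\<close>.
\<close>

definition lev :: "nat \<Rightarrow> real" where "lev j = (hl * exp (mur j)) powr (1 / (p - 1))"

lemma lev_pos: "0 < lev j" using hl_pos by (simp add: lev_def)

lemma lev_powr: "exp (- mur j) * lev j powr (p - 1) = hl"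
proof -
  have "lev j powr (p - 1) = hl * exp (mur j)" using p hl_pos by (simp add: lev_def powr_powr)
  then show ?thesis by (simp add: exp_minus)
qed

lemma lev_level: "\<rho> \<le> 1 \<Longrightarrow> 0 < \<rho> \<Longrightarrow> exp (- mu \<omega> (rad j)) * lev j powr (p - 1) * \<rho>\<^sup>2 \<le> hl"
  using lev_powr[of j] mult_left_mono[of "\<rho>\<^sup>2" 1 hl] hl_pos power_le_one[of \<rho> 2]
  by (simp add: mur_def)

lemma lev_mono: "i \<le> j \<Longrightarrow> lev i \<le> lev j"
  unfolding lev_def using mur_mono[of i j] hl_pos p by (intro powr_mono2) auto

definition top_pt :: "nat \<Rightarrow> real ^ 'n \<Rightarrow> real ^ 'n" where
  "top_pt j b = b + (rad j / 2) *\<^sub>R axis n 1"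

text \<open>
  Note the shift: the level of the radius \<open>rad j\<close> is attained at the smaller height \<open>rad (Suc j) / 2\<close>.
\<close>

definition reach :: "nat \<Rightarrow> real ^ 'n \<Rightarrow> bool" where
  "reach j b \<longleftrightarrow> (\<exists>i. \<forall>x\<in>cball (top_pt (Suc j) b) (rad (Suc j) / 8). lev j \<le> u i x)"

lemma on_line:
  assumes "b \<in> axis_line f"
  shows "b $ n = 0" "tn b = 0" "top_pt j b $ n = rad j / 2" "tn (top_pt j b) \<le> rad j / 2"
proof -
  show b: "b $ n = 0" using assms fn by (auto simp: axis_line_def)
  show t: "tn b = 0" using assms by (simp add: transverse_norm_eq_0_iff)
  show "top_pt j b $ n = rad j / 2" using b by (simp add: top_pt_def)
  show "tn (top_pt j b) \<le> rad j / 2"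
    using transverse_norm_lipschitz[of f "top_pt j b" b] t rad_pos[of j] by (simp add: top_pt_def)
qed

text \<open>The shift in \<open>reach\<close> makes the chain fit: it starts from the value
  \<open>lev (Suc j)\<close> and runs within distance \<open>rad (Suc j)\<close> of the line, where
  the absorption is at most \<open>exp (- mur (Suc j))\<close>, the coefficient to which this level
  belongs.\<close>

lemma reach_imp:
  assumes S: "reach (Suc j) b" and b: "b \<in> axis_line f" "b' \<in> axis_line f"
    and k: "norm (b' - b) \<le> (real k - 6) * (rad (Suc (Suc j)) / 8)" and le: "lev j \<le> hf ^ k * lev (Suc j)"
  shows "reach j b'"
proof -
  define r \<rho> where "r = rad (Suc (Suc j))" and "\<rho> = r / 8"
  have r: "0 < r" "r \<le> 1" "rad (Suc j) = 2 * r" using rad_pos rad_le rad_Suc[of "Suc j"] by (auto simp: r_def)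
  obtain i where i: "\<And>x. x \<in> cball (top_pt (Suc (Suc j)) b) \<rho> \<Longrightarrow> lev (Suc j) \<le> u i x"
    using S unfolding reach_def \<rho>_def r_def by blast
  have "lev j \<le> u i y" if y: "y \<in> cball (top_pt (Suc j) b') (rad (Suc j) / 8)" for y
  proof -
    have yd: "norm (y - top_pt (Suc j) b') \<le> r / 4" using y r by (simp add: dist_norm norm_minus_commute)
    have "\<bar>(y - top_pt (Suc j) b') $ n\<bar> \<le> r / 4"
      using component_le_norm_cart[of "y - top_pt (Suc j) b'" n] yd by linarith
    then have "r - r / 4 \<le> y $ n" unfolding abs_le_iff using on_line(3)[OF b(2), of "Suc j"] r by simp
    then have yn: "3 * \<rho> < y $ n" using r by (simp add: \<rho>_def)
    have ty: "tn y + 3 * \<rho> \<le> rad (Suc j)"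
      using transverse_norm_lipschitz[of f y "top_pt (Suc j) b'"] on_line(4)[OF b(2), of "Suc j"] yd r by (simp add: \<rho>_def)
    have "hf ^ k * lev (Suc j) \<le> u i y"
    proof (rule harnack_chain)
      show "0 < \<rho>" using r by (simp add: \<rho>_def)
      show "3 * \<rho> < top_pt (Suc (Suc j)) b $ n" "tn (top_pt (Suc (Suc j)) b) + 3 * \<rho> \<le> rad (Suc j)"
        using on_line(3,4)[OF b(1), of "Suc (Suc j)"] r unfolding r_def[symmetric] by (auto simp: \<rho>_def)
      show "3 * \<rho> < y $ n" "tn y + 3 * \<rho> \<le> rad (Suc j)" by fact+
      show "0 < lev (Suc j)" by (rule lev_pos)
      show "exp (- mu \<omega> (rad (Suc j))) * lev (Suc j) powr (p - 1) * \<rho>\<^sup>2 \<le> hl"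
        by (rule lev_level) (use r in \<open>auto simp: \<rho>_def\<close>)
      show "lev (Suc j) \<le> u i x" if "x \<in> cball (top_pt (Suc (Suc j)) b) \<rho>" for x by (rule i[OF that])
      show "y \<in> cball y \<rho>" using r by (simp add: \<rho>_def)
      \<comment> \<open>Six of the \<open>k\<close> steps are reserved:
        \<open>r / 2 = 4 * \<rho>\<close> for the change of height and
        \<open>r / 4 = 2 * \<rho>\<close> for the target ball.\<close>
      have e: "y - top_pt (Suc (Suc j)) b = (y - top_pt (Suc j) b') + (b' - b) + (r / 2) *\<^sub>R axis n 1"
        using r by (simp add: top_pt_def r_def[symmetric] algebra_simps flip: scaleR_left.add)
      have "norm (y - top_pt (Suc (Suc j)) b) \<le> norm (y - top_pt (Suc j) b') + norm (b' - b) + norm ((r / 2) *\<^sub>R (axis n 1 :: real ^ 'n))"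
        unfolding e
        using norm_triangle_ineq[of "(y - top_pt (Suc j) b') + (b' - b)" "(r / 2) *\<^sub>R (axis n 1 :: real ^ 'n)"]
          norm_triangle_ineq[of "y - top_pt (Suc j) b'" "b' - b"] by linarith
      also have "\<dots> \<le> r / 4 + (real k - 6) * \<rho> + r / 2"
        using yd k r by (intro add_mono) (auto simp: \<rho>_def r_def)
      also have "\<dots> = real k * \<rho>"
      proof -
        have "r = 8 * \<rho>" by (simp add: \<rho>_def)
        then show ?thesis by (simp add: algebra_simps)
      qed
      finally show "norm (y - top_pt (Suc (Suc j)) b) \<le> real k * \<rho>" .
    qed
    then show ?thesis using le by linarith
  qed
  then show ?thesis unfolding reach_def by blast
qed

end

section \<open>Growth of the levels and the walk along the line\<close>

locale propagating_absorption = fading_absorption f n a p \<omega> K u g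
  for f n :: "'n::finite" and a p \<omega> K u g +
  assumes \<omega>_mono: "mono_on {0<..} \<omega>"
    and mu_top: "filterlim (mu \<omega>) at_top (at_right 0)"
    and ratio: "limsup (\<lambda>j. ereal (mu \<omega> (2 powr (- real j + 1)) / mu \<omega> (2 powr (- real j)))) < 1"
    and dini: "(\<integral>\<^sup>+s\<in>{0<..<1}. ennreal (\<omega> s / s) \<partial>lborel) = \<infinity>"
    and K_top: "filterlim K at_top sequentially"
begin

lemma rad_tendsto: "rad \<longlonglongrightarrow> 0"
  unfolding rad_power[abs_def] by (rule LIMSEQ_power_zero) simp

lemma mur_top: "filterlim mur at_top sequentially"
proof -
  have "filterlim rad (at_right 0) sequentially"
    unfolding filterlim_at using rad_tendsto rad_pos by (auto intro!: always_eventually simp: less_imp_neq[symmetric])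
  from filterlim_compose[OF mu_top this] show ?thesis by (simp add: mur_def[abs_def])
qed

lemma mur_ratio: "\<exists>\<theta><1. 0 < \<theta> \<and> (\<exists>J. \<forall>j\<ge>J. mur j \<le> \<theta> * mur (Suc j))"
proof -
  obtain \<theta>' where \<theta>': "limsup (\<lambda>j. ereal (mu \<omega> (2 powr (- real j + 1)) / mu \<omega> (2 powr (- real j)))) < ereal \<theta>'" "\<theta>' < 1"
    using ereal_dense2[OF ratio] by (auto simp: one_ereal_def)
  \<comment> \<open>The maximum secures \<open>0 < \<theta>\<close>. The limsup bound is used at
    index \<open>Suc j\<close>, where it compares \<open>mur j\<close> with
    \<open>mur (Suc j)\<close>.\<close>
  define \<theta> where "\<theta> = max \<theta>' (1 / 2)"
  obtain J where J: "\<And>j. J \<le> j \<Longrightarrow> mu \<omega> (2 powr (- real j + 1)) / mu \<omega> (2 powr (- real j)) < \<theta>'"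
    using Limsup_lessD[OF \<theta>'(1)] by (auto simp: eventually_sequentially)
  have "mur j \<le> \<theta> * mur (Suc j)" if "J \<le> j" for j
  proof -
    have "- real (Suc j) + 1 = - real j" by simp
    then have "mur j / mur (Suc j) < \<theta>'" using J[of "Suc j"] that by (simp only: mur_def rad_def)
    then have "mur j / mur (Suc j) \<le> \<theta>" by (simp add: \<theta>_def)
    then show ?thesis using mu_pos[OF rad_pos[of "Suc j"]] by (simp add: mur_def pos_divide_le_eq)
  qed
  then show ?thesis using \<theta>' by (intro exI[of _ \<theta>]) (auto simp: \<theta>_def)
qed

definition \<theta> :: real where "\<theta> = (SOME \<theta>. \<theta> < 1 \<and> 0 < \<theta> \<and> (\<exists>J. \<forall>j\<ge>J. mur j \<le> \<theta> * mur (Suc j)))"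

lemma \<theta>: "\<theta> < 1" "0 < \<theta>" "\<exists>J. \<forall>j\<ge>J. mur j \<le> \<theta> * mur (Suc j)"
  using someI_ex[OF mur_ratio] by (auto simp: \<theta>_def)

text \<open>The gap is eventually at least \<open>(1 - \<theta>) * mur (Suc j)\<close>, and
  \<open>mur\<close> tends to infinity.\<close>

lemma mur_gap: "\<forall>\<^sub>F j in sequentially. C \<le> mur (Suc j) - mur j"
proof -
  have "\<forall>\<^sub>F j in sequentially. C / (1 - \<theta>) \<le> mur j"
    using mur_top unfolding filterlim_at_top by blast
  then have "\<forall>\<^sub>F j in sequentially. C / (1 - \<theta>) \<le> mur (Suc j)" by (rule eventually_compose_filterlim[OF _ filterlim_Suc])
  moreover have "\<forall>\<^sub>F j in sequentially. mur j \<le> \<theta> * mur (Suc j)"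
    using \<theta>(3) by (simp add: eventually_sequentially)
  ultimately show ?thesis
  proof eventually_elim
    case (elim j)
    then have "C \<le> (1 - \<theta>) * mur (Suc j)" using \<theta>(1) by (simp add: pos_divide_le_eq mult.commute)
    then show ?case using elim(2) by (simp add: algebra_simps)
  qed
qed

end

context propagating_absorption
begin

text \<open>The quotient of consecutive levels is
  \<open>exp ((mur (Suc j) - mur j) / (p - 1))\<close>; it pays for \<open>k\<close> factors
  \<open>hf\<close>.\<close>

lemma lev_ratio: "hf ^ k * lev (Suc j) \<ge> lev j" if "real k * (- ln hf) * (p - 1) \<le> mur (Suc j) - mur j"
proof -
  have l: "ln (lev i) = (ln hl + mur i) / (p - 1)" for i
    using hl_pos by (simp add: lev_def ln_powr ln_mult)
  have "ln (lev j) \<le> ln (hf ^ k * lev (Suc j))"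
  proof -
    have "(ln hl + mur j) / (p - 1) \<le> real k * ln hf + (ln hl + mur (Suc j)) / (p - 1)"
    proof -
      have "real k * (- ln hf) \<le> (mur (Suc j) - mur j) / (p - 1)" using that p by (simp add: pos_le_divide_eq)
      then show ?thesis by (simp add: diff_divide_distrib add_divide_distrib)
    qed
    then show ?thesis using hf lev_pos[of "Suc j"] by (simp add: ln_mult ln_realpow l)
  qed
  then show ?thesis using lev_pos hf by simp
qed

text \<open>Half of the budget \<open>(1 - \<theta>) * mur (Suc j)\<close> is spent on steps along
  the line, each of length \<open>rad (Suc j) / 16\<close> and cost
  \<open>(- ln hf) * (p - 1)\<close>; hence \<open>32 = 2 * 16\<close>.\<close>

definition speed :: real where "speed = (1 - \<theta>) / (32 * (- ln hf) * (p - 1))"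

lemma ln_hf: "0 < - ln hf" using hf by simp

lemma speed_pos: "0 < speed"
  unfolding speed_def using \<theta>(1) ln_hf p by (intro divide_pos_pos mult_pos_pos) auto

text \<open>The affordable number of steps is proportional to \<open>mur (Suc j)\<close> and their
  length to \<open>rad (Suc j)\<close>; the product of the two is
  \<open>\<omega> (rad (Suc j))\<close>.\<close>

lemma reach_step:
  "\<exists>J. \<forall>j\<ge>J. \<forall>b\<in>axis_line f. \<forall>b'\<in>axis_line f. reach (Suc j) b \<longrightarrow> norm (b' - b) \<le> speed * \<omega> (rad (Suc j)) \<longrightarrow> reach j b'"
proof -
  define \<Lambda> where "\<Lambda> = (- ln hf) * (p - 1)"
  have \<Lambda>: "0 < \<Lambda>" unfolding \<Lambda>_def using ln_hf p by (intro mult_pos_pos) auto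
  obtain J1 where J1: "\<And>j. J1 \<le> j \<Longrightarrow> mur j \<le> \<theta> * mur (Suc j)" using \<theta>(3) by blast
  \<comment> \<open>The other half of the budget covers seven more steps, six from
    \<open>reach_imp\<close> and one from rounding up, once \<open>mur\<close> is large.\<close>
  have "\<forall>\<^sub>F j in sequentially. 14 * \<Lambda> / (1 - \<theta>) \<le> mur j" using mur_top unfolding filterlim_at_top by blast
  then obtain J2 where J2: "\<And>j. J2 \<le> j \<Longrightarrow> 14 * \<Lambda> / (1 - \<theta>) \<le> mur j" by (auto simp: eventually_sequentially)
  show ?thesis
  proof (intro exI allI impI ballI)
    fix j b b' assume j: "max J1 J2 \<le> j" and b: "b \<in> axis_line f" "b' \<in> axis_line f" and S: "reach (Suc j) b"
      and d: "norm (b' - b) \<le> speed * \<omega> (rad (Suc j))"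
    define r \<rho> el k where "r = rad (Suc j)" and "\<rho> = rad (Suc (Suc j)) / 8" and "el = norm (b' - b)"
      and "k = nat \<lceil>el / \<rho>\<rceil> + 6"
    have r: "0 < r" "\<rho> = r / 16" using rad_pos rad_Suc[of "Suc j"] by (auto simp: r_def \<rho>_def)
    have rho: "0 < \<rho>" using r by simp
    have el: "0 \<le> el / \<rho>" using rho by (simp add: el_def)
    have k: "real k - 6 = real_of_int \<lceil>el / \<rho>\<rceil>" using el by (simp add: k_def)
    have k1: "el / \<rho> \<le> real k - 6" "real k \<le> el / \<rho> + 7"
      using k le_of_int_ceiling[of "el / \<rho>"] of_int_ceiling_le_add_one[of "el / \<rho>"] by linarith+
    show "reach j b'"
    proof (rule reach_imp[OF S b])
      show "norm (b' - b) \<le> (real k - 6) * (rad (Suc (Suc j)) / 8)"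
        using k1(1) rho unfolding el_def[symmetric] \<rho>_def[symmetric] by (simp add: pos_divide_le_eq)
      have "el / \<rho> * \<Lambda> \<le> (1 - \<theta>) * mur (Suc j) / 2"
      proof -
        have "\<omega> r = r * mur (Suc j)" using r by (simp add: mur_def mu_def r_def)
        then have "el \<le> speed * (r * mur (Suc j))" using d by (simp add: el_def r_def)
        also have "\<dots> = 16 * speed * mur (Suc j) * \<rho>" using r(2) by simp
        finally have "el / \<rho> \<le> 16 * speed * mur (Suc j)" using rho by (simp add: pos_divide_le_eq)
        then have "el / \<rho> * \<Lambda> \<le> 16 * speed * mur (Suc j) * \<Lambda>" using \<Lambda> by (intro mult_right_mono) auto
        also have "\<dots> = 16 * (speed * \<Lambda>) * mur (Suc j)" by simp
        also have "speed * \<Lambda> = (1 - \<theta>) / 32"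
        proof -
          have "speed = (1 - \<theta>) / (32 * \<Lambda>)" unfolding speed_def \<Lambda>_def by (simp only: mult.assoc)
          then show ?thesis using \<Lambda> by simp
        qed
        also have "16 * ((1 - \<theta>) / 32) * mur (Suc j) = (1 - \<theta>) * mur (Suc j) / 2" by simp
        finally show ?thesis .
      qed
      moreover have "7 * \<Lambda> \<le> (1 - \<theta>) * mur (Suc j) / 2"
        using J2[of "Suc j"] j \<theta>(1) by (simp add: pos_divide_le_eq mult.commute)
      moreover have "real k * \<Lambda> \<le> (el / \<rho> + 7) * \<Lambda>" using k1(2) \<Lambda> by (intro mult_right_mono) auto
      ultimately have "real k * \<Lambda> \<le> (1 - \<theta>) * mur (Suc j)"
        unfolding distrib_right by linarith
      also have "\<dots> \<le> mur (Suc j) - mur j" using J1[of j] j by (simp add: algebra_simps)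
      finally show "lev j \<le> hf ^ k * lev (Suc j)" by (intro lev_ratio) (simp add: \<Lambda>_def mult.assoc)
    qed
  qed
qed

text \<open>\<open>pole_lower_bound\<close> on the ball of radius \<open>rad (Suc j)\<close>, with a
  mass proportional to \<open>lev j\<close>, which some \<open>K i\<close> provides. There
  \<open>\<gamma> * \<kappa> powr (p - 1)\<close> is proportional to
  \<open>exp (mur j - mur (Suc j))\<close>, so \<open>mur_gap\<close> makes the correction
  small.\<close>

lemma reach_start: "\<forall>\<^sub>F j in sequentially. reach j a"
proof -
  let ?N = "CARD('n)"
  define \<beta> where "\<beta> = (real ?N - 1) * p - 1"
  have \<beta>: "0 < \<beta>" "\<beta> < real ?N"
    using dirac_solution.\<beta>[OF dirac] by (auto simp: \<beta>_def dirac_solution.\<beta>_def[OF dirac])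
  define C where "C = 10 powr (p - 1) * (3 / 8) powr (- \<beta>) / (\<beta> * (real ?N - \<beta>)) * hl"
  have C: "0 < C" using \<beta> hl_pos by (simp add: C_def)
  have "\<forall>\<^sub>F j in sequentially. ln (8 * C) \<le> mur (Suc j) - mur j" by (rule mur_gap)
  then show ?thesis
  proof eventually_elim
    case (elim j)
    define r where "r = rad (Suc j)"
    have r: "0 < r" "r \<le> 1" using rad_pos rad_le by (auto simp: r_def)
    \<comment> \<open>In units of \<open>\<kappa> * R\<close> the pole contributes at least
      \<open>9 / 40\<close> and the correction takes at most \<open>1 / 8\<close>; the factor
      \<open>10\<close> compensates the difference \<open>1 / 10\<close>.\<close>
    define \<kappa> \<gamma> where "\<kappa> = 10 * lev j" and "\<gamma> = exp (- mur (Suc j))"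
    have \<kappa>: "0 < \<kappa>" using lev_pos by (simp add: \<kappa>_def)
    have "8 * C = exp (ln (8 * C))" using C by simp
    also have "\<dots> \<le> exp (mur (Suc j) - mur j)" using elim by simp
    finally have "8 * C * exp (mur j - mur (Suc j)) \<le> exp (mur (Suc j) - mur j) * exp (mur j - mur (Suc j))"
      by (rule mult_right_mono) simp
    also have "\<dots> = 1" by (simp flip: exp_add)
    finally have C8: "8 * C * exp (mur j - mur (Suc j)) \<le> 1" .
    have "\<gamma> * \<kappa> powr (p - 1) * ((3 / 8) powr (- \<beta>) / (\<beta> * (real ?N - \<beta>))) = C * exp (mur j - mur (Suc j))"
    proof -
      have "lev j powr (p - 1) = hl * exp (mur j)" using p hl_pos by (simp add: lev_def powr_powr)
      then have "\<kappa> powr (p - 1) = 10 powr (p - 1) * (hl * exp (mur j))" by (simp add: \<kappa>_def powr_mult)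
      moreover have "exp (mur j - mur (Suc j)) = exp (mur j) * \<gamma>"
        unfolding \<gamma>_def by (simp flip: exp_add)
      ultimately show ?thesis by (simp add: C_def)
    qed
    then have small: "\<gamma> * \<kappa> powr (p - 1) * ((3 / 8) powr (- \<beta>) / (\<beta> * (real ?N - \<beta>))) \<le> 1 / 8" using C8 by simp
    have "\<forall>\<^sub>F i in sequentially. \<kappa> / pole_const TYPE('n) \<le> K i" using K_top unfolding filterlim_at_top by blast
    then obtain i where "\<kappa> / pole_const TYPE('n) \<le> K i" by (auto simp: eventually_sequentially)
    then have Ki: "\<kappa> \<le> pole_const TYPE('n) * K i"
      using pole_const_pos[where 'n='n] by (simp add: pos_divide_le_eq mult.commute)
    have "lev j \<le> u i x" if x: "x \<in> cball (top_pt (Suc j) a) (rad (Suc j) / 8)" for x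
    proof -
      have xd: "norm (x - top_pt (Suc j) a) \<le> r / 8" using x by (simp add: dist_norm norm_minus_commute r_def)
      have "\<bar>(x - top_pt (Suc j) a) $ n\<bar> \<le> r / 8"
        using component_le_norm_cart[of "x - top_pt (Suc j) a" n] xd by linarith
      then have xn: "3 * r / 8 \<le> x $ n"
        unfolding abs_le_iff using on_line(3)[OF aL, of "Suc j"] by (simp add: r_def)
      have "norm (x - a) \<le> norm (x - top_pt (Suc j) a) + norm (top_pt (Suc j) a - a)"
        using norm_triangle_ineq[of "x - top_pt (Suc j) a" "top_pt (Suc j) a - a"] by simp
      also have "norm (top_pt (Suc j) a - a) = r / 2" using r by (simp add: top_pt_def r_def)
      finally have na: "norm (x - a) \<le> 5 * r / 8" using xd by simp
      have xa: "x $ n \<le> norm (x - a)" using component_le_norm_cart[of "x - a" n] a_n by simp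
      define q where "q = norm (x - a)"
      have q: "0 < q" "3 * r / 8 \<le> q" "q \<le> 5 * r / 8" using xa xn na r by (auto simp: q_def)
      have xO: "x \<in> \<Omega>" using xn r by (simp add: half_space_def)
      have xr: "x \<in> ball a r" using na r by (simp add: dist_norm norm_minus_commute)
      have lo: "\<kappa> * (x $ n / q ^ ?N - x $ n / r ^ ?N)
        - \<gamma> * \<kappa> powr p / (\<beta> * (real ?N - \<beta>)) * (x $ n * q powr (- \<beta>)) \<le> u i x"
        unfolding q_def \<beta>_def dirac_solution.\<beta>_def[OF dirac[of i], symmetric]
      proof (rule dirac_solution.pole_lower_bound[OF dirac r(1) _ _ \<kappa> Ki xr xO])
        show "0 < \<gamma>" by (simp add: \<gamma>_def)
        show "g y \<le> \<gamma>" if "y \<in> ball a r" "y \<in> \<Omega>" for y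
        proof -
          have "tn y \<le> r" using tn_dist_a[of y] that(1) by (simp add: dist_norm norm_minus_commute)
          then show ?thesis using g_le[OF that(2)] by (simp add: \<gamma>_def mur_def r_def)
        qed
      qed
      define R where "R = r / r ^ ?N"
      have R: "1 \<le> R"
      proof -
        have "r ^ ?N \<le> r ^ 1" using r N by (intro power_decreasing) auto
        then show ?thesis using r by (simp add: R_def)
      qed
      \<comment> \<open>\<open>9 / 40 = 3 / 8 * (3 / 5)\<close>: the height is at least
        \<open>3 * r / 8\<close>, and \<open>q \<le> 5 * r / 8\<close> leaves
        \<open>8 / 5 - 1 = 3 / 5\<close> of \<open>1 / r ^ ?N\<close>.\<close>
      have "9 / 40 * R \<le> x $ n / q ^ ?N - x $ n / r ^ ?N"
      proof -
        have "q ^ ?N \<le> (5 * r / 8) ^ ?N" using q by (intro power_mono) auto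
        also have "\<dots> = (5 / 8) ^ ?N * r ^ ?N" by (simp add: power_mult_distrib power_divide)
        also have "\<dots> \<le> (5 / 8) ^ 1 * r ^ ?N" using r N by (intro mult_right_mono power_decreasing) auto
        finally have "1 / (5 / 8 * r ^ ?N) \<le> 1 / q ^ ?N" using q r by (intro divide_left_mono) auto
        then have "3 / 5 * (1 / r ^ ?N) \<le> 1 / q ^ ?N - 1 / r ^ ?N" by simp
        then have "3 * r / 8 * (3 / 5 * (1 / r ^ ?N)) \<le> x $ n * (1 / q ^ ?N - 1 / r ^ ?N)"
          using xn r by (intro mult_mono) auto
        then show ?thesis by (simp add: R_def right_diff_distrib)
      qed
      then have 1: "\<kappa> * (9 / 40 * R) \<le> \<kappa> * (x $ n / q ^ ?N - x $ n / r ^ ?N)" using \<kappa> by (intro mult_left_mono) auto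
      have "x $ n * q powr (- \<beta>) \<le> R * (3 / 8) powr (- \<beta>)"
      proof -
        have "q powr (- \<beta>) \<le> (3 / 8 * r) powr (- \<beta>)" using q r \<beta> by (intro powr_mono2') auto
        also have "\<dots> = (3 / 8) powr (- \<beta>) * r powr (- \<beta>)" by (rule powr_mult)
        also have "r powr (- \<beta>) \<le> r powr (- real ?N)" using r \<beta> by (intro powr_mono') auto
        also have "r powr (- real ?N) = 1 / r ^ ?N" using r by (simp add: powr_minus powr_realpow divide_inverse)
        finally have "x $ n * q powr (- \<beta>) \<le> r * ((3 / 8) powr (- \<beta>) * (1 / r ^ ?N))"
          using xa na xn r by (intro mult_mono) (auto simp: q_def)
        then show ?thesis by (simp add: R_def mult.commute)
      qed
      then have "\<gamma> * \<kappa> powr p / (\<beta> * (real ?N - \<beta>)) * (x $ n * q powr (- \<beta>))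
          \<le> \<gamma> * \<kappa> powr p / (\<beta> * (real ?N - \<beta>)) * (R * (3 / 8) powr (- \<beta>))"
        using \<beta> by (intro mult_left_mono) (auto simp: \<gamma>_def)
      also have "\<dots> = \<kappa> * R * (\<gamma> * \<kappa> powr (p - 1) * ((3 / 8) powr (- \<beta>) / (\<beta> * (real ?N - \<beta>))))"
      proof -
        have "\<kappa> powr p = \<kappa> * \<kappa> powr (p - 1)" using \<kappa> powr_add[of \<kappa> 1 "p - 1"] by simp
        then show ?thesis by simp
      qed
      also have "\<dots> \<le> \<kappa> * R * (1 / 8)" using small \<kappa> R by (intro mult_left_mono) auto
      finally have "\<kappa> * R * (1 / 10) \<le> u i x" using 1 lo by linarith
      moreover have "\<kappa> * 1 * (1 / 10) \<le> \<kappa> * R * (1 / 10)" using \<kappa> R by (intro mult_right_mono mult_left_mono) auto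
      ultimately show ?thesis by (simp add: \<kappa>_def)
    qed
    then show ?case unfolding reach_def by blast
  qed
qed

lemma dyadic_interval:
  assumes "0 < s" "s \<le> rad J"
  obtains j where "J \<le> j" "rad (Suc j) < s" "s \<le> rad j"
proof -
  have "\<forall>\<^sub>F i in sequentially. rad i < s" using order_tendstoD(2)[OF rad_tendsto assms(1)] .
  then obtain i where i: "rad (J + i) < s" using eventually_sequentially by (metis le_add2)
  define i0 where "i0 = (LEAST i. rad (J + i) < s)"
  have 1: "rad (J + i0) < s" unfolding i0_def by (rule LeastI[of _ i]) (rule i)
  have "i0 \<noteq> 0" using 1 assms(2) by (intro notI) simp
  then obtain k where k: "i0 = Suc k" by (cases i0) auto
  have "\<not> rad (J + k) < s"
    using not_less_Least[of k "\<lambda>i. rad (J + i) < s"] k by (simp add: i0_def)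
  then show thesis using that[of "J + k"] 1 k by simp
qed

text \<open>On the dyadic interval below \<open>rad i\<close> the integrand
  \<open>\<omega> s / s\<close> is at most \<open>\<omega> (rad i) / rad (Suc i)\<close>, and the
  interval has length \<open>rad (Suc i)\<close>. Bounded sums would thus make the Dini integral
  finite.\<close>

lemma omega_sum: "\<exists>d. C \<le> (\<Sum>i<d. \<omega> (rad (j + i)))"
proof (rule ccontr)
  assume "\<not> (\<exists>d. C \<le> (\<Sum>i<d. \<omega> (rad (j + i))))"
  then have b: "(\<Sum>i<d. \<omega> (rad (j + i))) \<le> C" for d by (meson linear)
  have \<omega>0: "0 \<le> \<omega> (rad i)" for i using \<omega>_pos rad_pos by (simp add: less_imp_le)
  have "summable (\<lambda>i. \<omega> (rad (j + i)))"
    by (rule summableI_nonneg_bounded[OF \<omega>0 b])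
  then have "summable (\<lambda>i. \<omega> (rad i))" using summable_iff_shift[of "\<lambda>i. \<omega> (rad i)" j] by (simp add: add.commute)
  then have fin: "(\<Sum>i. ennreal (\<omega> (rad i))) \<noteq> \<infinity>"
    using suminf_ennreal2[OF \<omega>0, of "\<lambda>i. i"] by simp
  define h where "h i s = ennreal (\<omega> (rad i) / rad (Suc i)) * indicator {rad (Suc i)<..rad i} s" for i s
  have "(\<integral>\<^sup>+s\<in>{0<..<1}. ennreal (\<omega> s / s) \<partial>lborel) \<le> (\<integral>\<^sup>+s. (\<Sum>i. h i s) \<partial>lborel)"
  proof (rule nn_integral_mono)
    fix s :: real
    show "ennreal (\<omega> s / s) * indicator {0<..<1} s \<le> (\<Sum>i. h i s)"
    proof (cases "s \<in> {0<..<1}")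
      case True
      then have s: "0 < s" "s \<le> rad 0" by (auto simp: rad_power)
      obtain i where i: "rad (Suc i) < s" "s \<le> rad i" using dyadic_interval[OF s] by blast
      have "\<omega> s \<le> \<omega> (rad i)" using \<omega>_mono s i rad_pos[of i] by (auto simp: monotone_on_def)
      then have "\<omega> s / s \<le> \<omega> (rad i) / rad (Suc i)" using \<omega>0 i rad_pos[of "Suc i"] by (intro frac_le) auto
      then have "ennreal (\<omega> s / s) * indicator {0<..<1} s \<le> h i s" using i True by (simp add: h_def ennreal_leI)
      also have "\<dots> \<le> (\<Sum>i. h i s)" using sum_le_suminf[of "\<lambda>i. h i s" "{i}"] by simp
      finally show ?thesis .
    qed simp
  qed
  also have "\<dots> = (\<Sum>i. \<integral>\<^sup>+s. h i s \<partial>lborel)"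
    unfolding h_def by (rule nn_integral_suminf) measurable
  also have "\<dots> = (\<Sum>i. ennreal (\<omega> (rad i)))"
  proof (intro suminf_cong)
    fix i
    have "(\<integral>\<^sup>+s. h i s \<partial>lborel) = ennreal (\<omega> (rad i) / rad (Suc i)) * ennreal (rad i - rad (Suc i))"
      unfolding h_def using rad_pos[of i] by (subst nn_integral_cmult_indicator) (auto simp: rad_Suc)
    also have "\<dots> = ennreal (\<omega> (rad i))"
      using \<omega>0 rad_pos[of i] by (simp add: rad_Suc flip: ennreal_mult')
    finally show "(\<integral>\<^sup>+s. h i s \<partial>lborel) = ennreal (\<omega> (rad i))" .
  qed
  finally have "(\<integral>\<^sup>+s\<in>{0<..<1}. ennreal (\<omega> s / s) \<partial>lborel) < \<infinity>"
    using fin by (simp add: less_top order_le_less_trans)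
  then show False using dini by simp
qed

text \<open>For given \<open>b\<close>, \<open>omega_sum\<close> supplies the number
  \<open>d\<close> of scales and \<open>reach_start\<close> the start above \<open>a\<close> at the
  scale \<open>j + d\<close>. On each scale the walk goes straight towards \<open>b\<close>, as far
  as \<open>reach_step\<close> allows.\<close>

lemma reach_all: "\<exists>J. \<forall>j\<ge>J. \<forall>b\<in>axis_line f. reach j b"
proof -
  obtain J1 where J1: "\<And>j b b'. \<lbrakk>J1 \<le> j; b \<in> axis_line f; b' \<in> axis_line f; reach (Suc j) b;
      norm (b' - b) \<le> speed * \<omega> (rad (Suc j))\<rbrakk> \<Longrightarrow> reach j b'"
    using reach_step by blast
  obtain J2 where J2: "\<And>j. J2 \<le> j \<Longrightarrow> reach j a" using reach_start by (auto simp: eventually_sequentially)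
  have \<omega>0: "0 < speed * \<omega> (rad i)" for i using \<omega>_pos rad_pos speed_pos by simp
  have walk: "reach j b'" if "J1 \<le> j" "reach (j + d) b" "b \<in> axis_line f" "b' \<in> axis_line f"
    "norm (b' - b) \<le> speed * (\<Sum>i<d. \<omega> (rad (Suc j + i)))" for j d b b'
    using that
  proof (induction d arbitrary: b)
    case 0
    then show ?case by simp
  next
    case (Suc d)
    define la el where "la = speed * \<omega> (rad (Suc (j + d)))" and "el = norm (b' - b)"
    \<comment> \<open>The fraction of the remaining way covered on the current scale: all of it, if
      the allowed distance suffices.\<close>
    define s where "s = (if el \<le> la then 1 else la / el)"
    have la: "0 < la" by (simp add: la_def \<omega>0)
    have s: "0 \<le> s" "s \<le> 1" "s * el \<le> la" "(1 - s) * el \<le> max 0 (el - la)"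
      using la by (auto simp: s_def divide_simps left_diff_distrib)
    define b2 where "b2 = b + s *\<^sub>R (b' - b)"
    have b2: "b2 \<in> axis_line f" using Suc.prems(3,4) by (simp add: b2_def axis_line_def)
    have "norm (b2 - b) \<le> la" using s by (simp add: b2_def el_def)
    then have r2: "reach (j + d) b2"
      using Suc.prems b2 by (intro J1[of "j + d" b]) (auto simp: la_def)
    have "b' - b2 = (1 - s) *\<^sub>R (b' - b)" by (simp add: b2_def algebra_simps)
    then have "norm (b' - b2) = (1 - s) * el" using s by (simp add: el_def)
    also have "\<dots> \<le> max 0 (el - la)" by (rule s(4))
    also have "\<dots> \<le> speed * (\<Sum>i<d. \<omega> (rad (Suc j + i)))"
    proof -
      have "0 \<le> speed * (\<Sum>i<d. \<omega> (rad (Suc j + i)))"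
        using speed_pos \<omega>_pos rad_pos by (intro mult_nonneg_nonneg sum_nonneg) (auto simp: less_imp_le)
      moreover have "el \<le> speed * (\<Sum>i<d. \<omega> (rad (Suc j + i))) + la"
        using Suc.prems(5) by (simp add: el_def la_def distrib_left)
      ultimately show ?thesis by simp
    qed
    finally show ?case using Suc.IH[OF Suc.prems(1) r2 b2 Suc.prems(4)] by blast
  qed
  show ?thesis
  proof (intro exI allI impI ballI)
    fix j b assume j: "max J1 J2 \<le> j" and b: "b \<in> axis_line f"
    obtain d where "norm (b - a) / speed \<le> (\<Sum>i<d. \<omega> (rad (Suc j + i)))" using omega_sum by blast
    then have d: "norm (b - a) \<le> speed * (\<Sum>i<d. \<omega> (rad (Suc j + i)))"
      using speed_pos by (simp add: pos_divide_le_eq mult.commute)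
    show "reach j b" using walk[OF _ J2 aL b d] j by simp
  qed
qed

end

section \<open>Infinite boundary values on the line\<close>

context propagating_absorption
begin

text \<open>The scale is adapted to the point: \<open>tn x\<close> is comparable to the height of
  the point \<open>top_pt\<close> above the projection of \<open>x\<close> to the line. In the wedge
  the chain from there to \<open>x\<close> can use steps proportional to
  \<open>\<kappa> * tn x\<close>, so their number depends on \<open>\<kappa>\<close> only, and the
  level at the finer scale is at least \<open>lev j\<close>.\<close>

lemma wedge_lower:
  assumes \<kappa>: "0 < \<kappa>" "\<kappa> \<le> 1"
  shows "\<exists>J k. \<forall>j\<ge>J. \<forall>x\<in>\<Omega>. tn x \<le> rad (Suc j) / 2 \<longrightarrow> \<kappa> * tn x \<le> x $ n \<longrightarrow> hf ^ k * lev j \<le> u_lim x"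
proof -
  obtain J where J: "\<And>j b. \<lbrakk>J \<le> j; b \<in> axis_line f\<rbrakk> \<Longrightarrow> reach j b" using reach_all by blast
  \<comment> \<open>The steps will be \<open>\<rho> = \<kappa> * tn x / 4\<close>, and the distance
    at most \<open>3 * tn x = 12 / \<kappa> * \<rho>\<close>.\<close>
  define k where "k = nat \<lceil>12 / \<kappa>\<rceil>"
  have k: "12 / \<kappa> \<le> real k" by (simp add: k_def real_nat_ceiling_ge)
  show ?thesis
  proof (rule exI[of _ J], rule exI[of _ k], intro allI impI ballI)
    fix j x assume j: "J \<le> j" and x: "x \<in> \<Omega>" "tn x \<le> rad (Suc j) / 2" "\<kappa> * tn x \<le> x $ n"
    define t where "t = tn x"
    have t: "0 < t" using tn_pos[OF x(1)] by (simp add: t_def)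
    have "0 < 2 * t" "2 * t \<le> rad (Suc j)" using x t by (auto simp: t_def)
    then obtain j' where j': "Suc j \<le> j'" "rad (Suc j') < 2 * t" "2 * t \<le> rad j'" using dyadic_interval by blast
    then obtain i0 where i0: "j' = Suc i0" "j \<le> i0" by (cases j') auto
    define r \<rho> b where "r = rad (Suc i0)" and "\<rho> = \<kappa> * t / 4" and "b = axis f (x $ f)"
    have r: "r / 4 < t" "t \<le> r / 2" "0 < r" "rad i0 = 2 * r" "r \<le> 1"
      using j' i0 rad_Suc[of "Suc i0"] rad_Suc[of i0] rad_pos rad_le by (auto simp: r_def)
    have \<kappa>t: "\<kappa> * t \<le> t" "0 < \<kappa> * t" using \<kappa> t by (auto simp: mult_left_le_one_le)
    have b: "b \<in> axis_line f" by (simp add: b_def axis_line_def axis_def)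
    obtain i where i: "\<And>y. y \<in> cball (top_pt (Suc i0) b) (r / 8) \<Longrightarrow> lev i0 \<le> u i y"
      using J[OF order_trans[OF j i0(2)] b] unfolding reach_def r_def by blast
    have rho: "0 < \<rho>" "4 * \<rho> = \<kappa> * t" "4 * \<rho> \<le> t" using \<kappa>t by (auto simp: \<rho>_def)
    have "hf ^ k * lev i0 \<le> u i x"
    proof (rule harnack_chain)
      show "0 < \<rho>" by (rule rho)
      show "3 * \<rho> < top_pt (Suc i0) b $ n" "tn (top_pt (Suc i0) b) + 3 * \<rho> \<le> rad i0"
        using on_line(3,4)[OF b, of "Suc i0"] r rho unfolding r_def[symmetric] by linarith+
      show "3 * \<rho> < x $ n" using x(3) rho unfolding t_def[symmetric] by linarith
      show "tn x + 3 * \<rho> \<le> rad i0" unfolding t_def[symmetric] using rho r by linarith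
      show "0 < lev i0" by (rule lev_pos)
      show "exp (- mu \<omega> (rad i0)) * lev i0 powr (p - 1) * \<rho>\<^sup>2 \<le> hl"
        by (rule lev_level) (use r rho in linarith)+
      show "lev i0 \<le> u i y" if "y \<in> cball (top_pt (Suc i0) b) \<rho>" for y
      proof (rule i)
        have "\<rho> \<le> r / 8" using r rho by linarith
        then show "y \<in> cball (top_pt (Suc i0) b) (r / 8)" using that by simp
      qed
      show "x \<in> cball x \<rho>" using rho by simp
      have "norm (x - top_pt (Suc i0) b) \<le> norm (x - b) + norm ((r / 2) *\<^sub>R (axis n 1 :: real ^ 'n))"
        using norm_triangle_ineq4[of "x - b" "(r / 2) *\<^sub>R (axis n 1 :: real ^ 'n)"]
        by (simp add: top_pt_def r_def diff_diff_eq)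
      also have "\<dots> = t + r / 2" using r by (simp add: b_def norm_minus_axis t_def)
      also have "\<dots> \<le> 3 * t" using r by simp
      also have "\<dots> = 12 / \<kappa> * \<rho>" using \<kappa> by (simp add: \<rho>_def)
      also have "\<dots> \<le> real k * \<rho>" using k \<kappa>t by (intro mult_right_mono) (auto simp: \<rho>_def)
      finally show "norm (x - top_pt (Suc i0) b) \<le> real k * \<rho>" .
    qed
    also have "u i x \<le> u_lim x" by (rule u_le_lim[OF x(1)])
    also have "hf ^ k * lev j \<le> hf ^ k * lev i0" using lev_mono[OF i0(2)] hf by (intro mult_left_mono) auto
    finally show "hf ^ k * lev j \<le> u_lim x" .
  qed
qed

text \<open>By \<open>mur_gap\<close> the quotient of consecutive levels is eventually at least
  \<open>2 ^ Suc q\<close>, so the product with \<open>rad j ^ q\<close> at least doubles at each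
  index.\<close>

lemma lev_growth: "filterlim (\<lambda>j. lev j * rad j ^ q) at_top sequentially"
proof -
  define y where "y j = lev j * rad j ^ q" for j
  have y: "0 < y j" for j using lev_pos rad_pos by (simp add: y_def)
  have "\<forall>\<^sub>F j in sequentially. (p - 1) * (real (Suc q) * ln 2) \<le> mur (Suc j) - mur j" by (rule mur_gap)
  then have "\<forall>\<^sub>F j in sequentially. 2 * y j \<le> y (Suc j)"
  proof eventually_elim
    case (elim j)
    have "real (Suc q) * ln 2 \<le> (mur (Suc j) - mur j) / (p - 1)" using elim p by (simp add: pos_le_divide_eq mult.commute)
    then have "exp (real (Suc q) * ln 2) \<le> exp ((mur (Suc j) - mur j) / (p - 1))" by simp
    then have e: "2 ^ Suc q \<le> exp ((mur (Suc j) - mur j) / (p - 1))" by (simp only: exp_of_nat_mult) simp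
    have "lev i = hl powr (1 / (p - 1)) * exp (mur i / (p - 1))" for i
      by (simp add: lev_def powr_mult exp_powr_real)
    then have "lev (Suc j) = lev j * exp ((mur (Suc j) - mur j) / (p - 1))"
      by (simp add: diff_divide_distrib flip: exp_add)
    then have "lev j * 2 ^ Suc q \<le> lev (Suc j)" using e lev_pos[of j] by simp
    then have "lev j * 2 ^ Suc q * rad (Suc j) ^ q \<le> y (Suc j)" unfolding y_def
      using rad_pos[of "Suc j"] by (intro mult_right_mono) auto
    then show ?case by (simp add: y_def rad_Suc power_divide)
  qed
  then obtain J where J: "\<And>j. J \<le> j \<Longrightarrow> 2 * y j \<le> y (Suc j)" by (auto simp: eventually_sequentially)
  have g: "2 ^ i * y J \<le> y (i + J)" for i
  proof (induction i)
    case (Suc i)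
    then show ?case using J[of "i + J"] by simp
  qed simp
  show ?thesis unfolding y_def[symmetric] filterlim_at_top eventually_sequentially
  proof
    fix Z
    obtain i0 where i0: "Z < real i0 * y J" using reals_Archimedean3[OF y] by blast
    have "Z \<le> y j" if j: "J + i0 \<le> j" for j
    proof -
      define i where "i = j - J"
      have i: "j = i + J" "i0 \<le> i" using j by (auto simp: i_def)
      have "real i0 \<le> 2 ^ i" using i(2) of_nat_less_two_power[of i, where 'a=real] by linarith
      then have "real i0 * y J \<le> 2 ^ i * y J" using y[of J] by (intro mult_right_mono) auto
      then show ?thesis using g[of i] i0 i(1) by simp
    qed
    then show "\<exists>N. \<forall>j\<ge>N. Z \<le> y j" by blast
  qed
qed

lemma u_lim_wedge:
  assumes b: "b \<in> axis_line f" and \<kappa>: "0 < \<kappa>"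
  shows "filterlim u_lim at_top (at b within {x \<in> \<Omega>. \<kappa> * tn x \<le> x $ n})"
  unfolding filterlim_at_top
proof
  fix Z
  \<comment> \<open>\<open>wedge_lower\<close> is stated for slopes at most \<open>1\<close>; a
    wedge of larger slope is contained in the one of slope \<open>1\<close>.\<close>
  define \<kappa>' where "\<kappa>' = min \<kappa> 1"
  have \<kappa>': "0 < \<kappa>'" "\<kappa>' \<le> 1" using \<kappa> by (auto simp: \<kappa>'_def)
  obtain J k where J: "\<And>j x. \<lbrakk>J \<le> j; x \<in> \<Omega>; tn x \<le> rad (Suc j) / 2; \<kappa>' * tn x \<le> x $ n\<rbrakk> \<Longrightarrow> hf ^ k * lev j \<le> u_lim x"
    using wedge_lower[OF \<kappa>'] by blast
  have "\<forall>\<^sub>F j in sequentially. Z / hf ^ k \<le> lev j * rad j ^ 0" using lev_growth unfolding filterlim_at_top by blast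
  then have "\<forall>\<^sub>F j in sequentially. J \<le> j \<and> Z / hf ^ k \<le> lev j"
    by (intro eventually_conj eventually_ge_at_top) simp
  then obtain j where j: "J \<le> j" "Z / hf ^ k \<le> lev j" by (auto simp: eventually_sequentially)
  have Z: "Z \<le> hf ^ k * lev j" using j(2) hf by (simp add: pos_divide_le_eq mult.commute)
  show "\<forall>\<^sub>F x in at b within {x \<in> \<Omega>. \<kappa> * tn x \<le> x $ n}. Z \<le> u_lim x"
    unfolding eventually_at
  proof (intro exI conjI ballI impI)
    show "0 < rad (Suc j) / 2" using rad_pos by simp
    fix x assume x: "x \<in> {x \<in> \<Omega>. \<kappa> * tn x \<le> x $ n}" "x \<noteq> b \<and> dist x b < rad (Suc j) / 2"
    have "tn x \<le> rad (Suc j) / 2"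
      using transverse_norm_lipschitz[of f x b] on_line(2)[OF b] x by (simp add: dist_norm)
    moreover have "\<kappa>' * tn x \<le> \<kappa> * tn x"
      using transverse_norm_nonneg[of f x] by (intro mult_right_mono) (auto simp: \<kappa>'_def)
    ultimately show "Z \<le> u_lim x" using J[OF j(1), of x] x Z by force
  qed
qed

text \<open>Near \<open>b\<close>, the slice at height \<open>e\<close> contains a box of length
  \<open>r\<close> along the line and side \<open>e / CARD('n)\<close> in the other
  \<open>CARD('n) - 2\<close> directions. It lies in the wedge of slope \<open>1 / 2\<close>, where
  \<open>u_lim\<close> is at least a multiple of \<open>lev j\<close> with \<open>rad j\<close>
  comparable to \<open>e\<close>, and by \<open>lev_growth\<close> this outweighs the small volume
  of the box.\<close>

lemma u_lim_slice:
  assumes b: "b \<in> axis_line f" and r: "0 < r"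
  shows "(slice_mass n u_lim b r \<longlongrightarrow> \<infinity>) (at_right 0)"
  unfolding infinity_ennreal_def tendsto_top_iff_ennreal
proof (intro allI impI)
  fix l :: real assume l: "0 \<le> l"
  let ?N = "CARD('n)"
  define q where "q = ?N - 2"
  have N0: "0 < real ?N" using N by simp
  have half: "0 < (1 / 2 :: real)" "(1 / 2 :: real) \<le> 1" by auto
  obtain J k where J: "\<And>j x. \<lbrakk>J \<le> j; x \<in> \<Omega>; tn x \<le> rad (Suc j) / 2; 1 / 2 * tn x \<le> x $ n\<rbrakk> \<Longrightarrow> hf ^ k * lev j \<le> u_lim x"
    using wedge_lower[OF half] by blast
  \<comment> \<open>All factors except \<open>lev j * rad j ^ q\<close>; the \<open>16\<close> comes
    from \<open>rad j / 16 < e\<close>.\<close>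
  define c where "c = hf ^ k * r * (1 / (16 * real ?N)) ^ q"
  have c: "0 < c" using hf r N0 by (simp add: c_def)
  have "\<forall>\<^sub>F j in sequentially. (l + 1) / c \<le> lev j * rad j ^ q" using lev_growth unfolding filterlim_at_top by blast
  then obtain J3 where J3: "\<And>j. J3 \<le> j \<Longrightarrow> (l + 1) / c \<le> lev j * rad j ^ q" by (auto simp: eventually_sequentially)
  define J' where "J' = max J J3"
  have main: "ennreal l < slice_mass n u_lim b r e" if e: "0 < e" "e < min (r / 4) (rad (Suc J') / 4)" for e
  proof -
    have "0 < 4 * e" "4 * e \<le> rad (Suc J')" using e by auto
    then obtain j' where j': "Suc J' \<le> j'" "rad (Suc j') < 4 * e" "4 * e \<le> rad j'" using dyadic_interval by blast
    then obtain j where j: "j' = Suc j" "J' \<le> j" by (cases j') auto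
    have ej: "rad j / 16 < e" "4 * e \<le> rad (Suc j)" using j' j by (auto simp: rad_Suc)
    \<comment> \<open>With the side \<open>e / ?N\<close> the coordinates other than those of
      \<open>f\<close> and \<open>n\<close> add up to at most \<open>e\<close>, hence
      \<open>tn x \<le> 2 * e\<close>.\<close>
    define B where "B i = (if i = f then {b $ f - r / 2<..<b $ f + r / 2} else {0<..<e / real ?N})" for i
    define A where "A = (\<Pi>\<^sub>E i\<in>UNIV - {n}. B i)"
    define M where "M = Pi\<^sub>M (UNIV - {n}) (\<lambda>_. lborel :: real measure)"
    interpret product_sigma_finite "\<lambda>_ :: 'n. lborel :: real measure"
      by (intro product_sigma_finite.intro sigma_finite_lborel)
    have A: "A \<in> sets M" unfolding A_def M_def by (rule sets_PiM_I_finite) (auto simp: B_def)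
    have emA: "emeasure M A = ennreal (r * (e / real ?N) ^ q)"
    proof -
      have "emeasure M A = (\<Prod>i\<in>UNIV - {n}. emeasure lborel (B i))"
        unfolding A_def M_def by (rule emeasure_PiM) (auto simp: B_def)
      also have "\<dots> = emeasure lborel (B f) * (\<Prod>i\<in>UNIV - {n} - {f}. emeasure lborel (B i))"
        using fn by (subst prod.remove[of _ f]) auto
      also have "emeasure lborel (B f) = ennreal r" using r by (simp add: B_def)
      also have "(\<Prod>i\<in>UNIV - {n} - {f}. emeasure lborel (B i)) = (\<Prod>i\<in>UNIV - {n} - {f}. ennreal (e / real ?N))"
        using e N0 by (intro prod.cong) (auto simp: B_def)
      also have "\<dots> = ennreal ((e / real ?N) ^ q)"
        using e N0 fn by (simp add: card_Diff_singleton q_def ennreal_power numeral_2_eq_2)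
      finally show ?thesis using r by (simp add: ennreal_mult')
    qed
    have pt: "ennreal (hf ^ k * lev j) * indicator A y \<le>
        (let x = (\<chi> i. if i = n then e else y i) in ennreal (u_lim x) * indicator (ball b r) x)" for y
    proof (cases "y \<in> A")
      case True
      define x :: "real ^ 'n" where "x = (\<chi> i. if i = n then e else y i)"
      have yB: "y i \<in> B i" if "i \<noteq> n" for i using True that by (auto simp: A_def)
      have xn: "x $ n = e" by (simp add: x_def)
      have xf: "\<bar>x $ f - b $ f\<bar> < r / 2" unfolding abs_less_iff using yB[OF fn] fn by (auto simp: x_def B_def)
      have xi: "\<bar>x $ i\<bar> \<le> e / real ?N" if "i \<noteq> n" "i \<noteq> f" for i
        using yB[OF that(1)] that by (auto simp: x_def B_def)
      have xO: "x \<in> \<Omega>" using e by (simp add: half_space_def xn)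
      have tx: "tn x \<le> 2 * e"
      proof -
        have "tn x \<le> (\<Sum>i\<in>UNIV - {f}. \<bar>x $ i\<bar>)"
          unfolding transverse_norm_L2 by (rule L2_set_le_sum_abs)
        also have "\<dots> = \<bar>x $ n\<bar> + (\<Sum>i\<in>UNIV - {f} - {n}. \<bar>x $ i\<bar>)"
          using fn by (subst sum.remove[of _ n]) auto
        also have "(\<Sum>i\<in>UNIV - {f} - {n}. \<bar>x $ i\<bar>) \<le> (\<Sum>i\<in>(UNIV :: 'n set). e / real ?N)"
          using xi e N0 by (intro order_trans[OF sum_mono sum_mono2]) auto
        also have "\<dots> = e" using N0 by simp
        finally show ?thesis using e by (simp add: xn)
      qed
      have "hf ^ k * lev j \<le> u_lim x"
        by (rule J) (use j xO tx ej e in \<open>auto simp: J'_def xn\<close>)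
      moreover have "x \<in> ball b r"
      proof -
        have "b $ i = 0" if "i \<noteq> f" for i using b that by (simp add: axis_line_def)
        then have "x - b = (x - axis f (x $ f)) + (x $ f - b $ f) *\<^sub>R axis f 1"
          by (simp add: vec_eq_iff axis_def)
        then have "norm (x - b) \<le> norm (x - axis f (x $ f)) + norm ((x $ f - b $ f) *\<^sub>R (axis f 1 :: real ^ 'n))"
          using norm_triangle_ineq by metis
        then have "norm (x - b) \<le> tn x + \<bar>x $ f - b $ f\<bar>" by (simp add: norm_minus_axis)
        then show ?thesis using tx xf e by (simp add: dist_norm norm_minus_commute)
      qed
      ultimately show ?thesis using True by (simp add: x_def[symmetric] ennreal_leI)
    qed simp
    have "ennreal l < ennreal (hf ^ k * lev j * (r * (e / real ?N) ^ q))"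
    proof (rule ennreal_lessI)
      have "(rad j / 16 / real ?N) ^ q \<le> (e / real ?N) ^ q"
        using ej N0 rad_pos[of j] by (intro power_mono divide_right_mono) auto
      then have "hf ^ k * lev j * (r * (rad j / 16 / real ?N) ^ q) \<le> hf ^ k * lev j * (r * (e / real ?N) ^ q)"
        using hf lev_pos[of j] r by (intro mult_left_mono) auto
      moreover have "hf ^ k * lev j * (r * (rad j / 16 / real ?N) ^ q) = c * (lev j * rad j ^ q)"
        by (simp add: c_def power_divide power_mult_distrib)
      moreover have "l + 1 \<le> c * (lev j * rad j ^ q)"
        using J3[of j] j c by (simp add: J'_def pos_divide_le_eq mult.commute)
      ultimately show "l < hf ^ k * lev j * (r * (e / real ?N) ^ q)" by linarith
      then show "0 < hf ^ k * lev j * (r * (e / real ?N) ^ q)" using l by linarith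
    qed
    also have "\<dots> = ennreal (hf ^ k * lev j) * emeasure M A"
      unfolding emA using hf lev_pos[of j] by (subst ennreal_mult') auto
    also have "\<dots> = (\<integral>\<^sup>+y. ennreal (hf ^ k * lev j) * indicator A y \<partial>M)"
      using A by (simp add: nn_integral_cmult_indicator)
    also have "\<dots> \<le> slice_mass n u_lim b r e"
      unfolding slice_mass_def M_def[symmetric] by (intro nn_integral_mono pt)
    finally show ?thesis .
  qed
  have "0 < min (r / 4) (rad (Suc J') / 4)" using r rad_pos[of "Suc J'"] by simp
  then show "\<forall>\<^sub>F e in at_right 0. ennreal l < slice_mass n u_lim b r e"
    unfolding eventually_at_right_field using main by blast
qed

lemma u_lim_infinite: "boundary_value_infinite_on n f (frontier \<Omega> \<inter> axis_line f) u_lim"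
  unfolding boundary_value_infinite_on_def using u_lim_wedge u_lim_slice by auto

end

theorem theorem1p2:
  fixes f n :: "'n::finite"
    and a :: "real ^ 'n"
    and p :: real
    and \<omega> :: "real \<Rightarrow> real"
    and K :: "nat \<Rightarrow> real"
    and u :: "nat \<Rightarrow> real ^ 'n \<Rightarrow> real"
  defines "\<Omega> \<equiv> half_space n"
    and "L \<equiv> axis_line f"
    and "g \<equiv> (\<lambda>x. h_weight \<omega> (transverse_norm f x))"
    and "u_lim \<equiv> (\<lambda>x. lim (\<lambda>j. u j x))"
  assumes "CARD('n) \<ge> 2" and "f \<noteq> n"
    and "a \<in> L"
    and "1 < p" and "p < 1 + 2 / (real CARD('n) - 1)"
    and "continuous_on {0<..} \<omega>"
    and "\<forall>s>0. \<omega> s > 0"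
    and "mono_on {0<..} \<omega>"
    and "antimono_on {0<..} (mu \<omega>)"
    and "filterlim (mu \<omega>) at_top (at_right 0)"
    and "limsup (\<lambda>j. ereal (mu \<omega> (2 powr (- real j + 1)) / mu \<omega> (2 powr (- real j)))) < 1"
    and "(\<omega> \<longlongrightarrow> 0) (at_right 0)"
    and "(\<integral>\<^sup>+s\<in>{0<..<1}. ennreal (\<omega> s / s) \<partial>lborel) = \<infinity>"
    and "\<forall>j. K j > 0" and "mono K" and "filterlim K at_top sequentially"
    and "\<forall>j. dirac_boundary_solution n g p (K j) a (u j)"
  shows "(\<forall>x\<in>\<Omega>. convergent (\<lambda>j. u j x)) \<and>
    interior_solution n g p u_lim \<and>
    boundary_value_zero_on n (frontier \<Omega> - L) u_lim \<and>
    boundary_value_infinite_on n f (frontier \<Omega> \<inter> L) u_lim"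
proof -
  interpret P: propagating_absorption f n a p \<omega> K u g
    using assms unfolding L_def by unfold_locales (simp_all add: g_def)
  have "u_lim = P.u_lim" by (simp add: u_lim_def P.u_lim_def[abs_def])
  then show ?thesis
    using P.u_convergent P.u_lim_interior P.u_lim_zero P.u_lim_infinite by (simp add: \<Omega>_def L_def)
qed

end
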